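(* Let $d\ge 1$, $r>d/2$, $0\le q<s$ and $s>d/2+r$. Assume that the sampling measures satisfy, with a constant $C_1$ independent of $m$, $$\|\nu_m\|_{H^{-r}}\le C_1\,\delta_m^{r}\qquad\text{for all } m .$$ Assume moreover that the spectral multiplier operators $\mathcal T_n$ satisfy, with constants $C_2,C_3$ independent of $n$, the approximation estimate $$\|f-\mathcal T_n f\|_{H^q}\le C_2\, n^{-(s-q)}\|f\|_{H^s}\qquad\text{for all } f\in H^s(\mathbb S^d),\ n\ge 1,$$ and the smoothing estimate $$\|\mathcal T_n u\|_{H^q}\le C_3\, n^{r+q}\|u\|_{H^{-r}}\qquad\text{for all } u\in H^{-r}(\mathbb S^d),\ n\ge1 .$$ Then there is a constant $C>0$, independent of $m$, $n$ and $f$, such that for all $m$, all $n\ge1$ and all $f\in H^s(\mathbb S^d)$, $$\|f-\mathcal F_n f\|_{H^q}\le C\left(n^{-(s-q)}+\delta_m^{r}\,n^{r+q}\right)\|f\|_{H^s}.$$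
   Context: $\mathbb S^d=\{x\in\mathbb R^{d+1}:|x|=1\}$ carries the normalized surface measure $\sigma$ ($\sigma(\mathbb S^d)=1$) and the geodesic distance $\rho(x,y)=\arccos(x\cdot y)$. For each $\ell\ge0$, $\{Y_{\ell,k}:1\le k\le Z(d,\ell)\}$ is an $L^2(\mathbb S^d,\sigma)$-orthonormal basis of the (real) spherical harmonics of degree $\ell$; $-\Delta_{\mathbb S^d}Y_{\ell,k}=\lambda_\ell Y_{\ell,k}$ with $\lambda_\ell=\ell(\ell+d-1)$. For a distribution $u$ put $\widehat u_{\ell,k}=\langle u,Y_{\ell,k}\rangle$. For $s\in\mathbb R$, $H^s(\mathbb S^d)$ is the space of distributions with $\|u\|_{H^s}^2=\sum_{\ell\ge0}(1+\lambda_\ell)^s\sum_k|\widehat u_{\ell,k}|^2<\infty$; for $s>0$, $H^{-s}$ is the dual of $H^s$ under the $L^2$-pairing. For $s>d/2$ elements of $H^s$ are identified with their continuous representatives. Sampling: for each $m$ (in an infinite set of positive integers) there are a point set $\mathcal X_m=\{x_j\}_{j=1}^m\subset\mathbb S^d$ and weights $w_j>0$ with $\sum_{j=1}^m w_j=1$ (points and weights may depend on $m$). The mesh norm is $\delta_m=\sup_{x\in\mathbb S^d}\min_{1\le j\le m}\rho(x,x_j)$. Set $\mu_m=\sum_{j=1}^m w_j\delta_{x_j}$ (here $\delta_{x_j}$ is the Dirac mass at $x_j$) and $\nu_m=\mu_m-\sigma$. Operators: for $n\ge1$ let $\eta_n:[0,\infty)\to\mathbb R$ be a function (spectral multiplier),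 $\Phi_n(x,y)=\sum_{\ell\ge0}\eta_n(\lambda_\ell)\sum_k Y_{\ell,k}(x)Y_{\ell,k}(y)$, and $\mathcal T_nf(x)=\int_{\mathbb S^d}\Phi_n(x,y)f(y)\,d\sigma(y)$, extended to distributions by $\mathcal T_nu(x)=\langle u,\Phi_n(x,\cdot)\rangle$, i.e. $\mathcal T_nu=\sum_\ell\eta_n(\lambda_\ell)\sum_k\widehat u_{\ell,k}Y_{\ell,k}$. The spectral multiplier hyperinterpolation operator is $\mathcal F_nf=\sum_{j=1}^m w_jf(x_j)\Phi_n(\cdot,x_j)$, where $\Phi_n(\cdot,y)=\mathcal T_n\delta_y$; it depends on $m$ as well as $n$. *)

theory Defs
  imports "HOL-Analysis.Analysis"
begin

section \<open>Normalized surface measure and geodesic distance on the unit sphere\<close>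

text \<open>
  The sphere is \<^term>\<open>sphere 0 1\<close> in a Euclidean space of dimension \<open>d + 1\<close>. The normalized surface
  measure of \<open>A\<close> is the relative volume in the unit ball of the cone over \<open>A\<close>, that is, the image
  of the uniform distribution on the ball under \<open>x \<mapsto> x / |x|\<close> (\<^const>\<open>sgn\<close>). The space of the measure
  is the sphere itself, so integrals do not see the values of functions off the sphere.
\<close>

definition sphere_measure :: "'a::euclidean_space measure" where
  "sphere_measure = restrict_space (distr (uniform_measure lborel (ball 0 1)) borel sgn) (sphere 0 1)"

definition geodist :: "'a::euclidean_space \<Rightarrow> 'a \<Rightarrow> real" where
  "geodist x y = arccos (x \<bullet> y)"


section \<open>Test functions and distributions on the sphere\<close>

text \<open>
  Functions on the sphere are represented by functions on the ambient space; only their values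
  on the sphere matter. Smoothness and the \<open>C\<^sup>N\<close> norms are those of the extension
  \<open>x \<mapsto> \<phi> (x / |x|)\<close>, constant along rays.
\<close>

primrec partials :: "'a list \<Rightarrow> ('a::euclidean_space \<Rightarrow> real) \<Rightarrow> 'a \<Rightarrow> real" where
  "partials [] f = f"
| "partials (b # bs) f = (\<lambda>x. deriv (\<lambda>t. partials bs f (x + t *\<^sub>R b)) 0)"

definition smooth_on :: "'a::euclidean_space set \<Rightarrow> ('a \<Rightarrow> real) \<Rightarrow> bool" where
  "smooth_on U f \<longleftrightarrow> (\<forall>bs. set bs \<subseteq> Basis \<longrightarrow> (\<forall>x\<in>U. partials bs f differentiable (at x)))"

definition test_functions :: "('a::euclidean_space \<Rightarrow> real) set" where
  "test_functions = {\<phi>. smooth_on (- {0}) (\<lambda>x. \<phi> (sgn x))}"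

definition Ck_norm :: "nat \<Rightarrow> ('a::euclidean_space \<Rightarrow> real) \<Rightarrow> real" where
  "Ck_norm N \<phi> = (SUP (bs, x) \<in> {bs. set bs \<subseteq> Basis \<and> length bs \<le> N} \<times> sphere 0 1.
                    \<bar>partials bs (\<lambda>y. \<phi> (sgn y)) x\<bar>)"

text \<open>
  A distribution is a continuous linear functional on the test functions. The continuity estimate
  forces the value at \<open>\<phi>\<close> to depend only on the restriction of \<open>\<phi>\<close> to the sphere; the values of the
  functional at functions that are not test functions are irrelevant.
\<close>

type_synonym 'a functional = "('a \<Rightarrow> real) \<Rightarrow> real"

definition distribution :: "'a::euclidean_space functional \<Rightarrow> bool" where
  "distribution u \<longleftrightarrow>
     (\<forall>\<phi>\<in>test_functions. \<forall>\<psi>\<in>test_functions. u (\<lambda>x. \<phi> x + \<psi> x) = u \<phi> + u \<psi>) \<and>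
     (\<forall>\<phi>\<in>test_functions. \<forall>c. u (\<lambda>x. c * \<phi> x) = c * u \<phi>) \<and>
     (\<exists>N C. \<forall>\<phi>\<in>test_functions. \<bar>u \<phi>\<bar> \<le> C * Ck_norm N \<phi>)"

definition of_fun :: "('a::euclidean_space \<Rightarrow> real) \<Rightarrow> 'a functional" where
  "of_fun f = (\<lambda>\<phi>. \<integral>x. f x * \<phi> x \<partial>sphere_measure)"

definition dirac :: "'a::euclidean_space \<Rightarrow> 'a functional" where
  "dirac y = (\<lambda>\<phi>. \<phi> y)"


section \<open>Spherical harmonics\<close>

definition laplacian :: "('a::euclidean_space \<Rightarrow> real) \<Rightarrow> 'a \<Rightarrow> real" where
  "laplacian p x = (\<Sum>b\<in>Basis. partials [b, b] p x)"

definition spherical_harmonics :: "nat \<Rightarrow> ('a::euclidean_space \<Rightarrow> real) set" where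
  "spherical_harmonics l =
     {f. \<exists>p. real_polynomial_function p \<and> (\<forall>c x. p (c *\<^sub>R x) = c ^ l * p x) \<and>
             (\<forall>x. laplacian p x = 0) \<and> (\<forall>x\<in>sphere 0 1. f x = p x)}"

text \<open>\<open>Z l\<close> is forced to be the dimension of the space of spherical harmonics of degree \<open>l\<close>.\<close>

definition harmonic_basis :: "(nat \<Rightarrow> nat) \<Rightarrow> (nat \<Rightarrow> nat \<Rightarrow> 'a::euclidean_space \<Rightarrow> real) \<Rightarrow> bool" where
  "harmonic_basis Z Y \<longleftrightarrow> (\<forall>l.
     (\<forall>k\<in>{1..Z l}. Y l k \<in> spherical_harmonics l) \<and>
     (\<forall>k\<in>{1..Z l}. \<forall>k'\<in>{1..Z l}.
        (\<integral>x. Y l k x * Y l k' x \<partial>sphere_measure) = (if k = k' then 1 else 0)) \<and>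
     (\<forall>f\<in>spherical_harmonics l. \<exists>c. \<forall>x\<in>sphere 0 1. f x = (\<Sum>k=1..Z l. c k * Y l k x)))"

definition eigval :: "nat \<Rightarrow> nat \<Rightarrow> real" where
  "eigval d l = real l * (real l + real d - 1)"


section \<open>Sobolev spaces\<close>

definition sobolev_term ::
  "nat \<Rightarrow> (nat \<Rightarrow> nat) \<Rightarrow> (nat \<Rightarrow> nat \<Rightarrow> 'a::euclidean_space \<Rightarrow> real) \<Rightarrow> real \<Rightarrow> 'a functional \<Rightarrow> nat \<Rightarrow> real"
  where "sobolev_term d Z Y s u l = (1 + eigval d l) powr s * (\<Sum>k=1..Z l. \<bar>u (Y l k)\<bar>\<^sup>2)"

definition sobolev ::
  "nat \<Rightarrow> (nat \<Rightarrow> nat) \<Rightarrow> (nat \<Rightarrow> nat \<Rightarrow> 'a::euclidean_space \<Rightarrow> real) \<Rightarrow> real \<Rightarrow> 'a functional set"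
  where "sobolev d Z Y s = {u. distribution u \<and> summable (sobolev_term d Z Y s u)}"

definition sobolev_norm ::
  "nat \<Rightarrow> (nat \<Rightarrow> nat) \<Rightarrow> (nat \<Rightarrow> nat \<Rightarrow> 'a::euclidean_space \<Rightarrow> real) \<Rightarrow> real \<Rightarrow> 'a functional \<Rightarrow> real"
  where "sobolev_norm d Z Y s u = sqrt (\<Sum>l. sobolev_term d Z Y s u l)"

text \<open>
  For \<open>s > d / 2\<close> the elements of the Sobolev space of order \<open>s\<close> are identified with their continuous
  representatives.
\<close>

definition sobolev_fun ::
  "nat \<Rightarrow> (nat \<Rightarrow> nat) \<Rightarrow> (nat \<Rightarrow> nat \<Rightarrow> 'a::euclidean_space \<Rightarrow> real) \<Rightarrow> real \<Rightarrow> ('a \<Rightarrow> real) set"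
  where "sobolev_fun d Z Y s = {f. continuous_on (sphere 0 1) f \<and> of_fun f \<in> sobolev d Z Y s}"


section \<open>Sampling measures\<close>

definition mesh_norm :: "nat \<Rightarrow> (nat \<Rightarrow> 'a::euclidean_space) \<Rightarrow> real" where
  "mesh_norm m x = (SUP y\<in>sphere 0 1. Min ((\<lambda>j. geodist y (x j)) ` {1..m}))"

definition sampling_measure :: "nat \<Rightarrow> (nat \<Rightarrow> real) \<Rightarrow> (nat \<Rightarrow> 'a::euclidean_space) \<Rightarrow> 'a functional" where
  "sampling_measure m w x = (\<lambda>\<phi>. \<Sum>j=1..m. w j * dirac (x j) \<phi>)"

definition sampling_error :: "nat \<Rightarrow> (nat \<Rightarrow> real) \<Rightarrow> (nat \<Rightarrow> 'a::euclidean_space) \<Rightarrow> 'a functional" where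
  "sampling_error m w x = sampling_measure m w x - (\<lambda>\<phi>. \<integral>y. \<phi> y \<partial>sphere_measure)"


section \<open>Spectral multiplier operators and hyperinterpolation\<close>

text \<open>
  The series is taken in the sense of distributions. It need not converge for an arbitrary multiplier
  \<open>\<eta>\<close>, but it does, on every test function, whenever the result lies in a Sobolev space
  of order \<open>q \<ge> 0\<close>.
\<close>

definition multiplier_op ::
  "nat \<Rightarrow> (nat \<Rightarrow> nat) \<Rightarrow> (nat \<Rightarrow> nat \<Rightarrow> 'a::euclidean_space \<Rightarrow> real) \<Rightarrow> (real \<Rightarrow> real)
     \<Rightarrow> 'a functional \<Rightarrow> 'a functional"
  where "multiplier_op d Z Y \<eta> u =
    (\<lambda>\<phi>. \<Sum>l. \<eta> (eigval d l) * (\<Sum>k=1..Z l. u (Y l k) * of_fun (Y l k) \<phi>))"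

text \<open>The kernel slice \<open>\<Phi>(\<cdot>, y)\<close>; it is a distribution and need not be a continuous function.\<close>

definition kernel ::
  "nat \<Rightarrow> (nat \<Rightarrow> nat) \<Rightarrow> (nat \<Rightarrow> nat \<Rightarrow> 'a::euclidean_space \<Rightarrow> real) \<Rightarrow> (real \<Rightarrow> real)
     \<Rightarrow> 'a \<Rightarrow> 'a functional"
  where "kernel d Z Y \<eta> y = multiplier_op d Z Y \<eta> (dirac y)"

definition hyperinterpolation ::
  "nat \<Rightarrow> (nat \<Rightarrow> nat) \<Rightarrow> (nat \<Rightarrow> nat \<Rightarrow> 'a::euclidean_space \<Rightarrow> real) \<Rightarrow> (real \<Rightarrow> real)
     \<Rightarrow> nat \<Rightarrow> (nat \<Rightarrow> real) \<Rightarrow> (nat \<Rightarrow> 'a) \<Rightarrow> ('a \<Rightarrow> real) \<Rightarrow> 'a functional"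
  where "hyperinterpolation d Z Y \<eta> m w x f =
    (\<lambda>\<phi>. \<Sum>j=1..m. w j * f (x j) * kernel d Z Y \<eta> (x j) \<phi>)"

end

theory Submission
  imports Defs "HOL-Probability.Probability_Measure"
begin

text \<open>
  Write \<open>F f = T (f \<mu>)\<close>, so that \<open>f - F f = (f - T f) - T (f \<nu>)\<close>. The first term is the approximation
  estimate. By the smoothing estimate, the second is controlled by the \<open>H\<^sup>-\<^sup>r\<close> norm of \<open>f \<nu>\<close>, and the
  heart of the matter is the dual form of a multiplier estimate, \<open>|f \<nu>|\<^sub>-\<^sub>r \<le> K |f|\<^sub>s |\<nu>|\<^sub>-\<^sub>r\<close>.

  Expand \<open>f = \<Sum>\<^sub>l f\<^sub>l\<close> into spherical harmonics. Multiplication by \<open>f\<^sub>l\<close> raises the degree by at most \<open>l\<close>,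
  so Bessel's inequality for the tails and summation by parts bound its norm on \<open>H\<^sup>r\<close> by a multiple of
  \<open>(1 + \<lambda>\<^sub>l)\<^sup>r\<^sup>/\<^sup>2 sup |f\<^sub>l|\<close>. The addition theorem gives \<open>sup |f\<^sub>l| \<le> \<surd>Z\<^sub>l |f\<^sub>l|\<^sub>L\<^sub>2\<close>. By Cauchy-Schwarz the
  bounds are summable in \<open>l\<close> as soon as \<open>\<Sum>\<^sub>l (1 + \<lambda>\<^sub>l)\<^sup>r\<^sup>-\<^sup>s Z\<^sub>l\<close> converges. For \<open>s - r > d / 2\<close> this follows from
  \<open>\<Sum>\<^sub>l\<^sub><\<^sub>N Z\<^sub>l = O(N\<^sup>d)\<close> by summation by parts.
\<close>

section \<open>The surface measure\<close>

text \<open>The obstacle is that \<open>r\<close> is a real order and Sobolev norms exist only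
  through coefficients, so neither a product rule nor an intrinsic norm is at hand; the multiplier
  estimate has to be read off degrees alone. The dual side is convenient because
  \<open>\<nu>\<close> is a measure: it pairs with every continuous function, so
  \<open>\<nu> (\<lambda>y. f y * \<phi> y)\<close> makes sense although \<open>f\<close> need not
  be smooth, and uniform approximations of \<open>f\<close> pass through it. The condition
  \<open>r > d / 2\<close> puts measures, Dirac masses included, into the space of order
  \<open>- r\<close>; hence the sampling bound concerns a convergent series, and the smoothing
  estimate covers every kernel slice.

  The basis hypothesis speaks about single degrees only. Orthogonality of different degrees,
  completeness and the dimension count are therefore derived from the definition of spherical
  harmonics, through polynomials on the ambient space and the invariance of the surface measure. The
  error is compared with its two parts only on the basis functions: the norms see nothing else,
  whereas membership also requires the functionals to be distributions.\<close>

lemma measurable_sgn_borel [measurable]: "(sgn :: 'a::euclidean_space \<Rightarrow> 'a) \<in> borel_measurable borel"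
  unfolding sgn_div_norm[abs_def] by measurable

lemma emeasure_unit_ball:
  "emeasure lborel (ball 0 1 :: 'a::euclidean_space set) \<noteq> 0"
  "emeasure lborel (ball 0 1 :: 'a::euclidean_space set) \<noteq> \<infinity>"
proof -
  show "emeasure lborel (ball 0 1 :: 'a::euclidean_space set) \<noteq> 0"
    using open_not_negligible[of "ball 0 1 :: 'a set"]
    by (simp add: negligible_iff_null_sets null_sets_def )
  show "emeasure lborel (ball 0 1 :: 'a::euclidean_space set) \<noteq> \<infinity>"
    using emeasure_lborel_ball_finite[of "0::'a" 1] by auto
qed

lemma prob_space_uniform_ball: "prob_space (uniform_measure lborel (ball 0 1 :: 'a::euclidean_space set))"
  using emeasure_unit_ball by (intro prob_space_uniform_measure) auto

text \<open>The origin is the only point that \<open>sgn\<close> does not send to the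
  sphere.\<close>

lemma AE_uniform_ball_nonzero: "AE x in uniform_measure lborel (ball 0 1). x \<noteq> (0::'a::euclidean_space)"
  using AE_lborel_singleton[of "0::'a"] by (intro AE_uniform_measureI) auto

lemma space_sphere_measure [simp]: "space sphere_measure = sphere 0 1"
  by (simp add: sphere_measure_def space_restrict_space)

lemma sets_sphere_measure [measurable_cong]:
  "sets sphere_measure = sets (restrict_space borel (sphere 0 1))"
  unfolding sphere_measure_def by (intro sets_restrict_space_cong) simp

lemma emeasure_sphere_measure:
  assumes "A \<in> sets borel" "A \<subseteq> sphere 0 1"
  shows "emeasure (sphere_measure :: 'a::euclidean_space measure) A
           = emeasure (uniform_measure lborel (ball 0 1)) (sgn -` A)"
  using assms unfolding sphere_measure_def
  by (subst emeasure_restrict_space) (auto simp: emeasure_distr)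

lemma prob_space_sphere_measure: "prob_space (sphere_measure :: 'a::euclidean_space measure)"
proof
  interpret U: prob_space "uniform_measure lborel (ball 0 1 :: 'a set)" by (rule prob_space_uniform_ball)
  have "emeasure (uniform_measure lborel (ball 0 1)) (sgn -` sphere 0 1 :: 'a set)
      = emeasure (uniform_measure lborel (ball 0 1)) (space (uniform_measure lborel (ball 0 1 :: 'a set)))"
  proof (rule emeasure_eq_AE)
    show "AE x in uniform_measure lborel (ball 0 1 :: 'a set). (x \<in> sgn -` sphere 0 1) = (x \<in> space (uniform_measure lborel (ball 0 1)))"
      using AE_uniform_ball_nonzero by eventually_elim (simp add: norm_sgn)
  qed (auto simp: measurable_sets_borel[OF measurable_sgn_borel])
  then show "emeasure (sphere_measure :: 'a measure) (space sphere_measure) = 1"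
    using U.emeasure_space_1 by (simp add: emeasure_sphere_measure)
qed

lemma continuous_measurable_sphere:
  "continuous_on (sphere 0 1) (f :: 'a::euclidean_space \<Rightarrow> real) \<Longrightarrow> f \<in> borel_measurable sphere_measure"
  using borel_measurable_continuous_on_restrict by (simp add: measurable_cong_sets[OF sets_sphere_measure refl])

lemma continuous_sphere_bounded:
  assumes "continuous_on (sphere 0 1) (f :: 'a::euclidean_space \<Rightarrow> real)"
  obtains B where "0 \<le> B" "\<And>x. norm x = 1 \<Longrightarrow> \<bar>f x\<bar> \<le> B"
proof -
  have "bounded (f ` sphere 0 1)"
    by (intro compact_imp_bounded compact_continuous_image assms) simp
  then obtain B where "\<forall>y\<in>f ` sphere 0 1. norm y \<le> B" by (auto simp: bounded_iff)
  then show ?thesis by (intro that[of "max B 0"]) (auto intro!: max.coboundedI1)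
qed

lemma integrable_sphere:
  assumes "continuous_on (sphere 0 1) (f :: 'a::euclidean_space \<Rightarrow> real)"
  shows "integrable sphere_measure f"
proof -
  interpret prob_space "sphere_measure :: 'a measure" by (rule prob_space_sphere_measure)
  obtain B where "\<And>x. norm x = 1 \<Longrightarrow> \<bar>f x\<bar> \<le> B" using continuous_sphere_bounded[OF assms] by blast
  then show ?thesis
    by (intro integrable_const_bound[of _ B] AE_I2 continuous_measurable_sphere assms) auto
qed

lemma integral_sphere_cong:
  "(\<And>x. norm x = 1 \<Longrightarrow> f x = g x) \<Longrightarrow>
     integral\<^sup>L (sphere_measure :: 'a::euclidean_space measure) f = (integral\<^sup>L sphere_measure g :: real)"
  by (rule Bochner_Integration.integral_cong) auto

lemma integral_sphere_mono:
  fixes f g :: "'a::euclidean_space \<Rightarrow> real"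
  assumes "continuous_on (sphere 0 1) f" "continuous_on (sphere 0 1) g" "\<And>x. norm x = 1 \<Longrightarrow> f x \<le> g x"
  shows "integral\<^sup>L sphere_measure f \<le> integral\<^sup>L sphere_measure g"
  by (rule integral_mono) (auto intro: integrable_sphere assms)

lemma integral_sphere_const [simp]: "(\<integral>x. c \<partial>(sphere_measure :: 'a::euclidean_space measure)) = (c::real)"
proof -
  interpret prob_space "sphere_measure :: 'a measure" by (rule prob_space_sphere_measure)
  show ?thesis using prob_space by simp
qed

text \<open>A bridge to Lebesgue measure on the ball, where invariance is accessible. The indicator
  of the sphere matters only at the origin: \<open>sgn 0 = 0\<close>, and nothing is assumed about
  \<open>f\<close> there.\<close>

lemma integral_sphere_eq_ball:
  fixes f :: "'a::euclidean_space \<Rightarrow> real"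
  assumes "continuous_on (sphere 0 1) f"
  shows "integral\<^sup>L sphere_measure f
           = (\<integral>x. indicator (ball 0 1) x * (indicator (sphere 0 1) (sgn x) * f (sgn x)) \<partial>lborel)
               / measure lborel (ball 0 1 :: 'a set)"
proof -
  \<comment> \<open>Cutting off outside the sphere gives a Borel function on the whole space;
    \<open>f\<close> itself need not be measurable there.\<close>
  define g where "g x = indicator (sphere 0 1) x * f x" for x
  have g [measurable]: "g \<in> borel_measurable borel"
    using continuous_measurable_sphere[OF assms]
    by (subst (asm) measurable_cong_sets[OF sets_sphere_measure refl],
        subst (asm) borel_measurable_restrict_space_iff) (auto simp: g_def[abs_def])
  have "integral\<^sup>L sphere_measure f = (\<integral>x. g x \<partial>distr (uniform_measure lborel (ball 0 1)) borel sgn)"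
    unfolding sphere_measure_def by (subst integral_restrict_space) (auto simp: g_def[abs_def])
  also have "\<dots> = (\<integral>x. g (sgn x) \<partial>uniform_measure lborel (ball 0 1))"
    by (subst integral_distr) auto
  also have "\<dots> = (\<integral>x. (indicator (ball 0 1) x / measure lborel (ball 0 1 :: 'a set)) *\<^sub>R g (sgn x) \<partial>lborel)"
  proof -
    have eq: "indicator (ball 0 1) x / emeasure lborel (ball 0 1 :: 'a set)
        = ennreal (indicator (ball 0 1) x / measure lborel (ball 0 1 :: 'a set))" for x :: 'a
    proof -
      have "measure lborel (ball 0 1 :: 'a set) > 0"
        using emeasure_unit_ball[where 'a='a] by (simp add: measure_def enn2real_positive_iff zero_less_iff_neq_zero top.not_eq_extremum)
      then show ?thesis using emeasure_unit_ball[where 'a='a]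
        by (subst emeasure_eq_ennreal_measure) (auto simp: divide_ennreal indicator_def zero_ennreal_def[symmetric] simp flip: ennreal_1)
    qed
    have [measurable]: "ball 0 1 \<in> sets (borel :: 'a measure)" by simp
    show ?thesis unfolding uniform_measure_def eq
      by (subst integral_density) auto
  qed
  finally show ?thesis by (simp add: g_def )
qed

section \<open>Invariance under orthogonal maps\<close>

lemma nn_integral_lborel_translate:
  fixes f :: "'a::euclidean_space \<Rightarrow> ennreal"
  assumes [measurable]: "f \<in> borel_measurable borel"
  shows "(\<integral>\<^sup>+y. f (t + y) \<partial>lborel) = (\<integral>\<^sup>+y. f y \<partial>lborel)"
    and "(\<integral>\<^sup>+y. f (t - y) \<partial>lborel) = (\<integral>\<^sup>+y. f y \<partial>lborel)"
proof -
  show "(\<integral>\<^sup>+y. f (t + y) \<partial>lborel) = (\<integral>\<^sup>+y. f y \<partial>lborel)"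
    by (subst (2) lborel_affine[of 1 t]) (auto simp: nn_integral_density nn_integral_distr)
  show "(\<integral>\<^sup>+y. f (t - y) \<partial>lborel) = (\<integral>\<^sup>+y. f y \<partial>lborel)"
    by (subst (2) lborel_affine[of "-1" t]) (auto simp: nn_integral_density nn_integral_distr)
qed

text \<open>The image of Lebesgue measure under \<open>T\<close> is translation invariant. Fubini's theorem therefore shows
  that it is proportional to Lebesgue measure, and the unit ball fixes the factor.\<close>

lemma lborel_distr_orthogonal:
  fixes T :: "'a::euclidean_space \<Rightarrow> 'a"
  assumes T: "orthogonal_transformation T"
  shows "distr lborel borel T = lborel"
proof (rule measure_eqI)
  have lin: "linear T" and bij: "bij T" and nrm: "norm (T x) = norm x" for x
    using T by (auto intro: orthogonal_transformation_linear orthogonal_transformation_bij orthogonal_transformation_norm)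
  have Tm [measurable]: "T \<in> borel_measurable borel"
    using lin by (simp add: borel_measurable_continuous_onI linear_continuous_on linear_linear)
  have Tinv: "T (inv T y + x) = T x + y" for x y
    using bij by (simp add: linear_add[OF lin] bij_is_surj surj_f_inv_f add.commute)
  fix A :: "'a set" assume "A \<in> sets (distr lborel borel T)"
  then have [measurable]: "A \<in> sets borel" by simp
  define B where "B = ball (0::'a) 1"
  have [measurable]: "B \<in> sets borel" by (simp add: B_def)
  have preB: "T -` B = B" by (auto simp: B_def nrm)
  \<comment> \<open>The double integral of \<open>indicator A (T x) * indicator B (T x + y)\<close>
    is computed twice. Integrating over \<open>y\<close> at once splits off the measure of
    \<open>B\<close>. Shifting \<open>x\<close> by \<open>inv T y\<close> first moves
    \<open>y\<close> into the argument of \<open>A\<close>, and integrating over \<open>y\<close>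
    then splits off the measure of \<open>A\<close>.\<close>
  have "emeasure lborel (T -` A) * emeasure lborel B
      = (\<integral>\<^sup>+x. indicator A (T x) * (\<integral>\<^sup>+y. indicator B y \<partial>lborel) \<partial>lborel)"
    using measurable_sets_borel[OF Tm, of A]
    by (simp add: nn_integral_multc nn_integral_indicator[symmetric] indicator_vimage del: nn_integral_indicator)
  also have "\<dots> = (\<integral>\<^sup>+x. (\<integral>\<^sup>+y. indicator A (T x) * indicator B (T x + y) \<partial>lborel) \<partial>lborel)"
    by (simp add: nn_integral_cmult nn_integral_lborel_translate(1)[of "indicator B"] del: nn_integral_indicator)
  also have "\<dots> = (\<integral>\<^sup>+y. (\<integral>\<^sup>+x. indicator A (T x) * indicator B (T x + y) \<partial>lborel) \<partial>lborel)"
    by (rule lborel_pair.Fubini') measurable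
  also have "\<dots> = (\<integral>\<^sup>+y. (\<integral>\<^sup>+x. indicator A (T x - y) * indicator B (T x) \<partial>lborel) \<partial>lborel)"
  proof (rule nn_integral_cong)
    fix y
    show "(\<integral>\<^sup>+x. indicator A (T x) * indicator B (T x + y) \<partial>lborel)
        = (\<integral>\<^sup>+x. indicator A (T x - y) * indicator B (T x) \<partial>lborel)"
      using nn_integral_lborel_translate(1)[of "\<lambda>x. indicator A (T x - y) * indicator B (T x)" "inv T y"]
      by (simp add: Tinv)
  qed
  also have "\<dots> = (\<integral>\<^sup>+x. (\<integral>\<^sup>+y. indicator A (T x - y) * indicator B (T x) \<partial>lborel) \<partial>lborel)"
    by (rule lborel_pair.Fubini') measurable
  also have "\<dots> = (\<integral>\<^sup>+x. (\<integral>\<^sup>+y. indicator A y \<partial>lborel) * indicator B (T x) \<partial>lborel)"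
    by (simp add: nn_integral_multc nn_integral_lborel_translate(2)[of "indicator A"] del: nn_integral_indicator)
  also have "\<dots> = emeasure lborel A * emeasure lborel (T -` B)"
    using measurable_sets_borel[OF Tm, of B]
    by (simp add: nn_integral_cmult nn_integral_indicator[symmetric] indicator_vimage del: nn_integral_indicator)
  finally have "emeasure lborel (T -` A) * emeasure lborel B = emeasure lborel A * emeasure lborel B"
    by (simp add: preB)
  then have "emeasure lborel (T -` A) = emeasure lborel A"
    using emeasure_unit_ball[where 'a='a] by (simp add: B_def ennreal_mult_cancel_left mult.commute[of _ "emeasure lborel (ball 0 1)"])
  then show "emeasure (distr lborel borel T) A = emeasure lborel A"
    by (simp add: emeasure_distr)
qed simp

text \<open>An orthogonal map commutes with \<open>sgn\<close> and preserves the ball, so the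
  invariance of Lebesgue measure passes to the cone measure.\<close>

lemma integral_sphere_orthogonal:
  fixes T :: "'a::euclidean_space \<Rightarrow> 'a"
  assumes T: "orthogonal_transformation T" and f: "continuous_on (sphere 0 1) f"
  shows "(\<integral>x. f (T x) \<partial>sphere_measure) = (\<integral>x. f x \<partial>sphere_measure :: real)"
proof -
  have lin: "linear T" and nrm: "norm (T x) = norm x" for x
    using T by (auto intro: orthogonal_transformation_linear orthogonal_transformation_norm)
  have cont: "continuous_on UNIV T" using lin by (simp add: linear_continuous_on linear_linear)
  have [measurable]: "T \<in> borel_measurable borel"
    using cont by (simp add: borel_measurable_continuous_onI)
  have Tsgn: "T (sgn x) = sgn (T x)" for x
    by (simp add: sgn_div_norm nrm linear_scale[OF lin])
  have fT: "continuous_on (sphere 0 1) (\<lambda>x. f (T x))"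
    by (rule continuous_on_compose2[OF f continuous_on_subset[OF cont]]) (auto simp: nrm)
  define h where "h x = indicator (ball 0 1) x * (indicator (sphere 0 1) (sgn x) * f (sgn x))" for x :: "'a"
  have g [measurable]: "(\<lambda>x. indicator (sphere 0 1) x * f x) \<in> borel_measurable borel"
    using continuous_measurable_sphere[OF f]
    by (subst (asm) measurable_cong_sets[OF sets_sphere_measure refl],
        subst (asm) borel_measurable_restrict_space_iff) auto
  have [measurable]: "h \<in> borel_measurable borel"
  proof -
    have [measurable]: "(\<lambda>x. indicator (sphere 0 1) (sgn x) * f (sgn x)) \<in> borel_measurable borel"
      using measurable_compose[OF measurable_sgn_borel g] .
    have [measurable]: "ball 0 1 \<in> sets (borel :: ('a) measure)" by simp
    show ?thesis unfolding h_def[abs_def] by measurable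
  qed
  have "(\<integral>x. h (T x) \<partial>lborel) = (\<integral>x. h x \<partial>distr lborel borel T)"
    by (subst integral_distr) auto
  then have "(\<integral>x. h (T x) \<partial>lborel) = (\<integral>x. h x \<partial>lborel)" by (simp add: lborel_distr_orthogonal[OF T])
  moreover have T0: "T x = 0 \<longleftrightarrow> x = 0" for x using nrm[of x] by (metis norm_eq_zero)
  have "h (T x) = indicator (ball 0 1) x * (indicator (sphere 0 1) (sgn x) * f (T (sgn x)))" for x
    by (simp add: h_def Tsgn indicator_def nrm norm_sgn T0)
  ultimately show ?thesis
    by (simp add: integral_sphere_eq_ball[OF f] integral_sphere_eq_ball[OF fT] h_def)
qed

text \<open>A nonempty open piece of the sphere has positive measure, because the cone over it
  contains a nonempty open subset of the ball. A continuous function that vanishes almost everywhere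
  therefore has no nonzero value.\<close>

lemma integral_square_eq_0_sphere:
  fixes f :: "'a::euclidean_space \<Rightarrow> real"
  assumes f: "continuous_on (sphere 0 1) f" and 0: "(\<integral>x. (f x)\<^sup>2 \<partial>sphere_measure) = 0" and y: "norm y = 1"
  shows "f y = 0"
proof (rule ccontr)
  assume ne: "f y \<noteq> 0"
  have "AE x in sphere_measure. (f x)\<^sup>2 = 0"
    using 0 by (subst (asm) integral_nonneg_eq_0_iff_AE) (auto intro!: integrable_sphere continuous_intros f)
  then have ae: "AE x in sphere_measure. f x = 0" by simp
  obtain U where U: "open U" "U \<inter> sphere 0 1 = f -` (-{0}) \<inter> sphere 0 1"
    using f by (metis continuous_on_open_invariant open_delete Compl_eq_Diff_UNIV open_UNIV)
  define A where "A = U \<inter> sphere 0 1"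
  have A: "A \<in> sets borel" "A \<subseteq> sphere 0 1"
    using \<open>open U\<close> by (simp_all add: A_def borel_open borel_closed sets.Int)
  have "A = {x \<in> space sphere_measure. f x \<noteq> 0}" unfolding A_def U(2) by auto
  moreover have "emeasure sphere_measure {x \<in> space sphere_measure. f x \<noteq> 0} = 0"
    using ae by (intro emeasure_eq_0_AE) simp
  ultimately have "emeasure sphere_measure A = 0" by simp
  then have z: "emeasure (uniform_measure lborel (ball 0 1)) (sgn -` A) = 0"
    using A by (simp add: emeasure_sphere_measure)
  have [measurable]: "sgn -` A \<in> sets borel" using measurable_sets_borel[OF measurable_sgn_borel A(1)] .
  have z2: "emeasure lborel (ball 0 1 \<inter> sgn -` A) = 0"
    using z emeasure_unit_ball[where 'a='a] by (simp add: ennreal_divide_eq_0_iff )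
  \<comment> \<open>The origin is removed because \<open>sgn\<close> is discontinuous there.\<close>
  define V where "V = (-{0} \<inter> sgn -` U) \<inter> ball 0 (1::real)"
  have "continuous_on (-{0}) (sgn :: 'a \<Rightarrow> 'a)" by (intro continuous_intros) auto
  then have "open V" unfolding V_def
    by (intro open_Int open_ball continuous_open_preimage U(1)) auto
  moreover have "V \<subseteq> ball 0 1 \<inter> sgn -` A" by (auto simp: V_def A_def norm_sgn)
  \<comment> \<open>The point \<open>y\<close> lies on the boundary of the ball; half of it is
    interior and on the same ray.\<close>
  moreover have "(1/2) *\<^sub>R y \<in> V"
  proof -
    have "y \<in> f -` (-{0}) \<inter> sphere 0 1" using y ne by simp
    then have "y \<in> U" unfolding U(2)[symmetric] by blast
    moreover have "sgn ((1/2) *\<^sub>R y) = y" "y \<noteq> 0" using y by (auto simp: sgn_div_norm)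
    ultimately show ?thesis using y by (simp add: V_def)
  qed
  ultimately have "\<not> negligible V" using open_not_negligible by blast
  moreover have "emeasure lborel V \<le> 0"
    unfolding z2[symmetric] using \<open>V \<subseteq> _\<close> \<open>sgn -` A \<in> sets borel\<close> by (intro emeasure_mono) auto
  then have "V \<in> null_sets lborel" using \<open>open V\<close> by (auto simp: null_sets_def)
  then have "negligible V" by (simp add: negligible_iff_null_sets null_sets_completionI)
  ultimately show False by simp
qed

section \<open>Homogeneous polynomials\<close>

text \<open>An inductive form of homogeneity, so that Euler's identity, the degrees of derivatives
  and the reduction on the sphere follow by induction on the construction. The rule
  \<open>zero\<close> makes every degree a vector space.\<close>

inductive hpoly :: "nat \<Rightarrow> ('a::euclidean_space \<Rightarrow> real) \<Rightarrow> bool" where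
  const: "hpoly 0 (\<lambda>_. c)"
| zero: "hpoly n (\<lambda>_. 0)"
| add: "hpoly n f \<Longrightarrow> hpoly n g \<Longrightarrow> hpoly n (\<lambda>x. f x + g x)"
| coord: "hpoly n f \<Longrightarrow> b \<in> Basis \<Longrightarrow> hpoly (Suc n) (\<lambda>x. (x \<bullet> b) * f x)"

lemma hpoly_scale: "hpoly n f \<Longrightarrow> hpoly n (\<lambda>x. c * f x)"
proof (induction rule: hpoly.induct)
  case (coord n f b)
  then show ?case using hpoly.coord[of n "\<lambda>x. c * f x" b] by (simp add: mult.left_commute)
qed (auto simp: distrib_left intro: hpoly.intros)

lemma hpoly_sum: "(\<And>i. i \<in> I \<Longrightarrow> hpoly n (f i)) \<Longrightarrow> hpoly n (\<lambda>x. \<Sum>i\<in>I. f i x)"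
  by (induction I rule: infinite_finite_induct) (auto intro: hpoly.intros)

lemma hpoly_mult: "hpoly m f \<Longrightarrow> hpoly n g \<Longrightarrow> hpoly (m + n) (\<lambda>x. f x * g x)"
proof (induction rule: hpoly.induct)
  case (coord n f b)
  then show ?case using hpoly.coord by (fastforce simp: mult.assoc)
qed (auto simp: distrib_right hpoly_scale intro: hpoly.intros)

lemma hpoly_inner: "b \<in> Basis \<Longrightarrow> hpoly (Suc 0) (\<lambda>x. x \<bullet> b)"
  using hpoly.coord[OF hpoly.const[of 1], of b] by simp

lemma hpoly_homogeneous: "hpoly n f \<Longrightarrow> f (c *\<^sub>R x) = c ^ n * f x"
  by (induction rule: hpoly.induct) (auto simp: algebra_simps)

lemma hpoly_real_polynomial_function: "hpoly n f \<Longrightarrow> real_polynomial_function f"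
  by (induction rule: hpoly.induct)
     (auto intro: real_polynomial_function.intros(2-) real_polynomial_function.intros(1)[OF bounded_linear_inner_left])

lemma hpoly_inner_self: "hpoly 2 (\<lambda>x. x \<bullet> x)"
proof -
  have "hpoly 2 (\<lambda>x. \<Sum>b\<in>Basis. (x \<bullet> b) * (x \<bullet> b))"
    by (rule hpoly_sum) (use hpoly.coord hpoly_inner in \<open>fastforce simp: numeral_2_eq_2\<close>)
  then show ?thesis by (subst euclidean_inner)
qed

lemma hpoly_inner_self_power: "hpoly n f \<Longrightarrow> hpoly (n + 2 * i) (\<lambda>x. (x \<bullet> x) ^ i * f x)"
proof (induction i)
  case (Suc i)
  then show ?case using hpoly_mult[OF hpoly_inner_self Suc.IH] by (simp add: mult.assoc)
qed simp

definition polydeg :: "nat \<Rightarrow> ('a::euclidean_space \<Rightarrow> real) \<Rightarrow> bool" where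
  "polydeg n f \<longleftrightarrow> (\<exists>h. (\<forall>i. hpoly i (h i)) \<and> (\<forall>x. f x = (\<Sum>i\<le>n. h i x)))"

lemma polydeg_hpoly: "hpoly i f \<Longrightarrow> i \<le> n \<Longrightarrow> polydeg n f"
  unfolding polydeg_def
  by (intro exI[of _ "\<lambda>j. if j = i then f else (\<lambda>_. 0)"])
     (auto intro: hpoly.zero simp: if_distrib[of "\<lambda>f. f _"] sum.delta)

lemma polydeg_add: "polydeg n f \<Longrightarrow> polydeg n g \<Longrightarrow> polydeg n (\<lambda>x. f x + g x)"
  unfolding polydeg_def
proof (elim exE conjE)
  fix h h' assume "\<forall>i. hpoly i (h i)" "\<forall>x. f x = (\<Sum>i\<le>n. h i x)"
    "\<forall>i. hpoly i (h' i)" "\<forall>x. g x = (\<Sum>i\<le>n. h' i x)"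
  then show "\<exists>h. (\<forall>i. hpoly i (h i)) \<and> (\<forall>x. f x + g x = (\<Sum>i\<le>n. h i x))"
    by (intro exI[of _ "\<lambda>i x. h i x + h' i x"]) (auto intro: hpoly.add simp: sum.distrib)
qed

lemma polydeg_sum: "(\<And>i. i \<in> I \<Longrightarrow> polydeg n (f i)) \<Longrightarrow> polydeg n (\<lambda>x. \<Sum>i\<in>I. f i x)"
proof (induction I rule: infinite_finite_induct)
  case (insert a F)
  then show ?case by (auto intro: polydeg_add)
qed (auto intro: polydeg_hpoly[OF hpoly.zero])

lemma polydeg_mono:
  assumes "polydeg m f" "m \<le> n" shows "polydeg n f"
proof -
  obtain h where h: "\<And>i. hpoly i (h i)" "\<And>x. f x = (\<Sum>i\<le>m. h i x)"
    using assms unfolding polydeg_def by metis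
  have "polydeg n (\<lambda>x. \<Sum>i\<le>m. h i x)"
    using assms by (intro polydeg_sum polydeg_hpoly[OF h(1)]) auto
  then show ?thesis using h(2) by presburger
qed

lemma polydeg_mult:
  assumes "polydeg m f" "polydeg n g" shows "polydeg (m + n) (\<lambda>x. f x * g x)"
proof -
  obtain h h' where h: "\<And>i. hpoly i (h i)" "\<And>x. f x = (\<Sum>i\<le>m. h i x)"
    "\<And>i. hpoly i (h' i)" "\<And>x. g x = (\<Sum>i\<le>n. h' i x)"
    using assms unfolding polydeg_def by metis
  have "polydeg (m + n) (\<lambda>x. \<Sum>i\<le>m. \<Sum>j\<le>n. h i x * h' j x)"
    by (intro polydeg_sum) (auto intro!: polydeg_hpoly[OF hpoly_mult[OF h(1,3)]] add_mono)
  then show ?thesis by (simp add: h(2,4) sum_product)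
qed

lemma real_polynomial_function_polydeg: "real_polynomial_function p \<Longrightarrow> \<exists>n. polydeg n p"
proof (induction rule: real_polynomial_function.induct)
  case (linear f)
  have "hpoly (Suc 0) (\<lambda>x. \<Sum>b\<in>Basis. f b * (x \<bullet> b))"
    by (intro hpoly_sum hpoly_scale hpoly_inner)
  moreover have "f x = (\<Sum>b\<in>Basis. f b * (x \<bullet> b))" for x
    using bounded_linear.linear[OF linear]
    by (subst (1) euclidean_representation[of x, symmetric])
       (simp only: linear_sum linear_scale real_scaleR_def mult.commute)
  then have "f = (\<lambda>x. \<Sum>b\<in>Basis. f b * (x \<bullet> b))" by (rule ext)
  ultimately have "hpoly (Suc 0) f" by metis
  then show ?case using polydeg_hpoly[OF _ order_refl] by blast
next
  case (const c)
  then show ?case using polydeg_hpoly[OF hpoly.const] by blast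
next
  case (add f g)
  then obtain m n where "polydeg m f" "polydeg n g" by blast
  then have "polydeg (max m n) (\<lambda>x. f x + g x)" by (intro polydeg_add) (auto intro: polydeg_mono)
  then show ?case by blast
next
  case (mult f g)
  then show ?case using polydeg_mult by blast
qed

text \<open>For fixed \<open>x\<close> the homogeneity equation is an identity between polynomials
  in \<open>c\<close>; comparing coefficients leaves only the part of degree
  \<open>l\<close>.\<close>

lemma homogeneous_polynomial_hpoly:
  assumes "real_polynomial_function p" "\<And>c x. p (c *\<^sub>R x) = c ^ l * p x"
  shows "hpoly l p"
proof -
  obtain n h where h: "\<And>i. hpoly i (h i)" "\<And>x. p x = (\<Sum>i\<le>n. h i x)"
    using real_polynomial_function_polydeg[OF assms(1)] unfolding polydeg_def by metis
  \<comment> \<open>The common length \<open>N\<close> also covers \<open>l > n\<close>, where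
    \<open>p\<close> turns out to be zero.\<close>
  define N where "N = max n l"
  have "p x = (if l \<le> n then h l x else 0)" for x
  proof -
    have "(\<Sum>i\<le>N. (if i \<le> n then h i x else 0) * c ^ i) = (\<Sum>i\<le>N. (if i = l then p x else 0) * c ^ i)" for c
    proof -
      have "(\<Sum>i\<le>N. (if i \<le> n then h i x else 0) * c ^ i) = (\<Sum>i\<le>n. h i x * c ^ i)"
        by (rule sum.mono_neutral_cong_right) (auto simp: N_def)
      also have "\<dots> = p (c *\<^sub>R x)" by (simp add: h(2) hpoly_homogeneous[OF h(1)] mult.commute)
      also have "\<dots> = (\<Sum>i\<le>N. (if i = l then p x * c ^ i else 0))"
        by (simp add: assms(2) N_def)
      finally show ?thesis by (simp add: if_distrib[of "\<lambda>y. y * _"] cong: if_cong)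
    qed
    then have "\<forall>i\<le>N. (if i \<le> n then h i x else 0) = (if i = l then p x else 0)"
      by (subst polyfun_eq_coeffs[symmetric]) blast
    then have "(if l \<le> n then h l x else 0) = p x" by (auto simp: N_def)
    then show ?thesis by simp
  qed
  then have "p = (if l \<le> n then h l else (\<lambda>_. 0))" by auto
  then show ?thesis using h(1)[of l] hpoly.zero by metis
qed

section \<open>Differentiation of polynomials\<close>

definition pd :: "'a \<Rightarrow> ('a::euclidean_space \<Rightarrow> real) \<Rightarrow> 'a \<Rightarrow> real" where
  "pd b f x = deriv (\<lambda>t. f (x + t *\<^sub>R b)) 0"

lemma laplacian_pd: "laplacian f x = (\<Sum>b\<in>Basis. pd b (pd b f) x)"
  by (simp add: laplacian_def pd_def[abs_def])

lemma pd_eq: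
  assumes "(f has_derivative D) (at x)" shows "pd b f x = D b"
proof -
  have "((\<lambda>t::real. x + t *\<^sub>R b) has_derivative (\<lambda>t. t *\<^sub>R b)) (at 0)"
    by (auto intro!: derivative_eq_intros)
  moreover have "(f has_derivative D) (at (x + (0::real) *\<^sub>R b))" using assms by simp
  ultimately have "((\<lambda>t. f (x + t *\<^sub>R b)) has_derivative (\<lambda>t. D (t *\<^sub>R b))) (at 0)"
    by (rule has_derivative_compose)
  moreover have "D (t *\<^sub>R b) = D b * t" for t
    by (simp add: linear_scale[OF has_derivative_linear[OF assms]])
  ultimately show ?thesis
    unfolding pd_def by (intro DERIV_imp_deriv) (simp add: has_field_derivative_def)
qed

lemma has_derivative_pd:
  assumes "real_polynomial_function f"
  shows "(f has_derivative (\<lambda>v. \<Sum>b\<in>Basis. (v \<bullet> b) * pd b f x)) (at x)"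
proof -
  obtain D where D: "(f has_derivative D) (at x)"
    using differentiable_at_real_polynomial_function[OF assms] by (auto simp: differentiable_def)
  have "D v = (\<Sum>b\<in>Basis. (v \<bullet> b) * D b)" for v
    using has_derivative_linear[OF D]
    by (subst (1) euclidean_representation[of v, symmetric]) (simp only: linear_sum linear_scale real_scaleR_def)
  then have "D = (\<lambda>v. \<Sum>b\<in>Basis. (v \<bullet> b) * D b)" by blast
  then show ?thesis using D by (simp add: pd_eq[OF D])
qed

lemma DERIV_along_curve:
  assumes "real_polynomial_function f" "(\<gamma> has_vector_derivative v) (at t)"
  shows "((\<lambda>s. f (\<gamma> s)) has_real_derivative (\<Sum>b\<in>Basis. (v \<bullet> b) * pd b f (\<gamma> t))) (at t)"
proof -
  have "(*) (\<Sum>b\<in>Basis. (v \<bullet> b) * pd b f (\<gamma> t)) = (\<lambda>h. \<Sum>b\<in>Basis. (h *\<^sub>R v \<bullet> b) * pd b f (\<gamma> t))"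
    by (rule ext) (simp add: sum_distrib_left mult_ac)
  then show ?thesis
    using has_derivative_compose[OF assms(2)[unfolded has_vector_derivative_def] has_derivative_pd[OF assms(1)]]
    by (simp add: has_field_derivative_def)
qed

lemma pd_add:
  "real_polynomial_function f \<Longrightarrow> real_polynomial_function g \<Longrightarrow>
     pd b (\<lambda>x. f x + g x) = (\<lambda>x. pd b f x + pd b g x)"
proof
  fix x assume "real_polynomial_function f" "real_polynomial_function g"
  from has_derivative_add[OF has_derivative_pd[OF this(1), of x] has_derivative_pd[OF this(2), of x]]
    has_derivative_pd[OF this(1), of x] has_derivative_pd[OF this(2), of x]
  show "pd b (\<lambda>x. f x + g x) x = pd b f x + pd b g x" by (simp add: pd_eq)
qed

lemma pd_mult:
  "real_polynomial_function f \<Longrightarrow> real_polynomial_function g \<Longrightarrow>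
     pd b (\<lambda>x. f x * g x) = (\<lambda>x. f x * pd b g x + pd b f x * g x)"
proof
  fix x assume "real_polynomial_function f" "real_polynomial_function g"
  from has_derivative_mult[OF has_derivative_pd[OF this(1), of x] has_derivative_pd[OF this(2), of x]]
    has_derivative_pd[OF this(1), of x] has_derivative_pd[OF this(2), of x]
  show "pd b (\<lambda>x. f x * g x) x = f x * pd b g x + pd b f x * g x" by (simp add: pd_eq)
qed

lemma pd_const: "pd b (\<lambda>_. c) = (\<lambda>_. 0)"
  by (rule ext) (simp add: pd_eq[OF has_derivative_const])

lemma pd_inner: "pd b (\<lambda>x. x \<bullet> c) = (\<lambda>_. b \<bullet> c)"
  by (rule ext) (rule pd_eq, auto intro!: derivative_eq_intros)

lemma pd_cmult: "real_polynomial_function f \<Longrightarrow> pd b (\<lambda>x. c * f x) = (\<lambda>x. c * pd b f x)"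
  using pd_mult[OF real_polynomial_function.intros(2), of f b c] by (simp add: pd_const)

lemma real_polynomial_function_inner: "real_polynomial_function (\<lambda>x. x \<bullet> b)"
  by (rule real_polynomial_function.intros(1)[OF bounded_linear_inner_left])

lemma pd_coord:
  "real_polynomial_function f \<Longrightarrow>
     pd b (\<lambda>x. (x \<bullet> c) * f x) = (\<lambda>x. (x \<bullet> c) * pd b f x + (b \<bullet> c) * f x)"
  using pd_mult[OF real_polynomial_function_inner] by (simp add: pd_inner)

text \<open>The second conjunct makes the induction work: for \<open>n = 0\<close> truncated
  subtraction would give \<open>(x \<bullet> c) * pd b f x\<close> degree one where degree zero is
  required.\<close>

lemma hpoly_pd_aux: "hpoly n f \<Longrightarrow> hpoly (n - 1) (pd b f) \<and> (n = 0 \<longrightarrow> pd b f = (\<lambda>_. 0))"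
proof (induction rule: hpoly.induct)
  case (add n f g)
  then show ?case
    by (auto simp: pd_add hpoly_real_polynomial_function intro: hpoly.add)
next
  case (coord n f c)
  have eq: "pd b (\<lambda>x. (x \<bullet> c) * f x) = (\<lambda>x. (x \<bullet> c) * pd b f x + (b \<bullet> c) * f x)"
    using coord by (simp add: pd_coord hpoly_real_polynomial_function)
  have "hpoly n (\<lambda>x. (x \<bullet> c) * pd b f x)"
  proof (cases n)
    case 0
    then show ?thesis using coord by (simp add: hpoly.const)
  next
    case (Suc k)
    then show ?thesis using coord hpoly.coord by fastforce
  qed
  then show ?case unfolding eq using coord by (auto intro!: hpoly.add hpoly_scale)
qed (auto simp: pd_const intro: hpoly.intros)

lemma hpoly_pd: "hpoly n f \<Longrightarrow> hpoly (n - 1) (pd b f)"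
  and hpoly_0_pd: "hpoly 0 f \<Longrightarrow> pd b f = (\<lambda>_. 0)"
  using hpoly_pd_aux by blast+

lemma real_polynomial_function_pd:
  assumes "real_polynomial_function f" shows "real_polynomial_function (pd b f)"
  using assms
proof (induction rule: real_polynomial_function.induct)
  case (linear f)
  then have "pd b f = (\<lambda>_. f b)" by (auto simp: pd_eq bounded_linear_imp_has_derivative)
  then show ?case by (simp add: real_polynomial_function.intros(2))
qed (auto simp: pd_const pd_add pd_mult intro: real_polynomial_function.intros)

lemma euler_identity: "hpoly n f \<Longrightarrow> (\<Sum>b\<in>Basis. (x \<bullet> b) * pd b f x) = real n * f x"
proof (induction rule: hpoly.induct)
  case (add n f g)
  then show ?case
    by (simp add: pd_add hpoly_real_polynomial_function distrib_left sum.distrib)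
next
  case (coord n f c)
  have xc: "(\<Sum>b\<in>Basis. (x \<bullet> b) * (b \<bullet> c)) = x \<bullet> c"
    by (simp add: euclidean_inner[of x c] inner_commute[of c])
  have "(\<Sum>b\<in>Basis. (x \<bullet> b) * pd b (\<lambda>x. (x \<bullet> c) * f x) x)
      = (x \<bullet> c) * (\<Sum>b\<in>Basis. (x \<bullet> b) * pd b f x) + f x * (\<Sum>b\<in>Basis. (x \<bullet> b) * (b \<bullet> c))"
    by (simp only: pd_coord[OF hpoly_real_polynomial_function[OF coord(1)]])
       (simp add: distrib_left sum.distrib sum_distrib_left mult_ac)
  note eq = this
  show ?case unfolding eq xc coord.IH by (simp add: algebra_simps)
qed (auto simp: pd_const)

lemma laplacian_add:
  "real_polynomial_function f \<Longrightarrow> real_polynomial_function g \<Longrightarrow>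
     laplacian (\<lambda>x. f x + g x) x = laplacian f x + laplacian g x"
  by (simp add: laplacian_pd pd_add real_polynomial_function_pd sum.distrib)

lemma laplacian_cmult:
  "real_polynomial_function f \<Longrightarrow> laplacian (\<lambda>x. c * f x) x = c * laplacian f x"
  by (simp add: laplacian_pd pd_cmult real_polynomial_function_pd sum_distrib_left)

lemma laplacian_zero [simp]: "laplacian (\<lambda>_. 0) = (\<lambda>_. 0)"
  by (rule ext) (simp add: laplacian_pd pd_const)

lemma hpoly_laplacian: "hpoly n f \<Longrightarrow> hpoly (n - 2) (laplacian f)"
  unfolding laplacian_pd[abs_def]
  by (intro hpoly_sum) (metis hpoly_pd diff_diff_left one_add_one)

lemma laplacian_low_degree:
  assumes "hpoly n f" "n < 2" shows "laplacian f = (\<lambda>_. 0)"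
proof -
  have "hpoly 0 (pd b f)" for b
    using hpoly_pd[OF assms(1), of b] assms(2) by (auto simp: less_2_cases_iff)
  then have "pd b (pd b f) = (\<lambda>_. 0)" for b by (rule hpoly_0_pd)
  then show ?thesis by (simp add: laplacian_pd[abs_def])
qed

text \<open>The gradient of \<open>x \<bullet> x\<close> is \<open>2 x\<close> and its Laplacian is
  \<open>2 * DIM('a)\<close>; Euler's identity turns the cross term into
  \<open>4 n f\<close>.\<close>

lemma laplacian_inner_self_mult:
  assumes f: "hpoly n (f :: 'a::euclidean_space \<Rightarrow> real)"
  shows "laplacian (\<lambda>x. (x \<bullet> x) * f x) x = (2 * real DIM('a) + 4 * real n) * f x + (x \<bullet> x) * laplacian f x"
proof -
  note rp = hpoly_real_polynomial_function[OF f]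
  have ns: "real_polynomial_function (\<lambda>x::'a. x \<bullet> x)"
    using hpoly_inner_self hpoly_real_polynomial_function by blast
  have pns: "pd b (\<lambda>x::'a. x \<bullet> x) = (\<lambda>x. 2 * (x \<bullet> b))" for b
    by (rule ext, rule pd_eq) (auto intro!: derivative_eq_intros simp: inner_commute)
  have "pd b (pd b (\<lambda>x. (x \<bullet> x) * f x)) x = 2 * f x + 4 * ((x \<bullet> b) * pd b f x) + (x \<bullet> x) * pd b (pd b f) x"
    if "b \<in> Basis" for b
    using that by (simp add: pd_mult pd_add pd_cmult pd_coord pns ns rp real_polynomial_function_pd
      real_polynomial_function.intros real_polynomial_function_inner pd_const pd_inner)
  then have "laplacian (\<lambda>x. (x \<bullet> x) * f x) x
      = (\<Sum>b\<in>Basis. 2 * f x + 4 * ((x \<bullet> b) * pd b f x) + (x \<bullet> x) * pd b (pd b f) x)"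
    by (simp add: laplacian_pd)
  also have "\<dots> = 2 * real DIM('a) * f x + 4 * (\<Sum>b\<in>Basis. (x \<bullet> b) * pd b f x) + (x \<bullet> x) * laplacian f x"
    by (simp add: sum.distrib sum_distrib_left laplacian_pd)
  finally show ?thesis unfolding euler_identity[OF f] by (simp add: algebra_simps)
qed

lemma laplacian_inner_self_power_mult:
  assumes f: "hpoly n (f :: 'a::euclidean_space \<Rightarrow> real)"
  shows "laplacian (\<lambda>x. (x \<bullet> x) ^ Suc i * f x) x
       = (x \<bullet> x) ^ Suc i * laplacian f x
         + 2 * (real i + 1) * (2 * real i + DIM('a) + 2 * real n) * (x \<bullet> x) ^ i * f x"
proof (induction i)
  case 0
  then show ?case using laplacian_inner_self_mult[OF f, of x] by (simp add: algebra_simps)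
next
  case (Suc i)
  have "laplacian (\<lambda>x. (x \<bullet> x) ^ Suc (Suc i) * f x) x = laplacian (\<lambda>x. (x \<bullet> x) * ((x \<bullet> x) ^ Suc i * f x)) x"
    by (simp add: mult.assoc)
  also have "\<dots> = (2 * real DIM('a) + 4 * real (n + 2 * Suc i)) * ((x \<bullet> x) ^ Suc i * f x)
      + (x \<bullet> x) * laplacian (\<lambda>x. (x \<bullet> x) ^ Suc i * f x) x"
    by (rule laplacian_inner_self_mult) (rule hpoly_inner_self_power[OF f])
  finally show ?case unfolding Suc.IH by (simp add: algebra_simps)
qed


section \<open>Harmonic decomposition\<close>

lemma spherical_harmonics_iff:
  "f \<in> spherical_harmonics l \<longleftrightarrow>
     (\<exists>p. hpoly l p \<and> (\<forall>x. laplacian p x = 0) \<and> (\<forall>x. norm x = 1 \<longrightarrow> f x = p x))"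
proof -
  have "hpoly l p \<longleftrightarrow> real_polynomial_function p \<and> (\<forall>c x. p (c *\<^sub>R x) = c ^ l * p x)" for p :: "'a \<Rightarrow> real"
    using homogeneous_polynomial_hpoly[of p l] hpoly_real_polynomial_function[of l p] hpoly_homogeneous[of l p]
    by blast
  then show ?thesis by (simp add: spherical_harmonics_def Ball_def)
qed

lemma spherical_harmonics_zero: "(\<lambda>_. 0) \<in> spherical_harmonics l"
  unfolding spherical_harmonics_iff by (intro exI[of _ "\<lambda>_. 0"]) (auto intro: hpoly.zero)

lemma spherical_harmonics_add:
  assumes "f \<in> spherical_harmonics l" "g \<in> spherical_harmonics l"
  shows "(\<lambda>x. f x + g x) \<in> spherical_harmonics l"
proof -
  obtain p q where "hpoly l p" "\<forall>x. laplacian p x = 0" "\<forall>x. norm x = 1 \<longrightarrow> f x = p x"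
    "hpoly l q" "\<forall>x. laplacian q x = 0" "\<forall>x. norm x = 1 \<longrightarrow> g x = q x"
    using assms unfolding spherical_harmonics_iff by metis
  then show ?thesis unfolding spherical_harmonics_iff
    by (intro exI[of _ "\<lambda>x. p x + q x"])
       (auto intro: hpoly.add simp: laplacian_add hpoly_real_polynomial_function)
qed

lemma spherical_harmonics_scale:
  assumes "f \<in> spherical_harmonics l" shows "(\<lambda>x. c * f x) \<in> spherical_harmonics l"
proof -
  obtain p where "hpoly l p" "\<forall>x. laplacian p x = 0" "\<forall>x. norm x = 1 \<longrightarrow> f x = p x"
    using assms unfolding spherical_harmonics_iff by metis
  then show ?thesis unfolding spherical_harmonics_iff
    by (intro exI[of _ "\<lambda>x. c * p x"])
       (auto intro: hpoly_scale simp: laplacian_cmult hpoly_real_polynomial_function)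
qed

lemma hpoly_iterated_laplacian: "hpoly n p \<Longrightarrow> hpoly (n - 2 * i) ((laplacian ^^ i) p)"
proof (induction i)
  case (Suc i)
  then show ?case using hpoly_laplacian[of "n - 2 * i"] by (simp add: diff_diff_add)
qed simp

lemma iterated_laplacian_eq_0: "hpoly n p \<Longrightarrow> n < 2 * i \<Longrightarrow> (laplacian ^^ i) p = (\<lambda>_. 0)"
proof (induction i)
  case (Suc i)
  then show ?case
    using laplacian_low_degree[OF hpoly_iterated_laplacian[OF Suc.prems(1)], of i]
    by (cases "n < 2 * i") auto
qed simp

text \<open>The ansatz \<open>h = \<Sum>\<^sub>i c\<^sub>i |x|\<^sup>2\<^sup>i \<Delta>\<^sup>i p\<close> with \<open>c\<^sub>0 = 1\<close>: its Laplacian telescopes for the right \<open>c\<^sub>i\<close>.\<close>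

lemma harmonic_part:
  fixes p :: "'a::euclidean_space \<Rightarrow> real"
  assumes p: "hpoly n p"
  obtains h c where "hpoly n h" "\<And>x. laplacian h x = 0"
    "\<And>x. p x = h x + (\<Sum>i=1..n. c i * (x \<bullet> x) ^ i * (laplacian ^^ i) p x)"
proof -
  define L where "L i = (laplacian ^^ i) p" for i
  have LS: "laplacian (L i) = L (Suc i)" for i by (simp add: L_def)
  have L: "hpoly (n - 2 * i) (L i)" for i unfolding L_def by (rule hpoly_iterated_laplacian[OF p])
  have L0: "n < 2 * i \<Longrightarrow> L i = (\<lambda>_. 0)" for i unfolding L_def by (rule iterated_laplacian_eq_0[OF p])
  \<comment> \<open>This is the factor that the Laplacian of
    \<open>(x \<bullet> x) ^ Suc j * L (Suc j) x\<close> puts on the term one power lower. It is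
    positive, so the recursion for \<open>c\<close>, chosen to cancel that term against the previous
    one, may divide by it.\<close>
  define \<beta> where "\<beta> j = 2 * (real j + 1) * (2 * real j + DIM('a) + 2 * real (n - 2 * Suc j))" for j
  have \<beta>: "\<beta> j > 0" for j
    unfolding \<beta>_def using DIM_positive[where 'a='a]
    by (intro mult_pos_pos) (simp_all add: add_nonneg_pos add_pos_nonneg del: DIM_positive)
  define c where "c = rec_nat (1::real) (\<lambda>j a. - a / \<beta> j)"
  have c0: "c 0 = 1" and cS: "c (Suc j) * \<beta> j = - c j" for j
    using \<beta>[of j] by (simp_all add: c_def)
  have term_hpoly: "hpoly n (\<lambda>x. c i * ((x \<bullet> x) ^ i * L i x))" for i
  proof (cases "n < 2 * i")
    case True
    then show ?thesis by (simp add: L0 hpoly.zero)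
  next
    case False
    then have "n - 2 * i + 2 * i = n" by simp
    then show ?thesis using hpoly_scale[OF hpoly_inner_self_power[OF L[of i], of i]] by simp
  qed
  have lapterm: "laplacian (\<lambda>x. c (Suc i) * ((x \<bullet> x) ^ Suc i * L (Suc i) x)) x
      = c (Suc i) * ((x \<bullet> x) ^ Suc i * L (Suc (Suc i)) x) - c i * ((x \<bullet> x) ^ i * L (Suc i) x)" for i x
  proof -
    have "laplacian (\<lambda>x. c (Suc i) * ((x \<bullet> x) ^ Suc i * L (Suc i) x)) x
        = c (Suc i) * laplacian (\<lambda>x. (x \<bullet> x) ^ Suc i * L (Suc i) x) x"
      by (intro laplacian_cmult hpoly_real_polynomial_function[OF hpoly_inner_self_power[OF L]])
    also have "laplacian (\<lambda>x. (x \<bullet> x) ^ Suc i * L (Suc i) x) x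
        = (x \<bullet> x) ^ Suc i * L (Suc (Suc i)) x + \<beta> i * (x \<bullet> x) ^ i * L (Suc i) x"
      using laplacian_inner_self_power_mult[OF L[of "Suc i"], of i x] by (simp only: LS \<beta>_def)
    finally have "laplacian (\<lambda>x. c (Suc i) * ((x \<bullet> x) ^ Suc i * L (Suc i) x)) x
      = c (Suc i) * ((x \<bullet> x) ^ Suc i * L (Suc (Suc i)) x) + (c (Suc i) * \<beta> i) * ((x \<bullet> x) ^ i * L (Suc i) x)"
      by (simp only: distrib_left mult_ac)
    then show ?thesis by (simp only: cS minus_mult_left[symmetric])
  qed
  define h where "h N = (\<lambda>x. \<Sum>i\<le>N. c i * ((x \<bullet> x) ^ i * L i x))" for N
  have hh: "hpoly n (h N)" for N unfolding h_def by (intro hpoly_sum term_hpoly)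
  have lap: "laplacian (h N) x = c N * ((x \<bullet> x) ^ N * L (Suc N) x)" for N x
  proof (induction N)
    case 0
    then show ?case by (simp add: h_def c0 LS)
  next
    case (Suc N)
    have "h (Suc N) = (\<lambda>x. h N x + c (Suc N) * ((x \<bullet> x) ^ Suc N * L (Suc N) x))" by (simp add: h_def)
    then have "laplacian (h (Suc N)) x
        = laplacian (h N) x + laplacian (\<lambda>x. c (Suc N) * ((x \<bullet> x) ^ Suc N * L (Suc N) x)) x"
      using laplacian_add hpoly_real_polynomial_function[OF hh] hpoly_real_polynomial_function[OF term_hpoly]
      by metis
    then show ?case unfolding Suc.IH lapterm by simp
  qed
  show ?thesis
  proof (rule that[OF hh[of n], of "\<lambda>i. - c i"])
    show "laplacian (h n) x = 0" for x by (simp add: lap L0)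
    fix x
    have "h n x = c 0 * ((x \<bullet> x) ^ 0 * L 0 x) + (\<Sum>i=1..n. c i * ((x \<bullet> x) ^ i * L i x))"
      unfolding h_def by (simp add: sum.atLeast0_atMost_Suc atMost_atLeast0 sum.atLeast_Suc_atMost)
    then show "p x = h n x + (\<Sum>i=1..n. - c i * (x \<bullet> x) ^ i * (laplacian ^^ i) p x)"
      by (simp add: c0 L_def sum_negf mult.assoc)
  qed
qed

definition harmonic_sum :: "nat \<Rightarrow> ('a::euclidean_space \<Rightarrow> real) \<Rightarrow> bool" where
  "harmonic_sum n f \<longleftrightarrow>
     (\<exists>H. (\<forall>i. H i \<in> spherical_harmonics i) \<and> (\<forall>x. norm x = 1 \<longrightarrow> f x = (\<Sum>i\<le>n. H i x)))"

lemma harmonic_sum_single: "f \<in> spherical_harmonics i \<Longrightarrow> i \<le> n \<Longrightarrow> harmonic_sum n f"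
  unfolding harmonic_sum_def
  by (intro exI[of _ "\<lambda>j. if j = i then f else (\<lambda>_. 0)"])
     (auto intro: spherical_harmonics_zero simp: if_distrib[of "\<lambda>f. f _"] sum.delta)

lemma harmonic_sum_add: "harmonic_sum n f \<Longrightarrow> harmonic_sum n g \<Longrightarrow> harmonic_sum n (\<lambda>x. f x + g x)"
  unfolding harmonic_sum_def
proof (elim exE conjE)
  fix h h' assume "\<forall>i. h i \<in> spherical_harmonics i" "\<forall>x. norm x = 1 \<longrightarrow> f x = (\<Sum>i\<le>n. h i x)"
    "\<forall>i. h' i \<in> spherical_harmonics i" "\<forall>x. norm x = 1 \<longrightarrow> g x = (\<Sum>i\<le>n. h' i x)"
  then show "\<exists>h. (\<forall>i. h i \<in> spherical_harmonics i) \<and> (\<forall>x. norm x = 1 \<longrightarrow> f x + g x = (\<Sum>i\<le>n. h i x))"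
    by (intro exI[of _ "\<lambda>i x. h i x + h' i x"]) (auto intro: spherical_harmonics_add simp: sum.distrib)
qed

lemma harmonic_sum_scale: "harmonic_sum n f \<Longrightarrow> harmonic_sum n (\<lambda>x. c * f x)"
  unfolding harmonic_sum_def
proof (elim exE conjE)
  fix h assume "\<forall>i. h i \<in> spherical_harmonics i" "\<forall>x. norm x = 1 \<longrightarrow> f x = (\<Sum>i\<le>n. h i x)"
  then show "\<exists>h. (\<forall>i. h i \<in> spherical_harmonics i) \<and> (\<forall>x. norm x = 1 \<longrightarrow> c * f x = (\<Sum>i\<le>n. h i x))"
    by (intro exI[of _ "\<lambda>i x. c * h i x"]) (auto intro: spherical_harmonics_scale simp: sum_distrib_left)
qed

lemma harmonic_sum_sum: "(\<And>i. i \<in> I \<Longrightarrow> harmonic_sum n (f i)) \<Longrightarrow> harmonic_sum n (\<lambda>x. \<Sum>i\<in>I. f i x)"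
proof (induction I rule: infinite_finite_induct)
  case (insert a F)
  then show ?case by (auto intro: harmonic_sum_add)
qed (auto intro: harmonic_sum_single[OF spherical_harmonics_zero, of 0])

lemma harmonic_sum_cong: "harmonic_sum n f \<Longrightarrow> (\<And>x. norm x = 1 \<Longrightarrow> f x = g x) \<Longrightarrow> harmonic_sum n g"
  unfolding harmonic_sum_def by metis

lemma harmonic_sum_mono:
  assumes "harmonic_sum m f" "m \<le> n" shows "harmonic_sum n f"
proof -
  obtain H where H: "\<And>i. H i \<in> spherical_harmonics i" "\<And>x. norm x = 1 \<Longrightarrow> f x = (\<Sum>i\<le>m. H i x)"
    using assms(1) unfolding harmonic_sum_def by metis
  have "harmonic_sum n (\<lambda>x. \<Sum>i\<le>m. H i x)"
    by (intro harmonic_sum_sum harmonic_sum_single[OF H(1)]) (use assms(2) in auto)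
  then show ?thesis by (rule harmonic_sum_cong) (simp add: H(2))
qed

text \<open>On the sphere the factors \<open>(x \<bullet> x) ^ i\<close> equal one, so
  \<open>harmonic_part\<close> leaves a harmonic polynomial and iterated Laplacians of smaller
  degree.\<close>

lemma hpoly_harmonic_sum: "hpoly n p \<Longrightarrow> harmonic_sum n p"
proof (induction n arbitrary: p rule: less_induct)
  case (less n)
  obtain h c where h: "hpoly n h" "\<And>x. laplacian h x = 0"
    "\<And>x. p x = h x + (\<Sum>i=1..n. c i * (x \<bullet> x) ^ i * (laplacian ^^ i) p x)"
    using harmonic_part[OF less.prems] by blast
  have "harmonic_sum n (\<lambda>x. h x + (\<Sum>i=1..n. c i * (laplacian ^^ i) p x))"
  proof (intro harmonic_sum_add harmonic_sum_sum harmonic_sum_scale)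
    show "harmonic_sum n h"
      by (rule harmonic_sum_single[of _ n]) (use h in \<open>auto simp: spherical_harmonics_iff\<close>)
    fix i assume "i \<in> {1..n}"
    \<comment> \<open>The range of \<open>i\<close> forces \<open>n \<ge> 1\<close>, so
      \<open>n - 2 * i < n\<close> even where the subtraction truncates.\<close>
    then have "harmonic_sum (n - 2 * i) ((laplacian ^^ i) p)"
      by (intro less.IH hpoly_iterated_laplacian less.prems) auto
    then show "harmonic_sum n ((laplacian ^^ i) p)" by (rule harmonic_sum_mono) simp
  qed
  then show ?case by (rule harmonic_sum_cong) (simp add: h(3) dot_square_norm)
qed

lemma polydeg_harmonic_sum: "polydeg n p \<Longrightarrow> harmonic_sum n p"
proof -
  assume "polydeg n p"
  then obtain h where h: "\<And>i. hpoly i (h i)" "\<And>x. p x = (\<Sum>i\<le>n. h i x)"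
    unfolding polydeg_def by metis
  have "harmonic_sum n (\<lambda>x. \<Sum>i\<le>n. h i x)"
    by (intro harmonic_sum_sum harmonic_sum_mono[OF hpoly_harmonic_sum[OF h(1)]]) auto
  then show ?thesis by (rule harmonic_sum_cong) (simp add: h(2))
qed

section \<open>Rotations and orthogonality\<close>

lemma real_polynomial_function_continuous: "real_polynomial_function f \<Longrightarrow> continuous_on S f"
  by (simp add: continuous_on_polymonial_function real_polynomial_function_eq)

text \<open>The rotation by \<open>t\<close> in the plane of \<open>b\<close> and \<open>c\<close>,
  written as a correction to \<open>x\<close> so that the orthogonal complement is visibly
  fixed.\<close>

definition plane_rotation :: "'a \<Rightarrow> 'a \<Rightarrow> real \<Rightarrow> 'a::euclidean_space \<Rightarrow> 'a" where
  "plane_rotation b c t x = x + ((cos t - 1) * (x \<bullet> b) - sin t * (x \<bullet> c)) *\<^sub>R b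
                       + (sin t * (x \<bullet> b) + (cos t - 1) * (x \<bullet> c)) *\<^sub>R c"

context
  fixes b c :: "'a::euclidean_space"
  assumes bc: "b \<in> Basis" "c \<in> Basis" "b \<noteq> c"
begin

lemma plane_rotation_inner:
  "plane_rotation b c t x \<bullet> b = cos t * (x \<bullet> b) - sin t * (x \<bullet> c)"
  "plane_rotation b c t x \<bullet> c = sin t * (x \<bullet> b) + cos t * (x \<bullet> c)"
  using bc by (simp_all add: plane_rotation_def inner_simps inner_Basis algebra_simps)

lemma orthogonal_plane_rotation: "orthogonal_transformation (plane_rotation b c t)"
  unfolding orthogonal_transformation
proof (intro conjI allI)
  show "linear (plane_rotation b c t)"
    by (rule linearI) (simp_all add: plane_rotation_def inner_simps algebra_simps)
  fix x
  define p q where "p = x \<bullet> b" and "q = x \<bullet> c"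
  define y where "y = plane_rotation b c t x"
  have y: "y = x + ((cos t - 1) * p - sin t * q) *\<^sub>R b + (sin t * p + (cos t - 1) * q) *\<^sub>R c"
    by (simp add: y_def plane_rotation_def p_def q_def)
  \<comment> \<open>Stated for arbitrary reals, the identity isolates the factor
    \<open>C\<^sup>2 + S\<^sup>2 - 1\<close>, which vanishes for cosine and sine.\<close>
  have ring: "X + ((C - 1) * p - S * q) * p + (S * p + (C - 1) * q) * q + ((C - 1) * p - S * q) * (C * p - S * q)
      + (S * p + (C - 1) * q) * (S * p + C * q) = X + (p\<^sup>2 + q\<^sup>2) * (C\<^sup>2 + S\<^sup>2 - 1)" for X C S :: real
    by (simp add: power2_eq_square algebra_simps)
  have "y \<bullet> y = y \<bullet> x + ((cos t - 1) * p - sin t * q) * (y \<bullet> b) + (sin t * p + (cos t - 1) * q) * (y \<bullet> c)"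
    by (subst (2) y) (simp add: inner_simps)
  also have "y \<bullet> x = x \<bullet> x + ((cos t - 1) * p - sin t * q) * p + (sin t * p + (cos t - 1) * q) * q"
    by (subst y) (simp add: inner_simps p_def q_def inner_commute)
  also have "y \<bullet> b = cos t * p - sin t * q" by (simp add: y_def plane_rotation_inner p_def q_def)
  also have "y \<bullet> c = sin t * p + cos t * q" by (simp add: y_def plane_rotation_inner p_def q_def)
  finally have "y \<bullet> y = x \<bullet> x + (p\<^sup>2 + q\<^sup>2) * ((cos t)\<^sup>2 + (sin t)\<^sup>2 - 1)"
    unfolding ring .
  then show "norm (plane_rotation b c t x) = norm x"
    by (simp add: norm_eq_sqrt_inner y_def)
qed

lemma has_vector_derivative_plane_rotation:
  "((\<lambda>t. plane_rotation b c t x) has_vector_derivative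
      (plane_rotation b c t x \<bullet> b) *\<^sub>R c - (plane_rotation b c t x \<bullet> c) *\<^sub>R b) (at t)"
  unfolding plane_rotation_inner unfolding plane_rotation_def
  by (auto intro!: derivative_eq_intros simp: algebra_simps)

end

text \<open>The generator of the rotations in the plane of \<open>b\<close> and \<open>c\<close>, an
  angular momentum operator. The sum of the squares of these operators takes the place of an
  intrinsic Laplacian.\<close>

definition rotderiv :: "'a \<Rightarrow> 'a \<Rightarrow> ('a::euclidean_space \<Rightarrow> real) \<Rightarrow> 'a \<Rightarrow> real" where
  "rotderiv b c f x = (x \<bullet> b) * pd c f x - (x \<bullet> c) * pd b f x"

lemma real_polynomial_function_rotderiv:
  "real_polynomial_function f \<Longrightarrow> real_polynomial_function (rotderiv b c f)"
  unfolding rotderiv_def[abs_def]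
  by (intro real_polynomial_function_diff real_polynomial_function.intros(4)
        real_polynomial_function_inner real_polynomial_function_pd)

lemma rotderiv_mult:
  assumes "real_polynomial_function f" "real_polynomial_function g"
  shows "rotderiv b c (\<lambda>x. f x * g x) x = f x * rotderiv b c g x + rotderiv b c f x * g x"
  by (simp add: rotderiv_def pd_mult assms algebra_simps)

lemma DERIV_plane_rotation:
  assumes bc: "b \<in> Basis" "c \<in> Basis" "b \<noteq> c" and f: "real_polynomial_function f"
  shows "((\<lambda>t. f (plane_rotation b c t x)) has_real_derivative rotderiv b c f (plane_rotation b c t x)) (at t)"
proof -
  define y where "y = plane_rotation b c t x"
  have basis: "(\<Sum>e\<in>Basis. (v \<bullet> e) * pd e f y) = pd v f y" if "v \<in> Basis" for v
    using that by (simp add: inner_Basis if_distrib[of "\<lambda>z. z * _"] cong: if_cong)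
  have "(\<Sum>e\<in>Basis. (((y \<bullet> b) *\<^sub>R c - (y \<bullet> c) *\<^sub>R b) \<bullet> e) * pd e f y)
      = (y \<bullet> b) * (\<Sum>e\<in>Basis. (c \<bullet> e) * pd e f y) - (y \<bullet> c) * (\<Sum>e\<in>Basis. (b \<bullet> e) * pd e f y)"
    by (simp add: inner_simps left_diff_distrib sum_subtractf sum_distrib_left mult.assoc)
  then have "(\<Sum>e\<in>Basis. (((y \<bullet> b) *\<^sub>R c - (y \<bullet> c) *\<^sub>R b) \<bullet> e) * pd e f y) = rotderiv b c f y"
    using bc by (simp add: rotderiv_def basis)
  then show ?thesis
    using DERIV_along_curve[OF f has_vector_derivative_plane_rotation[OF bc, of x t]] by (simp add: y_def)
qed

text \<open>Differentiate the rotation invariance of the integral at the identity.\<close>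

lemma integral_rotderiv:
  fixes f :: "'a::euclidean_space \<Rightarrow> real"
  assumes "b \<in> Basis" "c \<in> Basis" and f: "real_polynomial_function f"
  shows "(\<integral>x. rotderiv b c f x \<partial>sphere_measure) = 0"
proof (cases "b = c")
  case True
  then show ?thesis by (simp add: rotderiv_def)
next
  case False
  note bc = assms(1,2) False
  note orth = orthogonal_plane_rotation[OF bc]
  define R where "R = plane_rotation b c"
  define h where "h n = inverse (real (Suc n))" for n
  define D where "D n x = (f (R (h n) x) - f x) / h n" for n x
  have h: "h n > 0" for n by (simp add: h_def)
  have nR: "norm (R t x) = norm x" for t x
    unfolding R_def using orth by (rule orthogonal_transformation_norm)
  have R0: "R 0 x = x" for x by (simp add: R_def plane_rotation_def)
  have contf: "continuous_on S f" and contL: "continuous_on S (rotderiv b c f)" for S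
    by (intro real_polynomial_function_continuous real_polynomial_function_rotderiv f)+
  have contR: "continuous_on (sphere 0 1) (\<lambda>x. f (R t x))" for t
  proof (rule continuous_on_compose2[OF contf[of UNIV]])
    show "continuous_on (sphere 0 1) (R t)"
      unfolding R_def using orthogonal_transformation_linear[OF orth] by (simp add: linear_continuous_on linear_linear)
  qed auto
  obtain B where B: "0 \<le> B" "\<And>x. norm x = 1 \<Longrightarrow> \<bar>rotderiv b c f x\<bar> \<le> B"
    using continuous_sphere_bounded[OF contL] by blast
  have deriv: "((\<lambda>t. f (R t x)) has_real_derivative rotderiv b c f (R t x)) (at t)" for t x
    unfolding R_def by (rule DERIV_plane_rotation[OF bc f])
  \<comment> \<open>The mean value theorem along the orbit yields a dominating constant, since the
    orbit stays on the sphere.\<close>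
  have bound: "\<bar>D n x\<bar> \<le> B" if "norm x = 1" for n x
  proof -
    obtain z where "f (R (h n) x) - f (R 0 x) = (h n - 0) * rotderiv b c f (R z x)"
      using MVT2[OF h[of n], of "\<lambda>t. f (R t x)" "\<lambda>t. rotderiv b c f (R t x)"] deriv by blast
    then have "D n x = rotderiv b c f (R z x)" using h[of n] by (simp add: D_def R0)
    then show ?thesis using B(2)[of "R z x"] that by (simp add: nR)
  qed
  have lim: "(\<lambda>n. D n x) \<longlonglongrightarrow> rotderiv b c f x" for x
  proof -
    have "((\<lambda>t. (f (R t x) - f (R 0 x)) / (t - 0)) \<longlongrightarrow> rotderiv b c f (R 0 x)) (at 0)"
      using deriv[of x 0] by (simp add: has_field_derivative_iff)
    moreover have "filterlim h (at 0) sequentially"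
      unfolding filterlim_at h_def[abs_def] using LIMSEQ_inverse_real_of_nat by auto
    ultimately show ?thesis
      using filterlim_compose[of "\<lambda>t. (f (R t x) - f (R 0 x)) / (t - 0)" _ "at 0" h sequentially]
      by (simp add: D_def R0)
  qed
  have contD: "continuous_on (sphere 0 1) (D n)" for n
    unfolding D_def[abs_def] using h[of n] by (intro continuous_intros contR contf) auto
  have "(\<integral>x. D n x \<partial>sphere_measure) = 0" for n
  proof -
    have "(\<integral>x. f (R (h n) x) - f x \<partial>sphere_measure) = 0"
      using integral_sphere_orthogonal[OF orth contf, of "h n"]
      by (subst Bochner_Integration.integral_diff) (auto intro!: integrable_sphere contR contf simp flip: R_def)
    then show ?thesis by (simp add: D_def[abs_def])
  qed
  moreover have "(\<lambda>n. \<integral>x. D n x \<partial>sphere_measure) \<longlonglongrightarrow> (\<integral>x. rotderiv b c f x \<partial>sphere_measure)"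
  proof (rule integral_dominated_convergence[where w="\<lambda>_. B"])
    show "AE x in sphere_measure. (\<lambda>n. D n x) \<longlonglongrightarrow> rotderiv b c f x" by (simp add: lim)
    show "AE x in sphere_measure. norm (D n x) \<le> B" for n
      by (rule AE_I2) (simp add: bound)
  qed (auto intro!: continuous_measurable_sphere contL contD integrable_sphere)
  ultimately show ?thesis by (simp add: LIMSEQ_const_iff)
qed

text \<open>\<open>rotderiv\<close> is a derivation whose images have integral zero, hence
  antisymmetric; applied twice it is symmetric.\<close>

lemma integral_rotderiv_by_parts:
  fixes f g :: "'a::euclidean_space \<Rightarrow> real"
  assumes "b \<in> Basis" "c \<in> Basis" and f: "real_polynomial_function f" and g: "real_polynomial_function g"
  shows "(\<integral>x. f x * rotderiv b c g x \<partial>sphere_measure) = - (\<integral>x. rotderiv b c f x * g x \<partial>sphere_measure)"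
proof -
  note rp = f g real_polynomial_function_rotderiv real_polynomial_function.intros(4)
  have "0 = (\<integral>x. rotderiv b c (\<lambda>x. f x * g x) x \<partial>sphere_measure)"
    by (subst integral_rotderiv) (auto intro: assms rp)
  also have "\<dots> = (\<integral>x. f x * rotderiv b c g x + rotderiv b c f x * g x \<partial>sphere_measure)"
    by (simp add: rotderiv_mult[OF f g])
  also have "\<dots> = (\<integral>x. f x * rotderiv b c g x \<partial>sphere_measure) + (\<integral>x. rotderiv b c f x * g x \<partial>sphere_measure)"
    by (rule Bochner_Integration.integral_add)
       (intro integrable_sphere real_polynomial_function_continuous rp)+
  finally show ?thesis by simp
qed

text \<open>Every plane is counted as \<open>(b, c)\<close> and as \<open>(c, b)\<close>, hence the
  factor 2. For harmonic \<open>p\<close> the first term drops out, which exhibits \<open>p\<close>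
  as an eigenfunction with an eigenvalue that depends on the degree.\<close>

lemma sum_rotderiv_rotderiv:
  fixes p :: "'a::euclidean_space \<Rightarrow> real"
  assumes p: "hpoly m p"
  shows "(\<Sum>b\<in>Basis. \<Sum>c\<in>Basis. rotderiv b c (rotderiv b c p) x)
           = 2 * (x \<bullet> x) * laplacian p x - 2 * real m * (real m + DIM('a) - 2) * p x"
proof -
  note rp = hpoly_real_polynomial_function[OF p]
  define a P where "a b = x \<bullet> b" and "P b = pd b p x" for b
  define Q where "Q b c = pd c (pd b p) x" for b c
  have expand: "rotderiv b c (rotderiv b c p) x
      = (a b)\<^sup>2 * Q c c + (a c)\<^sup>2 * Q b b + (if b = c then a b * P c else 0) + (if b = c then a c * P b else 0)
        - a b * a c * Q b c - a c * a b * Q c b - a b * P b - a c * P c"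
    if "b \<in> Basis" "c \<in> Basis" for b c
  proof -
    have pdd: "pd e (rotderiv b c p) x
      = a b * pd e (pd c p) x + (e \<bullet> b) * P c - (a c * pd e (pd b p) x + (e \<bullet> c) * P b)" for e
    proof -
      have "rotderiv b c p = (\<lambda>x. (x \<bullet> b) * pd c p x + (-1) * ((x \<bullet> c) * pd b p x))"
        by (rule ext) (simp add: rotderiv_def)
      moreover have "pd e (\<lambda>x. (x \<bullet> b) * pd c p x + (-1) * ((x \<bullet> c) * pd b p x))
          = (\<lambda>x. pd e (\<lambda>x. (x \<bullet> b) * pd c p x) x + (-1) * pd e (\<lambda>x. (x \<bullet> c) * pd b p x) x)"
        by (simp only: pd_add pd_cmult real_polynomial_function.intros(2-) real_polynomial_function_inner real_polynomial_function_pd rp)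
      ultimately show ?thesis
        by (simp only: pd_coord real_polynomial_function_pd rp) (simp add: a_def P_def)
    qed
    have "rotderiv b c (rotderiv b c p) x = a b * pd c (rotderiv b c p) x - a c * pd b (rotderiv b c p) x"
      by (simp add: rotderiv_def[of b c "rotderiv b c p"] a_def)
    then show ?thesis
      using that unfolding pdd
      by (simp add: Q_def inner_Basis power2_eq_square algebra_simps)
  qed
  have aa: "(\<Sum>b\<in>Basis. (a b)\<^sup>2) = x \<bullet> x"
    by (subst euclidean_inner) (simp add: a_def power2_eq_square)
  have lap: "(\<Sum>b\<in>Basis. Q b b) = laplacian p x" by (simp add: Q_def laplacian_pd)
  have eul: "(\<Sum>b\<in>Basis. a b * P b) = real m * p x"
    using euler_identity[OF p] by (simp add: a_def P_def)
  \<comment> \<open>Euler's identity for the derivatives, of degree \<open>m - 1\<close>. The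
    truncation at \<open>m = 0\<close> is harmless because the factor \<open>real m\<close>
    vanishes.\<close>
  have hess: "(\<Sum>b\<in>Basis. \<Sum>c\<in>Basis. a b * a c * Q b c) = (real m - 1) * real m * p x"
  proof -
    have "(\<Sum>c\<in>Basis. a b * a c * Q b c) = a b * (real (m - 1) * P b)" for b
      using euler_identity[OF hpoly_pd[OF p], of x b]
      by (simp add: sum_distrib_left[symmetric] mult.assoc a_def P_def Q_def)
    then have "(\<Sum>b\<in>Basis. \<Sum>c\<in>Basis. a b * a c * Q b c) = real (m - 1) * (\<Sum>b\<in>Basis. a b * P b)"
      by (simp add: sum_distrib_left mult_ac)
    then show ?thesis by (cases m) (simp_all add: eul)
  qed
  \<comment> \<open>Exchanging the sums makes an appeal to the symmetry of second derivatives
    unnecessary.\<close>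
  have hess': "(\<Sum>b\<in>Basis. \<Sum>c\<in>Basis. a c * a b * Q c b) = (real m - 1) * real m * p x"
    using hess by (subst sum.swap)
  have s1: "(\<Sum>b\<in>Basis. \<Sum>c\<in>Basis. (a b)\<^sup>2 * Q c c) = (x \<bullet> x) * laplacian p x"
    by (simp add: sum_product[symmetric] aa lap)
  have s2: "(\<Sum>b\<in>Basis. \<Sum>c\<in>Basis. (a c)\<^sup>2 * Q b b) = (x \<bullet> x) * laplacian p x"
    using s1 by (subst sum.swap)
  have s3: "(\<Sum>b\<in>Basis. \<Sum>c\<in>(Basis::'a set). a b * P b) = DIM('a) * (real m * p x)"
    by (simp add: sum_distrib_left[symmetric] eul)
  have s4: "(\<Sum>b\<in>(Basis::'a set). \<Sum>c\<in>Basis. a c * P c) = DIM('a) * (real m * p x)"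
    using s3 by (subst sum.swap)
  have s5: "(\<Sum>b\<in>Basis. \<Sum>c\<in>Basis. if b = c then a b * P c else 0) = real m * p x"
    "(\<Sum>b\<in>Basis. \<Sum>c\<in>Basis. if b = c then a c * P b else 0) = real m * p x"
    using eul by simp_all
  have "(\<Sum>b\<in>Basis. \<Sum>c\<in>Basis. rotderiv b c (rotderiv b c p) x)
      = (\<Sum>b\<in>Basis. \<Sum>c\<in>Basis. (a b)\<^sup>2 * Q c c) + (\<Sum>b\<in>Basis. \<Sum>c\<in>Basis. (a c)\<^sup>2 * Q b b)
        + (\<Sum>b\<in>Basis. \<Sum>c\<in>Basis. if b = c then a b * P c else 0)
        + (\<Sum>b\<in>Basis. \<Sum>c\<in>Basis. if b = c then a c * P b else 0)
        - (\<Sum>b\<in>Basis. \<Sum>c\<in>Basis. a b * a c * Q b c) - (\<Sum>b\<in>Basis. \<Sum>c\<in>Basis. a c * a b * Q c b)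
        - (\<Sum>b\<in>Basis. \<Sum>c\<in>(Basis::'a set). a b * P b) - (\<Sum>b\<in>(Basis::'a set). \<Sum>c\<in>Basis. a c * P c)"
    by (simp only: expand sum.distrib sum_subtractf cong: sum.cong)
  then show ?thesis unfolding s1 s2 s3 s4 s5 hess hess' by (simp add: algebra_simps)
qed

text \<open>A symmetric operator has orthogonal eigenfunctions for different eigenvalues. The
  dimension assumption makes \<open>e\<close> strictly increasing; on the line the degrees 0 and 1
  would share the eigenvalue 0.\<close>

lemma spherical_harmonics_orthogonal:
  fixes f g :: "'a::euclidean_space \<Rightarrow> real"
  assumes dim: "DIM('a) \<ge> 2" and f: "f \<in> spherical_harmonics l" and g: "g \<in> spherical_harmonics m" and lm: "l \<noteq> m"
  shows "(\<integral>x. f x * g x \<partial>sphere_measure) = 0"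
proof -
  obtain p where p: "hpoly l p" "\<And>x. laplacian p x = 0" "\<And>x. norm x = 1 \<Longrightarrow> f x = p x"
    using f unfolding spherical_harmonics_iff by blast
  obtain q where q: "hpoly m q" "\<And>x. laplacian q x = 0" "\<And>x. norm x = 1 \<Longrightarrow> g x = q x"
    using g unfolding spherical_harmonics_iff by blast
  note rp = hpoly_real_polynomial_function[OF p(1)] and rq = hpoly_real_polynomial_function[OF q(1)]
  note rpfs = rp rq real_polynomial_function_rotderiv real_polynomial_function.intros(4)
  define e where "e k = real k * (real k + DIM('a) - 2)" for k
  define S where "S h x = (\<Sum>b\<in>Basis. \<Sum>c\<in>Basis. rotderiv b c (rotderiv b c h) x)" for h :: "'a \<Rightarrow> real" and x
  have Sp: "S p x = - 2 * e l * p x" and Sq: "S q x = - 2 * e m * q x" for x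
    unfolding S_def sum_rotderiv_rotderiv[OF p(1)] sum_rotderiv_rotderiv[OF q(1)] p(2) q(2) e_def by simp_all
  have swap: "(\<integral>x. p x * rotderiv b c (rotderiv b c q) x \<partial>sphere_measure)
      = (\<integral>x. rotderiv b c (rotderiv b c p) x * q x \<partial>sphere_measure)" if "b \<in> Basis" "c \<in> Basis" for b c
    using integral_rotderiv_by_parts[OF that rp, of "rotderiv b c q"]
      integral_rotderiv_by_parts[OF that _ rq, of "rotderiv b c p"] by (simp add: rpfs)
  have int: "integrable sphere_measure h" if "real_polynomial_function h" for h :: "'a \<Rightarrow> real"
    using that by (intro integrable_sphere real_polynomial_function_continuous)
  have "(\<integral>x. p x * S q x \<partial>sphere_measure) = (\<integral>x. S p x * q x \<partial>sphere_measure)"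
  proof -
    have "(\<integral>x. p x * S q x \<partial>sphere_measure)
        = (\<Sum>b\<in>Basis. \<Sum>c\<in>Basis. \<integral>x. p x * rotderiv b c (rotderiv b c q) x \<partial>sphere_measure)"
      by (simp add: S_def sum_distrib_left Bochner_Integration.integral_sum Bochner_Integration.integrable_sum int rpfs)
    also have "\<dots> = (\<Sum>b\<in>Basis. \<Sum>c\<in>Basis. \<integral>x. rotderiv b c (rotderiv b c p) x * q x \<partial>sphere_measure)"
      by (intro sum.cong refl swap)
    also have "\<dots> = (\<integral>x. S p x * q x \<partial>sphere_measure)"
      by (simp add: S_def sum_distrib_right Bochner_Integration.integral_sum Bochner_Integration.integrable_sum int rpfs)
    finally show ?thesis .
  qed
  then have "e m * (\<integral>x. p x * q x \<partial>sphere_measure) = e l * (\<integral>x. p x * q x \<partial>sphere_measure)"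
    by (simp add: Sp Sq mult.left_commute[of "p _"] mult.assoc)
  moreover have "e j < e k" if "j < k" for j k
    unfolding e_def using that dim by (intro mult_strict_mono) auto
  then have "e m \<noteq> e l" using lm by (metis less_irrefl nat_neq_iff)
  ultimately have "(\<integral>x. p x * q x \<partial>sphere_measure) = 0" by simp
  then show ?thesis using p(3) q(3) by (subst integral_sphere_cong[of _ "\<lambda>x. p x * q x"]) auto
qed

section \<open>Counting spherical polynomials\<close>

text \<open>Only values on the sphere are constrained, because the basis functions are prescribed
  only there.\<close>

definition sphere_poly :: "nat \<Rightarrow> ('a::euclidean_space \<Rightarrow> real) \<Rightarrow> bool" where
  "sphere_poly n f \<longleftrightarrow> (\<exists>p. polydeg n p \<and> (\<forall>x. norm x = 1 \<longrightarrow> f x = p x))"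

lemma sphere_poly_sum:
  assumes "\<And>i. i \<in> I \<Longrightarrow> sphere_poly n (f i)" shows "sphere_poly n (\<lambda>x. \<Sum>i\<in>I. f i x)"
proof -
  obtain p where "\<And>i. i \<in> I \<Longrightarrow> polydeg n (p i)" "\<And>i x. i \<in> I \<Longrightarrow> norm x = 1 \<Longrightarrow> f i x = p i x"
    using assms unfolding sphere_poly_def by metis
  then show ?thesis unfolding sphere_poly_def
    by (intro exI[of _ "\<lambda>x. \<Sum>i\<in>I. p i x"] conjI polydeg_sum allI impI sum.cong) auto
qed

lemma sphere_poly_mult:
  assumes "sphere_poly m f" "sphere_poly n g" shows "sphere_poly (m + n) (\<lambda>x. f x * g x)"
proof -
  obtain p q where "polydeg m p" "polydeg n q" "\<And>x. norm x = 1 \<Longrightarrow> f x = p x" "\<And>x. norm x = 1 \<Longrightarrow> g x = q x"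
    using assms unfolding sphere_poly_def by blast
  then show ?thesis unfolding sphere_poly_def
    by (intro exI[of _ "\<lambda>x. p x * q x"] conjI polydeg_mult) auto
qed

lemma sphere_poly_scale: "sphere_poly n f \<Longrightarrow> sphere_poly n (\<lambda>x. c * f x)"
proof -
  have "sphere_poly 0 (\<lambda>_. c)"
    unfolding sphere_poly_def using polydeg_hpoly[OF hpoly.const, of 0 c] by blast
  then show "sphere_poly n f \<Longrightarrow> sphere_poly n (\<lambda>x. c * f x)"
    using sphere_poly_mult[of 0 "\<lambda>_. c" n f] by simp
qed

lemma sphere_poly_mono: "sphere_poly m f \<Longrightarrow> m \<le> n \<Longrightarrow> sphere_poly n f"
  unfolding sphere_poly_def using polydeg_mono by metis

lemma spherical_harmonics_sphere_poly: "f \<in> spherical_harmonics l \<Longrightarrow> sphere_poly l f"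
  unfolding spherical_harmonics_iff sphere_poly_def using polydeg_hpoly by blast

lemma sphere_poly_harmonic_sum: "sphere_poly n f \<Longrightarrow> harmonic_sum n f"
  unfolding sphere_poly_def using polydeg_harmonic_sum harmonic_sum_cong by metis

lemma polydeg_real_polynomial_function: "polydeg n p \<Longrightarrow> real_polynomial_function p"
proof -
  assume "polydeg n p"
  then obtain h where h: "\<And>i. hpoly i (h i)" "\<And>x. p x = (\<Sum>i\<le>n. h i x)"
    unfolding polydeg_def by metis
  then have "p = (\<lambda>x. \<Sum>i\<le>n. h i x)" by blast
  then show ?thesis
    using real_polynomial_function_sum[of "{..n}" "\<lambda>x i. h i x"] hpoly_real_polynomial_function[OF h(1)] by simp
qed

lemma sphere_poly_continuous: "sphere_poly n f \<Longrightarrow> continuous_on (sphere 0 1) f"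
proof -
  assume "sphere_poly n f"
  then obtain p where p: "polydeg n p" "\<And>x. norm x = 1 \<Longrightarrow> f x = p x" unfolding sphere_poly_def by blast
  have "continuous_on (sphere 0 1) p"
    by (intro real_polynomial_function_continuous polydeg_real_polynomial_function[OF p(1)])
  then show ?thesis by (rule continuous_on_eq) (simp add: p(2))
qed

lemma hpoly_compose_linear:
  assumes "linear T" "hpoly n f" shows "hpoly n (\<lambda>x. f (T x))"
  using assms(2)
proof (induction rule: hpoly.induct)
  case (coord n f b)
  have "T x \<bullet> b = (\<Sum>c\<in>Basis. (T c \<bullet> b) * (x \<bullet> c))" for x
  proof -
    have "T x = (\<Sum>c\<in>Basis. (x \<bullet> c) *\<^sub>R T c)"
      by (subst (1) euclidean_representation[of x, symmetric]) (simp only: linear_sum[OF assms(1)] linear_scale[OF assms(1)])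
    then show ?thesis by (simp add: inner_sum_left mult.commute)
  qed
  then have eq: "(\<lambda>x. \<Sum>c\<in>Basis. (T c \<bullet> b) * (x \<bullet> c)) = (\<lambda>x. T x \<bullet> b)" by (rule ext[OF sym])
  have "hpoly (Suc 0) (\<lambda>x. \<Sum>c\<in>Basis. (T c \<bullet> b) * (x \<bullet> c))"
    by (intro hpoly_sum hpoly_scale hpoly_inner)
  from hpoly_mult[OF back_subst[of "hpoly (Suc 0)", OF this eq] coord.IH] show ?case by simp
qed (auto intro: hpoly.intros)

lemma sphere_poly_compose_orthogonal:
  assumes T: "orthogonal_transformation T" and f: "sphere_poly n f"
  shows "sphere_poly n (\<lambda>x. f (T x))"
proof -
  obtain p where p: "polydeg n p" "\<And>x. norm x = 1 \<Longrightarrow> f x = p x"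
    using f unfolding sphere_poly_def by blast
  obtain h where h: "\<And>i. hpoly i (h i)" "\<And>x. p x = (\<Sum>i\<le>n. h i x)"
    using p(1) unfolding polydeg_def by metis
  have "polydeg n (\<lambda>x. p (T x))"
    unfolding polydeg_def h(2) using hpoly_compose_linear[OF orthogonal_transformation_linear[OF T] h(1)]
    by (intro exI[of _ "\<lambda>i x. h i (T x)"]) auto
  moreover have "norm (T x) = norm x" for x using T by (rule orthogonal_transformation_norm)
  ultimately show ?thesis unfolding sphere_poly_def using p(2) by metis
qed

text \<open>Gaussian elimination, one equation per induction step.\<close>

lemma homogeneous_system_nontrivial:
  fixes m :: "'i \<Rightarrow> 'j \<Rightarrow> real"
  assumes "finite A" "finite I" "card A < card I"
  shows "\<exists>t. (\<exists>i\<in>I. t i \<noteq> 0) \<and> (\<forall>a\<in>A. (\<Sum>i\<in>I. t i * m i a) = 0)"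
  using assms
proof (induction A arbitrary: I m rule: finite_induct)
  case empty
  then obtain i where "i \<in> I" by fastforce
  then show ?case by (intro exI[of _ "\<lambda>_. 1"]) auto
next
  case (insert a A)
  show ?case
  proof (cases "\<forall>i\<in>I. m i a = 0")
    case True
    have "card A < card I" using insert by simp
    from insert.IH[OF insert.prems(1) this, of m]
    obtain t where "\<exists>i\<in>I. t i \<noteq> 0" "\<forall>a\<in>A. (\<Sum>i\<in>I. t i * m i a) = 0"
      by blast
    then show ?thesis using True by (intro exI[of _ t]) auto
  next
    case False
    then obtain j where j: "j \<in> I" "m j a \<noteq> 0" by blast
    \<comment> \<open>The remaining equations after the unknown \<open>j\<close> has been eliminated
      by means of the equation \<open>a\<close>.\<close>
    define m' where "m' i a' = m i a' - m i a / m j a * m j a'" for i a'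
    have "finite (I - {j})" "card A < card (I - {j})" using insert j by simp_all
    from insert.IH[OF this, of m']
    obtain t where t: "\<exists>i\<in>I - {j}. t i \<noteq> 0" "\<forall>b\<in>A. (\<Sum>i\<in>I - {j}. t i * m' i b) = 0"
      by blast
    \<comment> \<open>Back substitution: the value at \<open>j\<close> is the one that solves the
      equation \<open>a\<close>.\<close>
    define s where "s i = (if i = j then - (\<Sum>i\<in>I - {j}. t i * m i a) / m j a else t i)" for i
    have split: "(\<Sum>i\<in>I. s i * m i b) = s j * m j b + (\<Sum>i\<in>I - {j}. t i * m i b)" for b
      using j insert.prems(1) by (simp add: sum.remove[of I j] s_def)
    have "(\<Sum>i\<in>I. s i * m i a) = 0" using j by (simp add: split) (simp add: s_def)
    moreover have "(\<Sum>i\<in>I. s i * m i b) = 0" if "b \<in> A" for b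
    proof -
      have "0 = (\<Sum>i\<in>I - {j}. t i * m i b) - (\<Sum>i\<in>I - {j}. t i * m i a) / m j a * m j b"
        using t(2) that
        by (simp add: m'_def right_diff_distrib sum_subtractf sum_distrib_right sum_divide_distrib mult.assoc)
      then show ?thesis by (simp add: split) (simp add: s_def)
    qed
    moreover have "\<exists>i\<in>I. s i \<noteq> 0" using t(1) by (auto simp: s_def)
    ultimately show ?thesis by (intro exI[of _ s]) auto
  qed
qed

text \<open>On the sphere the square of one coordinate is a polynomial in the others, so that monomials of
  degree at most one in that coordinate suffice.\<close>

context
  fixes b0 :: "'a::euclidean_space"
  assumes b0: "b0 \<in> Basis"
begin

text \<open>The second component is the exponent of \<open>b0\<close>. The other exponents form an
  extensional function, so the set is finite and can be counted as a product.\<close>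

definition red_index :: "nat \<Rightarrow> (('a \<Rightarrow> nat) \<times> nat) set" where
  "red_index N = {(\<alpha>, e). \<alpha> \<in> (Basis - {b0}) \<rightarrow>\<^sub>E {..N} \<and> e \<le> 1 \<and> sum \<alpha> (Basis - {b0}) + e \<le> N}"

definition red_mono :: "('a \<Rightarrow> nat) \<times> nat \<Rightarrow> 'a \<Rightarrow> real" where
  "red_mono i x = (\<Prod>b\<in>Basis - {b0}. (x \<bullet> b) ^ fst i b) * (x \<bullet> b0) ^ snd i"

definition red_span :: "nat \<Rightarrow> ('a \<Rightarrow> real) \<Rightarrow> bool" where
  "red_span N f \<longleftrightarrow> (\<exists>c. \<forall>x. norm x = 1 \<longrightarrow> f x = (\<Sum>i\<in>red_index N. c i * red_mono i x))"

lemma red_index_subset: "red_index N \<subseteq> ((Basis - {b0}) \<rightarrow>\<^sub>E {..N}) \<times> {..1}"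
  by (auto simp: red_index_def)

lemma finite_red_index: "finite (red_index N)"
  by (rule finite_subset[OF red_index_subset]) (intro finite_cartesian_product finite_PiE, auto)

text \<open>Without the bound on the total degree there remain \<open>DIM('a) - 1\<close> exponents
  up to \<open>N\<close> and two choices for the last one. The power is the dimension of the sphere,
  not of the ambient space; this is what the summability threshold \<open>d / 2\<close> rests
  on.\<close>

lemma card_red_index: "card (red_index N) \<le> 2 * (N + 1) ^ (DIM('a) - 1)"
proof -
  have "card (red_index N) \<le> card (((Basis - {b0}) \<rightarrow>\<^sub>E {..N}) \<times> {..1::nat})"
    by (rule card_mono[OF _ red_index_subset]) (intro finite_cartesian_product finite_PiE, auto)
  also have "\<dots> = (N + 1) ^ (DIM('a) - 1) * 2"
    using b0 by (simp add: card_cartesian_product card_PiE)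
  finally show ?thesis by simp
qed

lemma red_span_mono: "i \<in> red_index N \<Longrightarrow> red_span N (red_mono i)"
  unfolding red_span_def
  by (intro exI[of _ "\<lambda>j. if j = i then 1 else 0"])
     (simp add: finite_red_index if_distrib[of "\<lambda>y. y * _"] cong: if_cong)

lemma red_span_scale: "red_span N f \<Longrightarrow> red_span N (\<lambda>x. c * f x)"
  unfolding red_span_def
proof (elim exE)
  fix k assume "\<forall>x. norm x = 1 \<longrightarrow> f x = (\<Sum>i\<in>red_index N. k i * red_mono i x)"
  then show "\<exists>k. \<forall>x. norm x = 1 \<longrightarrow> c * f x = (\<Sum>i\<in>red_index N. k i * red_mono i x)"
    by (intro exI[of _ "\<lambda>i. c * k i"]) (simp add: sum_distrib_left mult.assoc)
qed

lemma red_span_add: "red_span N f \<Longrightarrow> red_span N g \<Longrightarrow> red_span N (\<lambda>x. f x + g x)"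
  unfolding red_span_def
proof (elim exE)
  fix k k' assume "\<forall>x. norm x = 1 \<longrightarrow> f x = (\<Sum>i\<in>red_index N. k i * red_mono i x)"
    "\<forall>x. norm x = 1 \<longrightarrow> g x = (\<Sum>i\<in>red_index N. k' i * red_mono i x)"
  then show "\<exists>k. \<forall>x. norm x = 1 \<longrightarrow> f x + g x = (\<Sum>i\<in>red_index N. k i * red_mono i x)"
    by (intro exI[of _ "\<lambda>i. k i + k' i"]) (simp add: distrib_right sum.distrib)
qed

lemma red_span_cong: "red_span N f \<Longrightarrow> (\<And>x. norm x = 1 \<Longrightarrow> f x = g x) \<Longrightarrow> red_span N g"
  unfolding red_span_def by metis

lemma red_span_sum: "(\<And>i. i \<in> I \<Longrightarrow> red_span N (f i)) \<Longrightarrow> red_span N (\<lambda>x. \<Sum>i\<in>I. f i x)"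
proof (induction I rule: infinite_finite_induct)
  case (insert a F)
  then show ?case by (auto intro: red_span_add)
qed (auto simp: red_span_def intro!: exI[of _ "\<lambda>_. 0"])

text \<open>The condition \<open>e' + k \<le> Suc e\<close> covers both uses: multiplication by
  another coordinate (\<open>k = 1\<close>, \<open>e' = e\<close>) and the replacement of a square
  (\<open>k = 2\<close>, \<open>e' = 0\<close>, \<open>e = 1\<close>).\<close>

lemma red_index_upd:
  assumes "(\<alpha>, e) \<in> red_index N" "b \<in> Basis - {b0}" "e' \<le> 1" "e' + k \<le> Suc e"
  shows "(\<alpha>(b := \<alpha> b + k), e') \<in> red_index (Suc N)"
proof -
  define B where "B = Basis - {b0}"
  have B: "finite B" "b \<in> B" using assms by (auto simp: B_def)
  have sum: "sum (\<alpha>(b := \<alpha> b + k)) B = sum \<alpha> B + k"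
    using B by (simp add: sum.remove[of B b])
  have \<alpha>: "\<alpha> \<in> B \<rightarrow>\<^sub>E {..N}" "sum \<alpha> B + e \<le> N" using assms(1) by (auto simp: red_index_def B_def)
  have le: "\<alpha> b \<le> sum \<alpha> B" using B by (intro member_le_sum) auto
  have "(\<alpha>(b := \<alpha> b + k)) \<in> B \<rightarrow>\<^sub>E {..Suc N}"
    using \<alpha> B le assms(4) by (auto simp: PiE_iff extensional_def le_SucI)
  then show ?thesis using \<alpha> assms(3,4) sum by (simp add: red_index_def B_def[symmetric])
qed

lemma red_mono_upd:
  assumes "b \<in> Basis - {b0}"
  shows "red_mono (\<alpha>(b := \<alpha> b + k), e) x = (x \<bullet> b) ^ k * red_mono (\<alpha>, e) x"
  using assms by (simp add: red_mono_def prod.remove[of "Basis - {b0}" b] power_add)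

lemma red_span_coord_mono:
  assumes i: "i \<in> red_index N" and b: "b \<in> Basis"
  shows "red_span (Suc N) (\<lambda>x. (x \<bullet> b) * red_mono i x)"
proof -
  obtain \<alpha> e where ae: "i = (\<alpha>, e)" by (cases i)
  note mem = i[unfolded ae]
  have sub: "(\<alpha>, e') \<in> red_index (Suc N)" if "e' \<le> 1" "e' \<le> Suc e" for e'
  proof -
    have "\<alpha> \<in> (Basis - {b0}) \<rightarrow>\<^sub>E {..Suc N}" "sum \<alpha> (Basis - {b0}) + e \<le> N"
      using mem by (auto simp: red_index_def PiE_iff le_SucI)
    then show ?thesis using that by (simp add: red_index_def)
  qed
  have e1: "e \<le> 1" using mem by (simp add: red_index_def)
  consider "b \<noteq> b0" | "b = b0" "e = 0" | "b = b0" "e = 1" using e1 by linarith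
  then show ?thesis
  proof cases
    case 1
    have "red_span (Suc N) (red_mono (\<alpha>(b := \<alpha> b + 1), e))"
      using 1 b e1 by (intro red_span_mono red_index_upd[OF mem]) auto
    then show ?thesis
      by (rule red_span_cong) (use 1 b in \<open>simp add: red_mono_upd ae del: One_nat_def\<close>)
  next
    case 2
    have "red_span (Suc N) (red_mono (\<alpha>, 1))" by (intro red_span_mono sub) auto
    then show ?thesis by (rule red_span_cong) (use 2 in \<open>simp add: red_mono_def ae\<close>)
  next
    \<comment> \<open>The new factor completes the square of the coordinate along \<open>b0\<close>,
      which on the sphere is one minus the other squares.\<close>
    case 3
    have "red_span (Suc N) (\<lambda>x. red_mono (\<alpha>, 0) x + (-1) * (\<Sum>c\<in>Basis - {b0}. red_mono (\<alpha>(c := \<alpha> c + 2), 0) x))"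
      using 3 by (intro red_span_add red_span_scale red_span_sum red_span_mono sub red_index_upd[OF mem]) auto
    then show ?thesis
    proof (rule red_span_cong)
      fix x :: 'a assume "norm x = 1"
      then have "1 = x \<bullet> x" by (simp add: dot_square_norm)
      also have "\<dots> = (\<Sum>c\<in>Basis. (x \<bullet> c)\<^sup>2)"
        by (subst euclidean_inner) (simp add: power2_eq_square)
      also have "\<dots> = (x \<bullet> b0)\<^sup>2 + (\<Sum>c\<in>Basis - {b0}. (x \<bullet> c)\<^sup>2)" using b0 by (simp add: sum.remove)
      finally have sq: "1 - (\<Sum>c\<in>Basis - {b0}. (x \<bullet> c)\<^sup>2) = (x \<bullet> b0) * (x \<bullet> b0)"
        by (simp add: power2_eq_square)
      have "red_mono (\<alpha>, 0) x + (-1) * (\<Sum>c\<in>Basis - {b0}. red_mono (\<alpha>(c := \<alpha> c + 2), 0) x)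
          = (1 - (\<Sum>c\<in>Basis - {b0}. (x \<bullet> c)\<^sup>2)) * red_mono (\<alpha>, 0) x"
        by (simp only: red_mono_upd cong: sum.cong) (simp add: left_diff_distrib sum_distrib_right)
      also have "\<dots> = (x \<bullet> b) * red_mono i x"
        unfolding sq using 3 by (simp add: red_mono_def ae)
      finally show "red_mono (\<alpha>, 0) x + (-1) * (\<Sum>c\<in>Basis - {b0}. red_mono (\<alpha>(c := \<alpha> c + 2), 0) x)
          = (x \<bullet> b) * red_mono i x" .
    qed
  qed
qed

lemma red_span_coord:
  assumes "red_span N f" "b \<in> Basis" shows "red_span (Suc N) (\<lambda>x. (x \<bullet> b) * f x)"
proof -
  obtain c where c: "\<And>x. norm x = 1 \<Longrightarrow> f x = (\<Sum>i\<in>red_index N. c i * red_mono i x)"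
    using assms(1) unfolding red_span_def by blast
  have "red_span (Suc N) (\<lambda>x. \<Sum>i\<in>red_index N. c i * ((x \<bullet> b) * red_mono i x))"
    by (intro red_span_sum red_span_scale red_span_coord_mono assms(2))
  then show ?thesis by (rule red_span_cong) (simp add: c sum_distrib_left mult_ac)
qed

lemma hpoly_red_span: "hpoly n f \<Longrightarrow> n \<le> N \<Longrightarrow> red_span N f"
proof (induction arbitrary: N rule: hpoly.induct)
  case (const c)
  have "red_span N (\<lambda>x. c * red_mono (restrict (\<lambda>_. 0) (Basis - {b0}), 0) x)"
    by (intro red_span_scale red_span_mono) (simp add: red_index_def)
  then show ?case by (rule red_span_cong) (simp add: red_mono_def)
next
  case (zero n)
  then show ?case using red_span_sum[of "{}"] by simp
next
  case (add n f g)
  then show ?case by (intro red_span_add) auto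
next
  case (coord n f b)
  then show ?case by (cases N) (auto intro: red_span_coord)
qed

lemma sphere_poly_red_span: "sphere_poly n f \<Longrightarrow> red_span n f"
proof -
  assume "sphere_poly n f"
  then obtain p h where h: "\<And>i. hpoly i (h i)" "\<And>x. p x = (\<Sum>i\<le>n. h i x)" "\<And>x. norm x = 1 \<Longrightarrow> f x = p x"
    unfolding sphere_poly_def polydeg_def by metis
  have "red_span n (\<lambda>x. \<Sum>i\<le>n. h i x)" by (intro red_span_sum hpoly_red_span[OF h(1)]) simp
  then show ?thesis by (rule red_span_cong) (simp add: h)
qed

end

text \<open>More functions than reduced monomials admit a nontrivial linear relation on the sphere;
  pairing it with each function contradicts orthonormality.\<close>

lemma card_orthonormal_sphere_poly:
  fixes e :: "'i \<Rightarrow> 'a::euclidean_space \<Rightarrow> real"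
  assumes I: "finite I" and e: "\<And>i. i \<in> I \<Longrightarrow> sphere_poly n (e i)"
    and orth: "\<And>i j. i \<in> I \<Longrightarrow> j \<in> I \<Longrightarrow> (\<integral>x. e i x * e j x \<partial>sphere_measure) = (if i = j then 1 else 0)"
  shows "card I \<le> 2 * (n + 1) ^ (DIM('a) - 1)"
proof (rule ccontr)
  assume neg: "\<not> ?thesis"
  obtain b0 :: 'a where b0: "b0 \<in> Basis" using nonempty_Basis by blast
  have "card (red_index b0 n) < card I" using card_red_index[OF b0, of n] neg by linarith
  have "\<forall>i\<in>I. \<exists>c. \<forall>x. norm x = 1 \<longrightarrow> e i x = (\<Sum>k\<in>red_index b0 n. c k * red_mono b0 k x)"
    using sphere_poly_red_span[OF b0 e] unfolding red_span_def[OF b0] by blast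
  then obtain m where m: "\<And>i x. i \<in> I \<Longrightarrow> norm x = 1 \<Longrightarrow> e i x = (\<Sum>k\<in>red_index b0 n. m i k * red_mono b0 k x)"
    unfolding bchoice_iff by blast
  obtain t where t: "\<exists>i\<in>I. t i \<noteq> 0" "\<And>k. k \<in> red_index b0 n \<Longrightarrow> (\<Sum>i\<in>I. t i * m i k) = 0"
    using homogeneous_system_nontrivial[OF finite_red_index[OF b0] I \<open>_ < card I\<close>, of m] by blast
  have cont: "i \<in> I \<Longrightarrow> continuous_on (sphere 0 1) (e i)" for i using e sphere_poly_continuous by blast
  have zero: "(\<Sum>i\<in>I. t i * e i x) = 0" if "norm x = 1" for x
  proof -
    have "(\<Sum>i\<in>I. t i * e i x) = (\<Sum>k\<in>red_index b0 n. (\<Sum>i\<in>I. t i * m i k) * red_mono b0 k x)"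
      using that by (simp add: m sum_distrib_left sum_distrib_right mult.assoc) (rule sum.swap)
    then show ?thesis by (simp add: t(2))
  qed
  have "t j = 0" if j: "j \<in> I" for j
  proof -
    have "0 = (\<integral>x. (\<Sum>i\<in>I. t i * e i x) * e j x \<partial>sphere_measure)"
      by (subst integral_sphere_cong[of _ "\<lambda>_. 0"]) (auto simp: zero)
    also have "\<dots> = (\<integral>x. (\<Sum>i\<in>I. t i * (e i x * e j x)) \<partial>sphere_measure)"
      by (simp add: sum_distrib_right mult.assoc)
    also have "\<dots> = (\<Sum>i\<in>I. t i * (\<integral>x. e i x * e j x \<partial>sphere_measure))"
      by (subst Bochner_Integration.integral_sum)
         (auto intro!: integrable_sphere continuous_intros cont j)
    also have "\<dots> = t j" using I j by (simp add: orth if_distrib[of "\<lambda>y. _ * y"] cong: if_cong)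
    finally show ?thesis by simp
  qed
  then show False using t(1) by blast
qed

section \<open>Expansions in spherical harmonics\<close>

lemma eigval_nonneg: "d \<ge> 1 \<Longrightarrow> eigval d l \<ge> 0"
  by (cases l) (auto simp: eigval_def)

lemma eigval_ge_square: "d \<ge> 1 \<Longrightarrow> eigval d l \<ge> (real l)\<^sup>2"
  unfolding eigval_def power2_eq_square by (intro mult_left_mono) auto

lemma eigval_mono: "d \<ge> 1 \<Longrightarrow> l \<le> m \<Longrightarrow> eigval d l \<le> eigval d m"
  unfolding eigval_def by (cases l) (auto intro!: mult_mono)

text \<open>The eigenvalue is additive up to the cross term \<open>2 i l\<close>. As
  \<open>i l\<close> is a natural number it is at most its square, and that is at most the product
  of the eigenvalues.\<close>

lemma eigval_add_le:
  assumes "d \<ge> 1" shows "1 + eigval d (i + l) \<le> 3 * ((1 + eigval d i) * (1 + eigval d l))"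
proof -
  have "real n \<le> (real n)\<^sup>2" for n by (cases n) (simp_all add: power2_eq_square)
  from this[of "i * l"] have "real i * real l \<le> (real i)\<^sup>2 * (real l)\<^sup>2"
    by (simp add: power_mult_distrib)
  also have "\<dots> \<le> eigval d i * eigval d l"
    using assms by (intro mult_mono eigval_ge_square) (auto intro: eigval_nonneg)
  finally have "real i * real l \<le> eigval d i * eigval d l" .
  moreover have "eigval d (i + l) = eigval d i + eigval d l + 2 * (real i * real l)"
    by (simp add: eigval_def algebra_simps)
  moreover note eigval_nonneg[OF assms, of i] eigval_nonneg[OF assms, of l]
    mult_nonneg_nonneg[OF eigval_nonneg[OF assms, of i] eigval_nonneg[OF assms, of l]]
  moreover have "3 * ((1 + eigval d i) * (1 + eigval d l))
      = 3 + 3 * eigval d i + 3 * eigval d l + 3 * (eigval d i * eigval d l)"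
    by (simp add: algebra_simps)
  ultimately show ?thesis by linarith
qed

text \<open>Single increments of \<open>D\<close> may exceed those of \<open>B\<close>; only the
  totals are ordered. Summation by parts for \<open>B - D\<close> with decreasing weights
  suffices.\<close>

lemma abel_summation_mono:
  fixes a D B :: "nat \<Rightarrow> real"
  assumes "decseq a" "\<And>n. a n \<ge> 0" "D 0 = B 0" "\<And>n. D n \<le> B n"
  shows "(\<Sum>l<N. a l * (D (Suc l) - D l)) \<le> (\<Sum>l<N. a l * (B (Suc l) - B l))"
proof -
  define e where "e n = B n - D n" for n
  have e: "e n \<ge> 0" for n using assms(4) by (simp add: e_def)
  \<comment> \<open>Keeping the boundary term, instead of mere nonnegativity, is what the induction
    needs.\<close>
  have "a N * e N \<le> (\<Sum>l<N. a l * (e (Suc l) - e l))"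
  proof (induction N)
    case 0
    then show ?case by (simp add: e_def assms(3))
  next
    case (Suc N)
    have "a (Suc N) * e (Suc N) \<le> a N * e (Suc N)"
      using assms(1) e by (intro mult_right_mono) (auto simp: decseq_Suc_iff)
    then show ?case using Suc by (simp add: algebra_simps)
  qed
  moreover have "0 \<le> a N * e N" using assms(2) e by simp
  ultimately have "0 \<le> (\<Sum>l<N. a l * (e (Suc l) - e l))" by linarith
  then show ?thesis by (simp add: e_def algebra_simps sum_subtractf sum.distrib)
qed

locale harmonic_system =
  fixes d :: nat and Z :: "nat \<Rightarrow> nat" and Y :: "nat \<Rightarrow> nat \<Rightarrow> real^'n \<Rightarrow> real"
  assumes dim: "CARD('n) = d + 1" "d \<ge> 1" and basis: "harmonic_basis Z Y"
begin

definition ind :: "(nat \<times> nat) set" where "ind = (SIGMA l:UNIV. {1..Z l})"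

text \<open>Degrees strictly below \<open>N\<close>, to match partial sums of series; polynomials of
  degree at most \<open>n\<close> need \<open>indN (Suc n)\<close>.\<close>

definition indN :: "nat \<Rightarrow> (nat \<times> nat) set" where "indN N = (SIGMA l:{..<N}. {1..Z l})"

definition E :: "nat \<times> nat \<Rightarrow> real^'n \<Rightarrow> real" where "E i = Y (fst i) (snd i)"

lemma finite_indN [simp]: "finite (indN N)" by (simp add: indN_def)

lemma indN_iff: "i \<in> indN N \<longleftrightarrow> i \<in> ind \<and> fst i < N" by (auto simp: ind_def indN_def)

lemma indN_subset: "indN N \<subseteq> ind" by (auto simp: indN_iff)

lemma sum_indN: "(\<Sum>i\<in>indN N. g i) = (\<Sum>l<N. \<Sum>k=1..Z l. g (l, k))"
  unfolding indN_def by (subst sum.Sigma) auto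

lemma E_harmonic: "i \<in> ind \<Longrightarrow> E i \<in> spherical_harmonics (fst i)"
  using basis by (auto simp: harmonic_basis_def ind_def E_def)

lemma sphere_poly_E: "i \<in> ind \<Longrightarrow> sphere_poly (fst i) (E i)"
  by (intro spherical_harmonics_sphere_poly E_harmonic)

lemma continuous_E: "i \<in> ind \<Longrightarrow> continuous_on (sphere 0 1) (E i)"
  using sphere_poly_E sphere_poly_continuous by blast

lemma E_orthonormal:
  assumes "i \<in> ind" "j \<in> ind"
  shows "(\<integral>x. E i x * E j x \<partial>sphere_measure) = (if i = j then 1 else 0)"
proof (cases "fst i = fst j")
  case True
  then show ?thesis using assms basis
    by (cases i; cases j) (auto simp: harmonic_basis_def ind_def E_def)
next
  case False
  have "DIM(real^'n) \<ge> 2" using dim by simp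
  then show ?thesis
    using spherical_harmonics_orthogonal[OF _ E_harmonic[OF assms(1)] E_harmonic[OF assms(2)] False] False by auto
qed

section \<open>Finite expansions and Bessel's inequality\<close>

lemma continuous_lincomb:
  "A \<subseteq> ind \<Longrightarrow> continuous_on (sphere 0 1) (\<lambda>x. \<Sum>i\<in>A. a i * E i x)"
  by (intro continuous_intros continuous_E) auto

lemma of_fun_sum:
  assumes "\<And>i. i \<in> A \<Longrightarrow> continuous_on (sphere 0 1) (f i)" "continuous_on (sphere 0 1) h"
  shows "of_fun (\<lambda>x. \<Sum>i\<in>A. a i * f i x) h = (\<Sum>i\<in>A. a i * of_fun (f i) (h :: real^'n \<Rightarrow> real))"
  unfolding of_fun_def sum_distrib_right mult.assoc
  by (subst Bochner_Integration.integral_sum) (auto intro!: integrable_sphere continuous_intros assms)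

lemma of_fun_cong: "(\<And>x. norm x = 1 \<Longrightarrow> f x = g x) \<Longrightarrow> of_fun f h = of_fun g (h :: real^'n \<Rightarrow> real)"
  unfolding of_fun_def by (rule integral_sphere_cong) simp

lemma of_fun_commute: "of_fun f h = of_fun h (f :: real^'n \<Rightarrow> real)"
  by (simp add: of_fun_def mult.commute)

lemma of_fun_E: "i \<in> ind \<Longrightarrow> j \<in> ind \<Longrightarrow> of_fun (E i) (E j) = (if i = j then 1 else 0)"
  by (simp add: of_fun_def E_orthonormal)

lemma of_fun_lincomb_E:
  assumes "finite A" "A \<subseteq> ind" "j \<in> ind"
  shows "of_fun (\<lambda>x. \<Sum>i\<in>A. a i * E i x) (E j) = (if j \<in> A then a j else 0)"
proof -
  have "of_fun (\<lambda>x. \<Sum>i\<in>A. a i * E i x) (E j) = (\<Sum>i\<in>A. a i * of_fun (E i) (E j))"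
    using assms by (intro of_fun_sum continuous_E) auto
  also have "\<dots> = (\<Sum>i\<in>A. if i = j then a i else 0)"
    using assms by (intro sum.cong) (auto simp: of_fun_E)
  finally show ?thesis using assms(1) by simp
qed

lemma integral_square_lincomb:
  assumes "finite A" "A \<subseteq> ind"
  shows "(\<integral>x. (\<Sum>i\<in>A. a i * E i x)\<^sup>2 \<partial>sphere_measure) = (\<Sum>i\<in>A. (a i)\<^sup>2)"
proof -
  have "(\<integral>x. (\<Sum>i\<in>A. a i * E i x)\<^sup>2 \<partial>sphere_measure)
      = of_fun (\<lambda>x. \<Sum>i\<in>A. a i * E i x) (\<lambda>x. \<Sum>i\<in>A. a i * E i x)"
    by (simp add: of_fun_def power2_eq_square)
  also have "\<dots> = (\<Sum>i\<in>A. a i * of_fun (E i) (\<lambda>x. \<Sum>i\<in>A. a i * E i x))"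
    using assms by (intro of_fun_sum continuous_E continuous_lincomb) auto
  also have "\<dots> = (\<Sum>i\<in>A. a i * a i)"
    using assms by (intro sum.cong refl arg_cong2[where f="(*)"])
      (subst of_fun_commute, subst of_fun_lincomb_E, auto)
  finally show ?thesis by (simp add: power2_eq_square)
qed

lemma bessel:
  assumes "finite A" "A \<subseteq> ind" and f: "continuous_on (sphere 0 1) f"
  shows "(\<Sum>i\<in>A. (of_fun f (E i))\<^sup>2) \<le> (\<integral>x. (f x)\<^sup>2 \<partial>sphere_measure)"
proof -
  define c where "c i = of_fun f (E i)" for i
  define g where "g x = (\<Sum>i\<in>A. c i * E i x)" for x
  have g: "continuous_on (sphere 0 1) g"
    unfolding g_def using assms by (intro continuous_lincomb)
  have "of_fun g f = (\<Sum>i\<in>A. c i * of_fun (E i) f)"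
    unfolding g_def using assms by (intro of_fun_sum continuous_E f) auto
  then have fg: "(\<integral>x. g x * f x \<partial>sphere_measure) = (\<Sum>i\<in>A. (c i)\<^sup>2)"
    by (simp add: of_fun_commute[of "E _" f] c_def power2_eq_square) (simp add: of_fun_def)
  have gg: "(\<integral>x. (g x)\<^sup>2 \<partial>sphere_measure) = (\<Sum>i\<in>A. (c i)\<^sup>2)"
    unfolding g_def using assms by (intro integral_square_lincomb)
  have "0 \<le> (\<integral>x. (f x - g x)\<^sup>2 \<partial>sphere_measure)" by simp
  also have "\<dots> = (\<integral>x. (f x)\<^sup>2 + ((g x)\<^sup>2 + (-2) * (g x * f x)) \<partial>sphere_measure)"
    by (rule arg_cong[where f="integral\<^sup>L _"]) (auto simp: power2_eq_square algebra_simps)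
  also have "\<dots> = (\<integral>x. (f x)\<^sup>2 \<partial>sphere_measure) + ((\<integral>x. (g x)\<^sup>2 \<partial>sphere_measure) + (\<integral>x. (-2) * (g x * f x) \<partial>sphere_measure))"
    by (subst Bochner_Integration.integral_add Bochner_Integration.integral_add;
        (intro integrable_sphere continuous_intros f g)?)+ simp
  finally show ?thesis using fg gg by (simp add: c_def)
qed

lemma harmonic_sum_expansion:
  assumes f: "harmonic_sum n f" and x: "norm x = 1"
  shows "f x = (\<Sum>i\<in>indN (Suc n). of_fun f (E i) * E i x)"
proof -
  obtain H where H: "\<And>i. H i \<in> spherical_harmonics i" "\<And>x. norm x = 1 \<Longrightarrow> f x = (\<Sum>i\<le>n. H i x)"
    using f unfolding harmonic_sum_def by metis
  have "\<forall>l. \<exists>c. \<forall>x\<in>sphere 0 1. H l x = (\<Sum>k=1..Z l. c k * Y l k x)"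
    using basis H(1) unfolding harmonic_basis_def by blast
  then obtain c where c: "\<And>l x. norm x = 1 \<Longrightarrow> H l x = (\<Sum>k=1..Z l. c l k * Y l k x)"
    unfolding choice_iff by auto
  define a where "a i = c (fst i) (snd i)" for i
  have fx: "f x = (\<Sum>i\<in>indN (Suc n). a i * E i x)" if "norm x = 1" for x
    using that by (simp add: sum_indN H(2) c a_def E_def lessThan_Suc_atMost)
  have "of_fun f (E j) = a j" if "j \<in> indN (Suc n)" for j
  proof -
    have "of_fun f (E j) = of_fun (\<lambda>x. \<Sum>i\<in>indN (Suc n). a i * E i x) (E j)"
      by (rule of_fun_cong) (simp add: fx)
    then show ?thesis using that indN_subset by (subst (asm) of_fun_lincomb_E) auto
  qed
  then show ?thesis using fx[OF x] by simp
qed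

lemma sphere_poly_expansion:
  assumes "sphere_poly n f" "n < N" "norm x = 1"
  shows "f x = (\<Sum>i\<in>indN N. of_fun f (E i) * E i x)"
proof -
  have "harmonic_sum (N - 1) f"
    by (rule sphere_poly_harmonic_sum[OF sphere_poly_mono[OF assms(1)]]) (use assms(2) in simp)
  then show ?thesis using harmonic_sum_expansion[of "N - 1" f x] assms by simp
qed

text \<open>The finite expansion of \<open>f\<close> stops before the degree of \<open>E j\<close>.
  This truncates the coefficients of products.\<close>

lemma of_fun_sphere_poly_eq_0:
  assumes "sphere_poly n f" "j \<in> ind" "n < fst j" shows "of_fun f (E j) = 0"
proof -
  have "of_fun f (E j) = of_fun (\<lambda>x. \<Sum>i\<in>indN (Suc n). of_fun f (E i) * E i x) (E j)"
    by (rule of_fun_cong) (simp add: sphere_poly_expansion[OF assms(1), symmetric])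
  also have "\<dots> = 0" using assms indN_subset by (subst of_fun_lincomb_E) (auto simp: indN_iff)
  finally show ?thesis .
qed

section \<open>Dimension count and the diagonal of the reproducing kernel\<close>

lemma card_indN_le: "real (card (indN N)) \<le> 2 * real N ^ d"
proof (cases N)
  case 0
  then show ?thesis by (simp add: indN_def)
next
  case (Suc n)
  have "card (indN N) \<le> 2 * (n + 1) ^ (DIM(real^'n) - 1)"
    using indN_subset Suc
    by (intro card_orthonormal_sphere_poly[where e=E])
       (auto intro!: sphere_poly_mono[OF sphere_poly_E] simp: E_orthonormal indN_iff)
  then have "real (card (indN N)) \<le> real (2 * (n + 1) ^ (DIM(real^'n) - 1))" by (rule of_nat_mono)
  then show ?thesis using dim Suc by simp
qed

text \<open>The space of spherical polynomials of bounded degree is invariant under orthogonal maps, so the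
  diagonal of its reproducing kernel is constant.\<close>

lemma kernel_diagonal_le:
  assumes "norm x = 1" "norm y = 1"
  shows "(\<Sum>i\<in>indN N. (E i x)\<^sup>2) \<le> (\<Sum>i\<in>indN N. (E i y)\<^sup>2)"
proof (cases N)
  case 0
  then show ?thesis by (simp add: indN_def)
next
  case (Suc n)
  obtain T where T: "orthogonal_transformation T" "T y = x"
    using orthogonal_transformation_exists[of y x] assms by auto
  define g where "g z = (\<Sum>i\<in>indN N. E i x * E i z)" for z
  have gpoly: "sphere_poly n g"
    unfolding g_def using Suc
    by (intro sphere_poly_sum sphere_poly_scale sphere_poly_mono[OF sphere_poly_E]) (auto simp: indN_iff)
  define K where "K z = (\<Sum>i\<in>indN N. (E i z)\<^sup>2)" for z
  \<comment> \<open>By the choice of \<open>T\<close>, \<open>h y = g x = K x\<close>, while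
    \<open>h\<close> has the same squared norm as \<open>g\<close>, namely \<open>K x\<close>.
    Cauchy-Schwarz for the expansion of \<open>h\<close> at \<open>y\<close> then gives
    \<open>(K x)\<^sup>2 \<le> K x * K y\<close>.\<close>
  define h where "h z = g (T z)" for z
  have hpoly: "sphere_poly n h" unfolding h_def by (rule sphere_poly_compose_orthogonal[OF T(1) gpoly])
  define c where "c i = of_fun h (E i)" for i
  have "K x = h y" by (simp add: K_def h_def T g_def power2_eq_square)
  also have "\<dots> = (\<Sum>i\<in>indN N. c i * E i y)"
    unfolding c_def using hpoly Suc assms by (intro sphere_poly_expansion) auto
  finally have Kx: "K x = (\<Sum>i\<in>indN N. c i * E i y)" .
  have "(K x)\<^sup>2 \<le> (\<Sum>i\<in>indN N. (c i)\<^sup>2) * K y"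
    unfolding Kx unfolding K_def by (rule Cauchy_Schwarz_ineq_sum)
  also have "(\<Sum>i\<in>indN N. (c i)\<^sup>2) \<le> (\<integral>z. (h z)\<^sup>2 \<partial>sphere_measure)"
    unfolding c_def using indN_subset by (intro bessel sphere_poly_continuous[OF hpoly]) auto
  also have "(\<integral>z. (h z)\<^sup>2 \<partial>sphere_measure) = (\<integral>z. (g z)\<^sup>2 \<partial>sphere_measure)"
    unfolding h_def using sphere_poly_continuous[OF gpoly]
    by (intro integral_sphere_orthogonal[OF T(1), of "\<lambda>z. (g z)\<^sup>2"] continuous_intros)
  also have "\<dots> = K x" unfolding g_def K_def using indN_subset by (intro integral_square_lincomb) auto
  finally have "(K x)\<^sup>2 \<le> K x * K y" by (simp add: mult_right_mono K_def sum_nonneg)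
  moreover have "K x \<ge> 0" "K y \<ge> 0" by (auto simp: K_def intro: sum_nonneg)
  ultimately have "K x \<le> K y" by (cases "K x = 0") (auto simp: power2_eq_square)
  then show ?thesis by (simp add: K_def)
qed

text \<open>The diagonal is constant and the measure has mass one, so its value is its integral,
  which orthonormality evaluates.\<close>

lemma kernel_diagonal:
  assumes "norm x = 1" shows "(\<Sum>i\<in>indN N. (E i x)\<^sup>2) = real (card (indN N))"
proof -
  define K where "K z = (\<Sum>i\<in>indN N. (E i z)\<^sup>2)" for z
  have "real (card (indN N)) = (\<Sum>i\<in>indN N. (\<integral>z. E i z * E i z \<partial>sphere_measure))"
    by (simp add: E_orthonormal indN_iff)
  also have "\<dots> = (\<integral>z. K z \<partial>sphere_measure)"
    unfolding K_def power2_eq_square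
    by (subst Bochner_Integration.integral_sum)
       (auto intro!: integrable_sphere continuous_intros continuous_E simp: indN_iff)
  also have "\<dots> = (\<integral>z. K x \<partial>(sphere_measure :: (real^'n) measure))"
    by (rule integral_sphere_cong) (auto simp: K_def intro!: antisym kernel_diagonal_le assms)
  finally show ?thesis by (simp only: integral_sphere_const K_def)
qed

text \<open>Invariance was obtained for all degrees below a bound together; a single degree is the
  difference of two consecutive kernels.\<close>

lemma addition_formula:
  assumes "norm x = 1" shows "(\<Sum>k=1..Z l. (Y l k x)\<^sup>2) = real (Z l)"
proof -
  have "(\<Sum>i\<in>indN (Suc l). (E i x)\<^sup>2) - (\<Sum>i\<in>indN l. (E i x)\<^sup>2) = (\<Sum>k=1..Z l. (Y l k x)\<^sup>2)"
    by (simp add: sum_indN E_def)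
  moreover have "card (indN N) = (\<Sum>l<N. Z l)" for N by (simp add: indN_def)
  ultimately show ?thesis by (simp add: kernel_diagonal[OF assms])
qed

lemma summable_dimension:
  assumes t: "t > real d / 2" shows "summable (\<lambda>l. (1 + eigval d l) powr (- t) * real (Z l))"
proof -
  have t0: "t > 0" using t by (simp add: order.strict_trans1[rotated])
  \<comment> \<open>A comparison weight that decreases from \<open>l = 0\<close> on;
    \<open>(l + 1)\<^sup>2 \<le> 2 * (1 + l\<^sup>2)\<close> costs the factor
    \<open>2 powr t\<close>.\<close>
  define a where "a l = real (Suc l) powr (- 2 * t)" for l
  have a_dec: "decseq a" unfolding a_def decseq_Suc_iff
    using t0 by (intro allI powr_mono2') auto
  have a_nn: "a l \<ge> 0" for l by (simp add: a_def)
  have le: "(1 + eigval d l) powr (- t) \<le> 2 powr t * a l" for l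
  proof -
    have "(real (Suc l))\<^sup>2 / 2 \<le> 1 + (real l)\<^sup>2"
      using sum_squares_bound[of "real l" 1] by (simp add: power2_eq_square algebra_simps)
    also have "\<dots> \<le> 1 + eigval d l" using eigval_ge_square[OF dim(2)] by simp
    finally have "(1 + eigval d l) powr (- t) \<le> ((real (Suc l))\<^sup>2 / 2) powr (- t)"
      using t0 by (intro powr_mono2') auto
    also have "\<dots> = ((real (Suc l))\<^sup>2) powr (- t) / 2 powr (- t)" by (rule powr_divide)
    also have "((real (Suc l))\<^sup>2) powr (- t) = a l"
      by (simp add: a_def powr_powr flip: powr_numeral)
    finally show ?thesis by (simp add: powr_minus field_simps)
  qed
  \<comment> \<open>Only the count \<open>D\<close> of all degrees below \<open>N\<close> is
    bounded. The dimensions are its increments, while the increments of \<open>B\<close> have order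
    \<open>l ^ (d - 1)\<close>.\<close>
  define D B where "D N = real (card (indN N))" and "B N = 2 * real N ^ d" for N
  have Z: "real (Z l) = D (Suc l) - D l" for l by (simp add: D_def indN_def)
  have Bd: "B (Suc l) - B l \<le> 2 * real d * real (Suc l) powr (real d - 1)" for l
  proof -
    have "real (Suc l) ^ d - real l ^ d \<le> real d * real (Suc l) ^ (d - 1)"
    proof -
      have "real (Suc l) ^ d - real l ^ d = (\<Sum>i<d. real l ^ (d - Suc i) * real (Suc l) ^ i)"
        by (subst power_diff_sumr2) simp
      also have "\<dots> \<le> (\<Sum>i<d. real (Suc l) ^ (d - 1))"
      proof (rule sum_mono)
        fix i assume "i \<in> {..<d}"
        then have "d - 1 = (d - Suc i) + i" by auto
        then have "real (Suc l) ^ (d - 1) = real (Suc l) ^ (d - Suc i) * real (Suc l) ^ i"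
          by (metis power_add)
        then show "real l ^ (d - Suc i) * real (Suc l) ^ i \<le> real (Suc l) ^ (d - 1)"
          by (simp add: mult_right_mono power_mono)
      qed
      finally show ?thesis by simp
    qed
    moreover have "real (Suc l) powr (real d - 1) = real (Suc l) ^ (d - 1)"
      using dim(2) powr_realpow[of "real (Suc l)" "d - 1"] by (simp add: of_nat_diff)
    ultimately show ?thesis by (simp add: B_def)
  qed
  \<comment> \<open>The condition \<open>t > d / 2\<close> says exactly that this exponent is below
    -1.\<close>
  have "summable (\<lambda>l. real (Suc l) powr (real d - 1 - 2 * t))"
    using summable_real_powr_iff[of "real d - 1 - 2 * t"] t
    by (subst summable_Suc_iff[where f="\<lambda>l. real l powr (real d - 1 - 2 * t)"]) simp
  then have sumB: "summable (\<lambda>l. 2 * real d * real (Suc l) powr (real d - 1 - 2 * t))"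
    by (rule summable_mult)
  have "summable (\<lambda>l. a l * real (Z l))"
  proof (rule summableI_nonneg_bounded)
    fix N
    have "(\<Sum>l<N. a l * real (Z l)) \<le> (\<Sum>l<N. a l * (B (Suc l) - B l))"
      unfolding Z using card_indN_le dim(2)
      by (intro abel_summation_mono a_dec a_nn) (auto simp: D_def B_def indN_def)
    also have "\<dots> \<le> (\<Sum>l<N. 2 * real d * real (Suc l) powr (real d - 1 - 2 * t))"
    proof (rule sum_mono)
      fix l
      have "a l * (B (Suc l) - B l) \<le> a l * (2 * real d * real (Suc l) powr (real d - 1))"
        by (intro mult_left_mono Bd a_nn)
      also have "\<dots> = 2 * real d * real (Suc l) powr (real d - 1 - 2 * t)"
      proof -
        have "a l * real (Suc l) powr (real d - 1) = real (Suc l) powr (real d - 1 - 2 * t)"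
          unfolding a_def powr_add[symmetric] by (rule arg_cong[where f="\<lambda>e. _ powr e"]) simp
        then show ?thesis by (simp only: mult.left_commute[of "a l"])
      qed
      finally show "a l * (B (Suc l) - B l) \<le> 2 * real d * real (Suc l) powr (real d - 1 - 2 * t)" .
    qed
    also have "\<dots> \<le> (\<Sum>l. 2 * real d * real (Suc l) powr (real d - 1 - 2 * t))"
      by (rule sum_le_suminf[OF sumB]) auto
    finally show "(\<Sum>l<N. a l * real (Z l)) \<le> (\<Sum>l. 2 * real d * real (Suc l) powr (real d - 1 - 2 * t))" .
  qed (simp add: a_nn)
  then have "summable (\<lambda>l. 2 powr t * (a l * real (Z l)))" by (rule summable_mult)
  then show ?thesis
  proof (rule summable_comparison_test')
    fix l :: nat
    have "(1 + eigval d l) powr (- t) * real (Z l) \<le> (2 powr t * a l) * real (Z l)"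
      by (intro mult_right_mono le) simp
    then show "norm ((1 + eigval d l) powr (- t) * real (Z l)) \<le> 2 powr t * (a l * real (Z l))"
      by (simp add: mult.assoc)
  qed
qed

text \<open>Completeness by Stone-Weierstrass: \<open>f\<close> is orthogonal to every polynomial
  \<open>p\<close>, so the integral of its square is that of \<open>(f - p) * f\<close>, and
  \<open>p\<close> may be taken uniformly close to \<open>f\<close>.\<close>

lemma continuous_orthogonal_eq_0:
  assumes f: "continuous_on (sphere 0 1) f" and 0: "\<And>i. i \<in> ind \<Longrightarrow> of_fun f (E i) = 0" and y: "norm y = 1"
  shows "f y = 0"
proof (rule integral_square_eq_0_sphere[OF f _ y])
  obtain B where B: "0 \<le> B" "\<And>x. norm x = 1 \<Longrightarrow> \<bar>f x\<bar> \<le> B" using continuous_sphere_bounded[OF f] by blast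
  have "(\<integral>x. (f x)\<^sup>2 \<partial>sphere_measure) \<le> e * B" if e: "e > 0" for e
  proof -
    obtain p where p: "real_polynomial_function p" "\<And>x. x \<in> sphere 0 1 \<Longrightarrow> \<bar>f x - p x\<bar> < e"
      using Stone_Weierstrass_real_polynomial_function[OF compact_sphere f e] by blast
    obtain n where "polydeg n p" using real_polynomial_function_polydeg[OF p(1)] by blast
    then have sp: "sphere_poly n p" unfolding sphere_poly_def by blast
    have cp: "continuous_on (sphere 0 1) p" using p(1) by (rule real_polynomial_function_continuous)
    have "of_fun p f = of_fun (\<lambda>x. \<Sum>i\<in>indN (Suc n). of_fun p (E i) * E i x) f"
      by (rule of_fun_cong) (simp add: sphere_poly_expansion[OF sp, symmetric])
    also have "\<dots> = (\<Sum>i\<in>indN (Suc n). of_fun p (E i) * of_fun (E i) f)"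
      by (intro of_fun_sum continuous_E f) (auto simp: indN_iff)
    also have "\<dots> = 0" by (simp add: of_fun_commute[of "E _" f] 0 indN_iff)
    finally have pf: "(\<integral>x. p x * f x \<partial>sphere_measure) = 0" by (simp add: of_fun_def)
    have "(\<integral>x. (f x)\<^sup>2 \<partial>sphere_measure) = (\<integral>x. (f x - p x) * f x \<partial>sphere_measure) + (\<integral>x. p x * f x \<partial>sphere_measure)"
      by (subst Bochner_Integration.integral_add[symmetric])
         (auto intro!: integrable_sphere continuous_intros f cp simp: power2_eq_square algebra_simps)
    also have "(\<integral>x. (f x - p x) * f x \<partial>sphere_measure) \<le> (\<integral>x. e * B \<partial>(sphere_measure :: (real^'n) measure))"
    proof (rule integral_sphere_mono)
      fix x :: "real^'n" assume x: "norm x = 1"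
      have "(f x - p x) * f x \<le> \<bar>f x - p x\<bar> * \<bar>f x\<bar>" by (metis abs_ge_self abs_mult)
      also have "\<dots> \<le> e * B" using x p(2)[of x] B by (intro mult_mono) auto
      finally show "(f x - p x) * f x \<le> e * B" .
    qed (intro continuous_intros f cp)+
    finally show ?thesis by (simp only: pf integral_sphere_const add_0_right)
  qed
  note le = this
  have "(\<integral>x. (f x)\<^sup>2 \<partial>sphere_measure) \<le> 0 + e" if "e > 0" for e
  proof -
    have "e / (B + 1) * B \<le> e" using B(1) that by (simp add: field_simps)
    then show ?thesis using le[of "e / (B + 1)"] B(1) that by simp
  qed
  then have "(\<integral>x. (f x)\<^sup>2 \<partial>sphere_measure) \<le> 0" by (rule field_le_epsilon)
  then show "(\<integral>x. (f x)\<^sup>2 \<partial>sphere_measure) = 0" by (simp add: antisym)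
qed

end

section \<open>Multiplication in negative Sobolev spaces\<close>

text \<open>Abstractly, a finite signed measure on the sphere. The predicate
  \<open>distribution\<close> controls test functions only, whereas products with a merely
  continuous factor have to be paired here.\<close>

definition sup_bounded :: "'a::euclidean_space functional \<Rightarrow> bool" where
  "sup_bounded \<nu> \<longleftrightarrow>
     (\<forall>f g. continuous_on (sphere 0 1) f \<longrightarrow> continuous_on (sphere 0 1) g \<longrightarrow> \<nu> (\<lambda>x. f x + g x) = \<nu> f + \<nu> g) \<and>
     (\<forall>c f. continuous_on (sphere 0 1) f \<longrightarrow> \<nu> (\<lambda>x. c * f x) = c * \<nu> f) \<and>
     (\<exists>K\<ge>0. \<forall>f B. continuous_on (sphere 0 1) f \<longrightarrow> (\<forall>x. norm x = 1 \<longrightarrow> \<bar>f x\<bar> \<le> B) \<longrightarrow> \<bar>\<nu> f\<bar> \<le> K * B)"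

context
  fixes \<nu> :: "'a::euclidean_space functional"
  assumes \<nu>: "sup_bounded \<nu>"
begin

lemma sup_bounded_add:
  "continuous_on (sphere 0 1) f \<Longrightarrow> continuous_on (sphere 0 1) g \<Longrightarrow> \<nu> (\<lambda>x. f x + g x) = \<nu> f + \<nu> g"
  using \<nu> unfolding sup_bounded_def by blast

lemma sup_bounded_scale: "continuous_on (sphere 0 1) f \<Longrightarrow> \<nu> (\<lambda>x. c * f x) = c * \<nu> f"
  using \<nu> unfolding sup_bounded_def by blast

lemma sup_bounded_bound:
  obtains K where "K \<ge> 0" "\<And>f B. continuous_on (sphere 0 1) f \<Longrightarrow> (\<And>x. norm x = 1 \<Longrightarrow> \<bar>f x\<bar> \<le> B) \<Longrightarrow> \<bar>\<nu> f\<bar> \<le> K * B"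
  using \<nu> unfolding sup_bounded_def by blast

lemma sup_bounded_diff:
  "continuous_on (sphere 0 1) f \<Longrightarrow> continuous_on (sphere 0 1) g \<Longrightarrow> \<nu> (\<lambda>x. f x - g x) = \<nu> f - \<nu> g"
  using sup_bounded_add[of f "\<lambda>x. (-1) * g x"] sup_bounded_scale[of g "-1"]
  by (simp add: continuous_on_minus)

text \<open>The bound applied with \<open>B = 0\<close> to the difference makes values off the
  sphere irrelevant.\<close>

lemma sup_bounded_cong:
  assumes "continuous_on (sphere 0 1) f" "continuous_on (sphere 0 1) g" "\<And>x. norm x = 1 \<Longrightarrow> f x = g x"
  shows "\<nu> f = \<nu> g"
proof -
  obtain K where K: "\<And>f B. continuous_on (sphere 0 1) f \<Longrightarrow> (\<And>x. norm x = 1 \<Longrightarrow> \<bar>f x\<bar> \<le> B) \<Longrightarrow> \<bar>\<nu> f\<bar> \<le> K * B"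
    using sup_bounded_bound by blast
  have "\<bar>\<nu> (\<lambda>x. f x - g x)\<bar> \<le> K * 0"
    by (rule K) (auto intro!: continuous_intros assms(1,2) simp: assms(3))
  then show ?thesis by (simp add: sup_bounded_diff assms(1,2))
qed

lemma sup_bounded_sum:
  "(\<And>i. i \<in> A \<Longrightarrow> continuous_on (sphere 0 1) (f i)) \<Longrightarrow> \<nu> (\<lambda>x. \<Sum>i\<in>A. a i * f i x) = (\<Sum>i\<in>A. a i * \<nu> (f i))"
proof (induction A rule: infinite_finite_induct)
  case (insert j A)
  have "\<nu> (\<lambda>x. a j * f j x + (\<Sum>i\<in>A. a i * f i x)) = \<nu> (\<lambda>x. a j * f j x) + \<nu> (\<lambda>x. \<Sum>i\<in>A. a i * f i x)"
    by (intro sup_bounded_add continuous_intros) (auto intro: insert.prems)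
  then show ?case using insert by (simp add: sup_bounded_scale)
qed (use sup_bounded_scale[of "\<lambda>_. 0" 0] in auto)

end

text \<open>Summation by parts in layer form: \<open>W (h i)\<close> is the sum of the increments of
  \<open>W\<close> up to \<open>h i\<close>, and exchanging the sums collects the tails of
  \<open>b\<close>.\<close>

lemma sum_weight_tails:
  fixes W :: "nat \<Rightarrow> real" and b :: "'i \<Rightarrow> real"
  assumes "finite A" "\<And>i. i \<in> A \<Longrightarrow> h i \<le> K"
  shows "(\<Sum>i\<in>A. W (h i) * b i)
           = (\<Sum>k\<le>K. (if k = 0 then W 0 else W k - W (k - 1)) * (\<Sum>i | i \<in> A \<and> k \<le> h i. b i))"
proof -
  define \<delta> where "\<delta> k = (if k = 0 then W 0 else W k - W (k - 1))" for k
  have W: "W n = (\<Sum>k\<le>n. \<delta> k)" for n by (induction n) (auto simp: \<delta>_def)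
  have "(\<Sum>i\<in>A. W (h i) * b i) = (\<Sum>i\<in>A. \<Sum>k\<le>K. if k \<le> h i then \<delta> k * b i else 0)"
  proof (rule sum.cong)
    fix i assume i: "i \<in> A"
    have "W (h i) * b i = (\<Sum>k\<le>h i. \<delta> k * b i)" by (simp add: W sum_distrib_right)
    also have "\<dots> = (\<Sum>k\<le>K. if k \<le> h i then \<delta> k * b i else 0)"
      using assms(2)[OF i] by (intro sum.mono_neutral_cong_left) auto
    finally show "W (h i) * b i = (\<Sum>k\<le>K. if k \<le> h i then \<delta> k * b i else 0)" .
  qed simp
  also have "\<dots> = (\<Sum>k\<le>K. \<Sum>i\<in>A. if k \<le> h i then \<delta> k * b i else 0)" by (rule sum.swap)
  also have "\<dots> = (\<Sum>k\<le>K. \<delta> k * (\<Sum>i | i \<in> A \<and> k \<le> h i. b i))"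
    by (simp add: sum.inter_filter[OF assms(1), symmetric] sum_distrib_left)
  finally show ?thesis by (simp add: \<delta>_def)
qed

context harmonic_system
begin

section \<open>Weights and partial sums of Sobolev norms\<close>

definition wt :: "real \<Rightarrow> nat \<Rightarrow> real" where "wt s l = (1 + eigval d l) powr s"

lemma wt_pos [simp]: "wt s l > 0"
  using eigval_nonneg[OF dim(2), of l] by (simp add: wt_def)

lemma wt_add: "wt (s + t) l = wt s l * wt t l" by (simp add: wt_def powr_add)

lemma wt_half: "(wt (s / 2) l)\<^sup>2 = wt s l"
  by (simp add: power2_eq_square flip: wt_add)

lemma wt_inverse: "wt s l * wt (- s) l = 1"
  using eigval_nonneg[OF dim(2), of l] by (simp add: wt_def flip: powr_add)

lemma wt_ge_1: "s \<ge> 0 \<Longrightarrow> wt s l \<ge> 1"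
  using eigval_nonneg[OF dim(2), of l] by (simp add: wt_def ge_one_powr_ge_zero)

lemma wt_mono: "s \<ge> 0 \<Longrightarrow> l \<le> m \<Longrightarrow> wt s l \<le> wt s m"
  using eigval_nonneg[OF dim(2), of l] eigval_mono[OF dim(2), of l m] by (simp add: wt_def powr_mono2)

lemma wt_add_degree:
  assumes "s \<ge> 0" shows "wt s (i + l) \<le> 3 powr s * (wt s i * wt s l)"
proof -
  have "wt s (i + l) \<le> (3 * ((1 + eigval d i) * (1 + eigval d l))) powr s"
    unfolding wt_def using eigval_nonneg[OF dim(2)] assms
    by (intro powr_mono2 eigval_add_le dim) (simp_all add: add_nonneg_nonneg)
  also have "\<dots> = 3 powr s * (wt s i * wt s l)"
    using eigval_nonneg[OF dim(2), of i] eigval_nonneg[OF dim(2), of l] by (simp add: wt_def powr_mult)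
  finally show ?thesis .
qed

lemma sobolev_term_nonneg: "sobolev_term d Z Y s u l \<ge> 0"
  by (simp add: sobolev_term_def sum_nonneg)

lemma sum_sobolev_term: "(\<Sum>l<N. sobolev_term d Z Y s u l) = (\<Sum>i\<in>indN N. wt s (fst i) * (u (E i))\<^sup>2)"
  by (simp add: sum_indN sobolev_term_def wt_def E_def sum_distrib_left)

lemma sum_le_sobolev_norm:
  assumes "summable (sobolev_term d Z Y s u)"
  shows "(\<Sum>i\<in>indN N. wt s (fst i) * (u (E i))\<^sup>2) \<le> (sobolev_norm d Z Y s u)\<^sup>2"
proof -
  have "(\<Sum>l<N. sobolev_term d Z Y s u l) \<le> (\<Sum>l. sobolev_term d Z Y s u l)"
    by (rule sum_le_suminf[OF assms]) (auto simp: sobolev_term_nonneg)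
  then show ?thesis
    by (simp add: sum_sobolev_term sobolev_norm_def suminf_nonneg[OF assms] sobolev_term_nonneg)
qed

lemma sobolev_norm_nonneg:
  "summable (sobolev_term d Z Y s u) \<Longrightarrow> sobolev_norm d Z Y s u \<ge> 0"
  by (simp add: sobolev_norm_def suminf_nonneg sobolev_term_nonneg)

text \<open>Bounds on partial sums give convergence as well; without it the infinite sum is an
  unspecified number and a bound on the norm carries no information.\<close>

lemma sobolev_norm_leI:
  assumes "\<And>N. (\<Sum>i\<in>indN N. wt s (fst i) * (u (E i))\<^sup>2) \<le> C\<^sup>2" "C \<ge> 0"
  shows "summable (sobolev_term d Z Y s u)" "sobolev_norm d Z Y s u \<le> C"
proof -
  show s: "summable (sobolev_term d Z Y s u)"
    by (rule summableI_nonneg_bounded[of _ "C\<^sup>2"]) (simp_all add: sobolev_term_nonneg sum_sobolev_term assms(1))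
  have "(\<Sum>l. sobolev_term d Z Y s u l) \<le> C\<^sup>2"
    by (rule suminf_le_const[OF s]) (simp add: sum_sobolev_term assms(1))
  then show "sobolev_norm d Z Y s u \<le> C"
    unfolding sobolev_norm_def using assms(2) by (simp add: real_le_lsqrt)
qed

text \<open>The coefficients of \<open>p g\<close> of degree at least \<open>k\<close> only see the part of \<open>g\<close> of degree at least
  \<open>k - l\<close>. Bessel's inequality compares the tails, and summation by parts restores the weights.\<close>

lemma product_weighted_coefficients:
  assumes p: "sphere_poly l p" and B: "\<And>x. norm x = 1 \<Longrightarrow> \<bar>p x\<bar> \<le> B" and r: "r \<ge> 0"
  shows "(\<Sum>j\<in>indN M. wt r (fst j) * (of_fun (\<lambda>x. p x * (\<Sum>i\<in>indN N. a i * E i x)) (E j))\<^sup>2)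
           \<le> B\<^sup>2 * (\<Sum>i\<in>indN N. wt r (fst i + l) * (a i)\<^sup>2)"
proof -
  define b where "b j = of_fun (\<lambda>x. p x * (\<Sum>i\<in>indN N. a i * E i x)) (E j)" for j
  have cp: "continuous_on (sphere 0 1) p" using p by (rule sphere_poly_continuous)
  have b_tail: "b j = of_fun (\<lambda>x. p x * (\<Sum>i | i \<in> indN N \<and> k \<le> fst i + l. a i * E i x)) (E j)"
    if j: "j \<in> ind" "k \<le> fst j" for j k
  proof -
    define c where "c i = of_fun (\<lambda>x. p x * E i x) (E j)" for i
    have lin: "of_fun (\<lambda>x. p x * (\<Sum>i\<in>A. a i * E i x)) (E j) = (\<Sum>i\<in>A. a i * c i)" if "A \<subseteq> ind" for A
    proof -
      have "(\<lambda>x. p x * (\<Sum>i\<in>A. a i * E i x)) = (\<lambda>x. \<Sum>i\<in>A. a i * (p x * E i x))"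
        by (simp add: sum_distrib_left mult_ac)
      then show ?thesis unfolding c_def using that j
        by (simp only:) (intro of_fun_sum continuous_intros cp continuous_E; auto)
    qed
    have "c i = 0" if "i \<in> indN N" "\<not> k \<le> fst i + l" for i
      unfolding c_def using that j sphere_poly_mult[OF p sphere_poly_E[of i]]
      by (intro of_fun_sphere_poly_eq_0[of "l + fst i"]) (auto simp: indN_iff)
    then have "(\<Sum>i\<in>indN N. a i * c i) = (\<Sum>i | i \<in> indN N \<and> k \<le> fst i + l. a i * c i)"
      by (intro sum.mono_neutral_right) auto
    moreover have "{i. i \<in> indN N \<and> k \<le> fst i + l} \<subseteq> ind" using indN_subset by auto
    ultimately show ?thesis unfolding b_def using indN_subset by (simp add: lin)
  qed
  have tail: "(\<Sum>j | j \<in> indN M \<and> k \<le> fst j. (b j)\<^sup>2) \<le> B\<^sup>2 * (\<Sum>i | i \<in> indN N \<and> k \<le> fst i + l. (a i)\<^sup>2)" for k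
  proof -
    define A where "A = {i. i \<in> indN N \<and> k \<le> fst i + l}"
    define g where "g x = (\<Sum>i\<in>A. a i * E i x)" for x
    have A: "finite A" "A \<subseteq> ind" using indN_subset by (auto simp: A_def)
    have cg: "continuous_on (sphere 0 1) g" unfolding g_def by (rule continuous_lincomb[OF A(2)])
    have "(\<Sum>j | j \<in> indN M \<and> k \<le> fst j. (b j)\<^sup>2)
        = (\<Sum>j | j \<in> indN M \<and> k \<le> fst j. (of_fun (\<lambda>x. p x * g x) (E j))\<^sup>2)"
      unfolding g_def A_def by (intro sum.cong refl arg_cong[where f="\<lambda>y. y\<^sup>2"] b_tail) (auto simp: indN_iff)
    also have "\<dots> \<le> (\<integral>x. (p x * g x)\<^sup>2 \<partial>sphere_measure)"
      using indN_subset by (intro bessel continuous_intros cp cg) auto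
    also have "\<dots> \<le> (\<integral>x. B\<^sup>2 * (g x)\<^sup>2 \<partial>sphere_measure)"
    proof (rule integral_sphere_mono)
      fix x :: "real^'n" assume "norm x = 1"
      then have "(p x)\<^sup>2 \<le> B\<^sup>2" using B by (metis abs_ge_zero power2_abs power_mono)
      then show "(p x * g x)\<^sup>2 \<le> B\<^sup>2 * (g x)\<^sup>2" by (simp add: power_mult_distrib mult_right_mono)
    qed (intro continuous_intros cp cg)+
    also have "\<dots> = B\<^sup>2 * (\<Sum>i\<in>A. (a i)\<^sup>2)"
      using integral_square_lincomb[OF A, of a] by (simp add: g_def)
    finally show ?thesis by (simp add: A_def)
  qed
  \<comment> \<open>One cut-off serves both applications of the layer formula, as
    \<open>fst j < M\<close> and \<open>fst i + l < N + l\<close>. The increments of the weight are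
    nonnegative because \<open>r \<ge> 0\<close>, so the tail estimate may be inserted layer by
    layer.\<close>
  have "(\<Sum>j\<in>indN M. wt r (fst j) * (b j)\<^sup>2)
      = (\<Sum>k\<le>M + N + l. (if k = 0 then wt r 0 else wt r k - wt r (k - 1)) * (\<Sum>j | j \<in> indN M \<and> k \<le> fst j. (b j)\<^sup>2))"
    by (rule sum_weight_tails) (auto simp: indN_iff)
  also have "\<dots> \<le> (\<Sum>k\<le>M + N + l. (if k = 0 then wt r 0 else wt r k - wt r (k - 1))
                     * (B\<^sup>2 * (\<Sum>i | i \<in> indN N \<and> k \<le> fst i + l. (a i)\<^sup>2)))"
    by (intro sum_mono mult_left_mono tail) (auto intro!: wt_mono r less_imp_le[OF wt_pos])
  also have "\<dots> = B\<^sup>2 * (\<Sum>k\<le>M + N + l. (if k = 0 then wt r 0 else wt r k - wt r (k - 1))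
                     * (\<Sum>i | i \<in> indN N \<and> k \<le> fst i + l. (a i)\<^sup>2))"
    by (simp only: sum_distrib_left mult.left_commute)
  also have "(\<Sum>k\<le>M + N + l. (if k = 0 then wt r 0 else wt r k - wt r (k - 1))
                     * (\<Sum>i | i \<in> indN N \<and> k \<le> fst i + l. (a i)\<^sup>2))
      = (\<Sum>i\<in>indN N. wt r (fst i + l) * (a i)\<^sup>2)"
    by (rule sum_weight_tails[symmetric]) (auto simp: indN_iff)
  finally show ?thesis by (simp add: b_def)
qed

text \<open>Duality of the orders \<open>r\<close> and \<open>- r\<close> on the finitely many
  coefficients of the product. The factor \<open>3 powr (r / 2) * wt (r / 2) l\<close> is the price
  of raising degrees by at most \<open>l\<close>.\<close>

lemma pairing_product_bound:
  assumes \<nu>: "sup_bounded \<nu>" "summable (sobolev_term d Z Y (- r) \<nu>)"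
    and p: "sphere_poly l p" and B: "B \<ge> 0" "\<And>x. norm x = 1 \<Longrightarrow> \<bar>p x\<bar> \<le> B" and r: "r \<ge> 0"
  shows "\<bar>\<nu> (\<lambda>x. p x * (\<Sum>i\<in>indN N. a i * E i x))\<bar>
           \<le> (B * (3 powr (r / 2) * wt (r / 2) l)) * sobolev_norm d Z Y (- r) \<nu>
               * sqrt (\<Sum>i\<in>indN N. wt r (fst i) * (a i)\<^sup>2)"
proof -
  define g where "g x = (\<Sum>i\<in>indN N. a i * E i x)" for x
  define S where "S = (\<Sum>i\<in>indN N. wt r (fst i) * (a i)\<^sup>2)"
  \<comment> \<open>The product \<open>p g\<close> has degree at most \<open>l + N\<close>, so
    \<open>indN M\<close> carries all of its coefficients.\<close>
  define M where "M = Suc (l + N)"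
  define b where "b j = of_fun (\<lambda>x. p x * g x) (E j)" for j
  have gpoly: "sphere_poly N g" unfolding g_def
    by (intro sphere_poly_sum sphere_poly_scale sphere_poly_mono[OF sphere_poly_E]) (auto simp: indN_iff)
  note pg = sphere_poly_mult[OF p gpoly]
  have S0: "S \<ge> 0" unfolding S_def by (intro sum_nonneg mult_nonneg_nonneg less_imp_le[OF wt_pos]) auto
  have "\<nu> (\<lambda>x. p x * g x) = \<nu> (\<lambda>x. \<Sum>j\<in>indN M. b j * E j x)"
    unfolding b_def M_def using indN_subset
    by (intro sup_bounded_cong[OF \<nu>(1)] sphere_poly_continuous[OF pg] continuous_lincomb sphere_poly_expansion[OF pg]) auto
  also have "\<dots> = (\<Sum>j\<in>indN M. b j * \<nu> (E j))"
    by (intro sup_bounded_sum[OF \<nu>(1)] continuous_E) (auto simp: indN_iff)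
  also have "\<dots> = (\<Sum>j\<in>indN M. (wt (r / 2) (fst j) * b j) * (wt (- r / 2) (fst j) * \<nu> (E j)))"
  proof (rule sum.cong)
    fix j :: "nat \<times> nat"
    have "wt (r / 2) (fst j) * wt (- r / 2) (fst j) = 1" using wt_inverse[of "r / 2"] by simp
    then show "b j * \<nu> (E j) = (wt (r / 2) (fst j) * b j) * (wt (- r / 2) (fst j) * \<nu> (E j))"
      by (metis mult.commute mult.left_commute mult_1)
  qed simp
  finally have "(\<nu> (\<lambda>x. p x * g x))\<^sup>2
      \<le> (\<Sum>j\<in>indN M. (wt (r / 2) (fst j) * b j)\<^sup>2) * (\<Sum>j\<in>indN M. (wt (- r / 2) (fst j) * \<nu> (E j))\<^sup>2)"
    using Cauchy_Schwarz_ineq_sum by simp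
  also have "\<dots> = (\<Sum>j\<in>indN M. wt r (fst j) * (b j)\<^sup>2) * (\<Sum>j\<in>indN M. wt (- r) (fst j) * (\<nu> (E j))\<^sup>2)"
    by (simp only: power_mult_distrib wt_half)
  also have "\<dots> \<le> (B\<^sup>2 * (3 powr r * wt r l * S)) * (sobolev_norm d Z Y (- r) \<nu>)\<^sup>2"
  proof (rule mult_mono)
    have "(\<Sum>j\<in>indN M. wt r (fst j) * (b j)\<^sup>2) \<le> B\<^sup>2 * (\<Sum>i\<in>indN N. wt r (fst i + l) * (a i)\<^sup>2)"
      unfolding b_def g_def by (rule product_weighted_coefficients[OF p B(2) r])
    also have "(\<Sum>i\<in>indN N. wt r (fst i + l) * (a i)\<^sup>2) \<le> (\<Sum>i\<in>indN N. (3 powr r * (wt r (fst i) * wt r l)) * (a i)\<^sup>2)"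
      by (intro sum_mono mult_right_mono wt_add_degree r) auto
    also have "\<dots> = 3 powr r * wt r l * S" by (simp add: S_def sum_distrib_left mult_ac)
    finally show "(\<Sum>j\<in>indN M. wt r (fst j) * (b j)\<^sup>2) \<le> B\<^sup>2 * (3 powr r * wt r l * S)"
      by (simp add: mult_left_mono)
    show "0 \<le> B\<^sup>2 * (3 powr r * wt r l * S)" using S0 by (simp add: less_imp_le)
  qed (auto intro!: sum_le_sobolev_norm \<nu>(2) sum_nonneg mult_nonneg_nonneg less_imp_le[OF wt_pos])
  also have "\<dots> = ((B * (3 powr (r / 2) * wt (r / 2) l)) * sobolev_norm d Z Y (- r) \<nu> * sqrt S)\<^sup>2"
  proof -
    have "(3 powr (r / 2))\<^sup>2 = (3::real) powr r" by (simp add: power2_eq_square flip: powr_add)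
    then show ?thesis by (simp add: power_mult_distrib wt_half S0 mult_ac)
  qed
  finally have "\<bar>\<nu> (\<lambda>x. p x * g x)\<bar> \<le> \<bar>(B * (3 powr (r / 2) * wt (r / 2) l)) * sobolev_norm d Z Y (- r) \<nu> * sqrt S\<bar>"
    by (simp only: abs_le_square_iff)
  also have "\<dots> = (B * (3 powr (r / 2) * wt (r / 2) l)) * sobolev_norm d Z Y (- r) \<nu> * sqrt S"
    using B(1) S0 sobolev_norm_nonneg[OF \<nu>(2)]
    by (intro abs_of_nonneg mult_nonneg_nonneg) (simp_all add: less_imp_le)
  finally show ?thesis by (simp only: S_def g_def)
qed

section \<open>Expansion of a Sobolev function by degrees\<close>

definition proj :: "(real^'n \<Rightarrow> real) \<Rightarrow> nat \<Rightarrow> real^'n \<Rightarrow> real" where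
  "proj f l x = (\<Sum>k=1..Z l. of_fun f (Y l k) * Y l k x)"

definition proj_norm :: "(real^'n \<Rightarrow> real) \<Rightarrow> nat \<Rightarrow> real" where
  "proj_norm f l = sqrt (\<Sum>k=1..Z l. (of_fun f (Y l k))\<^sup>2)"

lemma proj_norm_nonneg: "proj_norm f l \<ge> 0" by (simp add: proj_norm_def sum_nonneg)

lemma sphere_poly_proj: "sphere_poly l (proj f l)"
  unfolding proj_def using sphere_poly_E
  by (intro sphere_poly_sum sphere_poly_scale) (force simp: ind_def E_def)

lemma sum_proj: "(\<Sum>l<n. proj f l x) = (\<Sum>i\<in>indN n. of_fun f (E i) * E i x)"
  by (simp add: sum_indN proj_def E_def)

lemma abs_proj_le:
  assumes "norm x = 1" shows "\<bar>proj f l x\<bar> \<le> sqrt (Z l) * proj_norm f l"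
proof -
  have "(proj f l x)\<^sup>2 \<le> (\<Sum>k=1..Z l. (of_fun f (Y l k))\<^sup>2) * (\<Sum>k=1..Z l. (Y l k x)\<^sup>2)"
    unfolding proj_def by (rule Cauchy_Schwarz_ineq_sum)
  also have "\<dots> = (sqrt (Z l) * proj_norm f l)\<^sup>2"
    unfolding addition_formula[OF assms] by (simp add: proj_norm_def power_mult_distrib sum_nonneg)
  finally show ?thesis
    unfolding abs_le_square_iff[symmetric] using proj_norm_nonneg[of f l] by simp
qed

lemma sum_proj_bound:
  assumes f: "summable (sobolev_term d Z Y s (of_fun f))" and s: "s > real d / 2 + r"
  shows "(\<Sum>l<n. (sqrt (Z l) * proj_norm f l) * wt (r / 2) l)
           \<le> sqrt (\<Sum>l. wt (r - s) l * Z l) * sobolev_norm d Z Y s (of_fun f)"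
proof -
  have sA: "summable (\<lambda>l. wt (r - s) l * Z l)"
    using summable_dimension[of "s - r"] s by (simp add: wt_def)
  have "((\<Sum>l<n. (sqrt (Z l) * proj_norm f l) * wt (r / 2) l))\<^sup>2
      = (\<Sum>l<n. (wt ((r - s) / 2) l * sqrt (Z l)) * (wt (s / 2) l * proj_norm f l))\<^sup>2"
  proof (intro arg_cong[where f="\<lambda>x. x\<^sup>2"] sum.cong refl)
    fix l
    \<comment> \<open>This splitting leaves the dimensions with a summable weight and the
      coefficients with the weight of order \<open>s\<close>.\<close>
    have "wt (r / 2) l = wt ((r - s) / 2) l * wt (s / 2) l"
      by (simp flip: wt_add add: diff_divide_distrib)
    then show "(sqrt (Z l) * proj_norm f l) * wt (r / 2) l = (wt ((r - s) / 2) l * sqrt (Z l)) * (wt (s / 2) l * proj_norm f l)"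
      by simp
  qed
  also have "\<dots> \<le> (\<Sum>l<n. (wt ((r - s) / 2) l * sqrt (Z l))\<^sup>2) * (\<Sum>l<n. (wt (s / 2) l * proj_norm f l)\<^sup>2)"
    by (rule Cauchy_Schwarz_ineq_sum)
  also have "\<dots> = (\<Sum>l<n. wt (r - s) l * Z l) * (\<Sum>l<n. sobolev_term d Z Y s (of_fun f) l)"
    by (simp add: power_mult_distrib wt_half proj_norm_def sum_nonneg sobolev_term_def wt_def[symmetric])
  also have "\<dots> \<le> (\<Sum>l. wt (r - s) l * Z l) * (\<Sum>l. sobolev_term d Z Y s (of_fun f) l)"
    by (intro mult_mono sum_le_suminf sA f)
       (auto intro!: sum_nonneg suminf_nonneg sA mult_nonneg_nonneg less_imp_le[OF wt_pos] sobolev_term_nonneg)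
  also have "\<dots> = (sqrt (\<Sum>l. wt (r - s) l * Z l) * sobolev_norm d Z Y s (of_fun f))\<^sup>2"
    by (simp add: power_mult_distrib sobolev_norm_def suminf_nonneg sA f sobolev_term_nonneg less_imp_le)
  finally show ?thesis
    by (rule power2_le_imp_le)
       (auto intro!: mult_nonneg_nonneg sobolev_norm_nonneg f suminf_nonneg sA less_imp_le[OF wt_pos])
qed

text \<open>The bound in \<open>sum_proj_bound\<close>, whose weights are at least one because
  \<open>r \<ge> 0\<close>, feeds the Weierstrass test. The limit is continuous and has the
  coefficients of \<open>f\<close>; completeness identifies the two.\<close>

lemma proj_uniform_limit:
  assumes f: "continuous_on (sphere 0 1) f" "summable (sobolev_term d Z Y s (of_fun f))"
    and s: "s > real d / 2 + r" "r \<ge> 0"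
  shows "uniform_limit (sphere 0 1) (\<lambda>n x. \<Sum>l<n. proj f l x) f sequentially"
proof -
  have "summable (\<lambda>l. sqrt (Z l) * proj_norm f l)"
  proof (rule summableI_nonneg_bounded)
    fix n
    have "(\<Sum>l<n. sqrt (Z l) * proj_norm f l) \<le> (\<Sum>l<n. (sqrt (Z l) * proj_norm f l) * wt (r / 2) l)"
    proof (rule sum_mono)
      fix l
      show "sqrt (Z l) * proj_norm f l \<le> (sqrt (Z l) * proj_norm f l) * wt (r / 2) l"
        using mult_left_mono[OF wt_ge_1[of "r / 2" l], of "sqrt (Z l) * proj_norm f l"] s(2) proj_norm_nonneg[of f l]
        by simp
    qed
    also have "\<dots> \<le> sqrt (\<Sum>l. wt (r - s) l * Z l) * sobolev_norm d Z Y s (of_fun f)"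
      by (rule sum_proj_bound[OF f(2) s(1)])
    finally show "(\<Sum>l<n. sqrt (Z l) * proj_norm f l) \<le> sqrt (\<Sum>l. wt (r - s) l * Z l) * sobolev_norm d Z Y s (of_fun f)" .
  qed (simp add: proj_norm_nonneg)
  then have ul: "uniform_limit (sphere 0 1) (\<lambda>n x. \<Sum>l<n. proj f l x) (\<lambda>x. \<Sum>l. proj f l x) sequentially"
    by (intro Weierstrass_m_test) (auto simp: abs_proj_le)
  define h where "h x = (\<Sum>l. proj f l x)" for x
  note ul = ul[folded h_def]
  have contS: "continuous_on (sphere 0 1) (\<lambda>x. \<Sum>l<n. proj f l x)" for n
    by (intro continuous_intros sphere_poly_continuous[OF sphere_poly_proj])
  have conth: "continuous_on (sphere 0 1) h"
    by (rule uniform_limit_theorem[OF _ ul]) (auto simp: contS)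
  have "of_fun (\<lambda>x. f x - h x) (E i) = 0" if i: "i \<in> ind" for i
  proof -
    obtain B where B: "0 \<le> B" "\<And>x. norm x = 1 \<Longrightarrow> \<bar>E i x\<bar> \<le> B"
      using continuous_sphere_bounded[OF continuous_E[OF i]] by blast
    have "\<bar>of_fun (\<lambda>x. f x - h x) (E i)\<bar> \<le> 0 + e" if e: "e > 0" for e
    proof -
      have "e / (B + 1) > 0" using e B by simp
      with ul have "\<forall>\<^sub>F n in sequentially. \<forall>x\<in>sphere 0 1. dist (\<Sum>l<n. proj f l x) (h x) < e / (B + 1)"
        unfolding uniform_limit_iff by blast
      \<comment> \<open>From this \<open>n\<close> on, the partial sum contains the degree of
        \<open>E i\<close> and so has the same coefficient there as \<open>f\<close>.\<close>
      then obtain n where n: "n \<ge> Suc (fst i)" "\<forall>x\<in>sphere 0 1. dist (\<Sum>l<n. proj f l x) (h x) < e / (B + 1)"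
        unfolding eventually_sequentially by (meson le_cases)
      define S where "S x = (\<Sum>l<n. proj f l x)" for x
      have cS: "continuous_on (sphere 0 1) S" unfolding S_def by (rule contS)
      have "of_fun S (E i) = of_fun f (E i)"
        unfolding S_def sum_proj using i n(1) indN_subset by (subst of_fun_lincomb_E) (auto simp: indN_iff)
      then have "of_fun (\<lambda>x. f x - h x) (E i) = (\<integral>x. (S x - h x) * E i x \<partial>sphere_measure)"
        unfolding of_fun_def left_diff_distrib using i
        by (subst (1 2) Bochner_Integration.integral_diff)
           (auto intro!: integrable_sphere continuous_intros continuous_E f conth cS)
      moreover have "\<bar>\<integral>x. (S x - h x) * E i x \<partial>sphere_measure\<bar> \<le> (\<integral>x. \<bar>(S x - h x) * E i x\<bar> \<partial>sphere_measure)"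
        by (rule integral_abs_bound)
      moreover have "(\<integral>x. \<bar>(S x - h x) * E i x\<bar> \<partial>sphere_measure) \<le> (\<integral>x. e \<partial>(sphere_measure :: (real^'n) measure))"
      proof (rule integral_sphere_mono)
        fix x :: "real^'n" assume x: "norm x = 1"
        have "\<bar>(S x - h x) * E i x\<bar> \<le> e / (B + 1) * B"
          unfolding abs_mult using n(2) x B by (intro mult_mono) (auto simp: S_def dist_real_def less_imp_le)
        also have "\<dots> \<le> e" using B e by (simp add: field_simps)
        finally show "\<bar>(S x - h x) * E i x\<bar> \<le> e" .
      qed (intro continuous_intros cS conth continuous_E i)+
      ultimately show ?thesis by (simp only: integral_sphere_const)
    qed
    then have "\<bar>of_fun (\<lambda>x. f x - h x) (E i)\<bar> \<le> 0" by (rule field_le_epsilon)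
    then show ?thesis by simp
  qed
  then have "f x - h x = 0" if "norm x = 1" for x
    using continuous_orthogonal_eq_0[of "\<lambda>x. f x - h x" x] that continuous_on_diff[OF f(1) conth] by blast
  then have "h x = f x" if "x \<in> sphere 0 1" for x using that by simp
  then show ?thesis using ul by (subst (asm) uniform_limit_cong'[of _ _ _ _ f]) auto
qed

text \<open>Partial sums of \<open>f\<close> satisfy the estimate degree by degree with a bound
  independent of their length. The sup-norm continuity of \<open>\<nu>\<close> serves only for the
  passage to the limit, so its constant does not enter the result.\<close>

lemma pairing_multiplication_bound:
  assumes \<nu>: "sup_bounded \<nu>" "summable (sobolev_term d Z Y (- r) \<nu>)"
    and f: "continuous_on (sphere 0 1) f" "summable (sobolev_term d Z Y s (of_fun f))"
    and s: "s > real d / 2 + r" "r \<ge> 0"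
  shows "\<bar>\<nu> (\<lambda>x. f x * (\<Sum>i\<in>indN N. a i * E i x))\<bar>
           \<le> (3 powr (r / 2) * sqrt (\<Sum>l. wt (r - s) l * Z l)) * sobolev_norm d Z Y s (of_fun f)
               * sobolev_norm d Z Y (- r) \<nu> * sqrt (\<Sum>i\<in>indN N. wt r (fst i) * (a i)\<^sup>2)"
proof -
  define g where "g x = (\<Sum>i\<in>indN N. a i * E i x)" for x
  define G where "G = sobolev_norm d Z Y (- r) \<nu> * sqrt (\<Sum>i\<in>indN N. wt r (fst i) * (a i)\<^sup>2)"
  have G: "G \<ge> 0" unfolding G_def
    by (intro mult_nonneg_nonneg sobolev_norm_nonneg \<nu> real_sqrt_ge_zero sum_nonneg less_imp_le[OF wt_pos]) auto
  define b where "b l = sqrt (Z l) * proj_norm f l" for l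
  define R where "R = 3 powr (r / 2) * (sqrt (\<Sum>l. wt (r - s) l * Z l) * sobolev_norm d Z Y s (of_fun f)) * G"
  have cg: "continuous_on (sphere 0 1) g" unfolding g_def using indN_subset by (rule continuous_lincomb)
  have cproj: "continuous_on (sphere 0 1) (proj f l)" for l
    by (rule sphere_poly_continuous[OF sphere_poly_proj])
  have partial: "\<bar>\<nu> (\<lambda>x. (\<Sum>l<n. proj f l x) * g x)\<bar> \<le> R" for n
  proof -
    have "\<nu> (\<lambda>x. (\<Sum>l<n. proj f l x) * g x) = (\<Sum>l<n. \<nu> (\<lambda>x. proj f l x * g x))"
      using sup_bounded_sum[OF \<nu>(1), of "{..<n}" "\<lambda>l x. proj f l x * g x" "\<lambda>_. 1"]
      by (simp add: sum_distrib_right continuous_on_mult cproj cg)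
    also have "\<bar>\<dots>\<bar> \<le> (\<Sum>l<n. \<bar>\<nu> (\<lambda>x. proj f l x * g x)\<bar>)" by (rule sum_abs)
    also have "\<dots> \<le> (\<Sum>l<n. 3 powr (r / 2) * (b l * wt (r / 2) l) * G)"
    proof (rule sum_mono)
      fix l
      show "\<bar>\<nu> (\<lambda>x. proj f l x * g x)\<bar> \<le> 3 powr (r / 2) * (b l * wt (r / 2) l) * G"
        using pairing_product_bound[OF \<nu> sphere_poly_proj[of l f] _ abs_proj_le s(2), where a=a and N=N] proj_norm_nonneg[of f l]
        by (simp add: g_def G_def b_def mult_ac)
    qed
    also have "\<dots> = 3 powr (r / 2) * (\<Sum>l<n. b l * wt (r / 2) l) * G"
      by (simp add: sum_distrib_left sum_distrib_right)
    also have "\<dots> \<le> R"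
      unfolding R_def b_def by (intro mult_right_mono mult_left_mono sum_proj_bound f s G) auto
    finally show ?thesis .
  qed
  obtain K where K: "K \<ge> 0" "\<And>f B. continuous_on (sphere 0 1) f \<Longrightarrow> (\<And>x. norm x = 1 \<Longrightarrow> \<bar>f x\<bar> \<le> B) \<Longrightarrow> \<bar>\<nu> f\<bar> \<le> K * B"
    using sup_bounded_bound[OF \<nu>(1)] by blast
  obtain B where B: "0 \<le> B" "\<And>x. norm x = 1 \<Longrightarrow> \<bar>g x\<bar> \<le> B" using continuous_sphere_bounded[OF cg] by blast
  have "\<bar>\<nu> (\<lambda>x. f x * g x)\<bar> \<le> R + e" if e: "e > 0" for e
  proof -
    \<comment> \<open>The added one in \<open>K * B + 1\<close> keeps the tolerance defined when
      \<open>K\<close> or \<open>B\<close> is zero.\<close>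
    have KB: "K * B \<ge> 0" using K(1) B(1) by simp
    then have "e / (K * B + 1) > 0" using e by simp
    with proj_uniform_limit[OF f s]
    have "\<forall>\<^sub>F n in sequentially. \<forall>x\<in>sphere 0 1. dist (\<Sum>l<n. proj f l x) (f x) < e / (K * B + 1)"
      unfolding uniform_limit_iff by blast
    then obtain n where n: "\<forall>x\<in>sphere 0 1. dist (\<Sum>l<n. proj f l x) (f x) < e / (K * B + 1)"
      unfolding eventually_sequentially by blast
    define S where "S x = (\<Sum>l<n. proj f l x)" for x
    have cS: "continuous_on (sphere 0 1) S" unfolding S_def by (intro continuous_intros cproj)
    have "\<bar>\<nu> (\<lambda>x. f x * g x - S x * g x)\<bar> \<le> K * (e / (K * B + 1) * B)"
    proof (rule K(2))
      fix x :: "real^'n" assume x: "norm x = 1"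
      have "\<bar>f x * g x - S x * g x\<bar> = \<bar>S x - f x\<bar> * \<bar>g x\<bar>"
        by (simp add: abs_mult[symmetric] abs_minus_commute left_diff_distrib)
      also have "\<dots> \<le> e / (K * B + 1) * B"
        using n x B by (intro mult_mono) (auto simp: S_def dist_real_def less_imp_le)
      finally show "\<bar>f x * g x - S x * g x\<bar> \<le> e / (K * B + 1) * B" .
    qed (intro continuous_intros f cS cg)
    also have "\<dots> = e / (K * B + 1) * (K * B)" by simp
    also have "\<dots> \<le> e" using KB e by (simp add: field_simps)
    finally have "\<bar>\<nu> (\<lambda>x. f x * g x) - \<nu> (\<lambda>x. S x * g x)\<bar> \<le> e"
      by (simp add: sup_bounded_diff[OF \<nu>(1)] continuous_on_mult f cS cg)
    then show ?thesis using partial[of n] by (simp add: S_def)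
  qed
  then have "\<bar>\<nu> (\<lambda>x. f x * g x)\<bar> \<le> R" by (rule field_le_epsilon)
  then show ?thesis by (simp add: g_def R_def G_def mult_ac)
qed

text \<open>The coefficients \<open>a i = wt (- r) (fst i) * u (E i)\<close> form the extremal test
  function: its pairing with \<open>u\<close> and its squared norm of order \<open>r\<close> are
  both the partial sum \<open>A\<close>. The pairing bound becomes
  \<open>A \<le> C * sqrt A\<close>.\<close>

proposition multiplication_negative_sobolev:
  assumes \<nu>: "sup_bounded \<nu>" "summable (sobolev_term d Z Y (- r) \<nu>)"
    and f: "continuous_on (sphere 0 1) f" "summable (sobolev_term d Z Y s (of_fun f))"
    and s: "s > real d / 2 + r" "r \<ge> 0"
  shows "summable (sobolev_term d Z Y (- r) (\<lambda>\<phi>. \<nu> (\<lambda>x. f x * \<phi> x)))"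
    and "sobolev_norm d Z Y (- r) (\<lambda>\<phi>. \<nu> (\<lambda>x. f x * \<phi> x))
           \<le> (3 powr (r / 2) * sqrt (\<Sum>l. wt (r - s) l * Z l)) * sobolev_norm d Z Y s (of_fun f)
               * sobolev_norm d Z Y (- r) \<nu>"
proof -
  define u where "u \<phi> = \<nu> (\<lambda>x. f x * \<phi> x)" for \<phi>
  define C where "C = (3 powr (r / 2) * sqrt (\<Sum>l. wt (r - s) l * Z l)) * sobolev_norm d Z Y s (of_fun f)
               * sobolev_norm d Z Y (- r) \<nu>"
  have "summable (\<lambda>l. wt (r - s) l * Z l)"
    using summable_dimension[of "s - r"] s by (simp add: wt_def)
  then have C: "C \<ge> 0" unfolding C_def
    by (intro mult_nonneg_nonneg sobolev_norm_nonneg \<nu> f real_sqrt_ge_zero suminf_nonneg less_imp_le[OF wt_pos]) auto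
  have "(\<Sum>i\<in>indN N. wt (- r) (fst i) * (u (E i))\<^sup>2) \<le> C\<^sup>2" for N
  proof -
    define A where "A = (\<Sum>i\<in>indN N. wt (- r) (fst i) * (u (E i))\<^sup>2)"
    define a where "a i = wt (- r) (fst i) * u (E i)" for i
    have A0: "A \<ge> 0" unfolding A_def by (intro sum_nonneg mult_nonneg_nonneg less_imp_le[OF wt_pos]) auto
    have "A = (\<Sum>i\<in>indN N. a i * \<nu> (\<lambda>x. f x * E i x))"
      by (simp add: A_def a_def u_def power2_eq_square mult.assoc)
    also have "\<dots> = \<nu> (\<lambda>x. \<Sum>i\<in>indN N. a i * (f x * E i x))"
      by (rule sup_bounded_sum[OF \<nu>(1), symmetric]) (auto intro!: continuous_intros f continuous_E simp: indN_iff)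
    also have "\<dots> = \<nu> (\<lambda>x. f x * (\<Sum>i\<in>indN N. a i * E i x))"
      by (simp add: sum_distrib_left mult.left_commute)
    finally have "A \<le> C * sqrt (\<Sum>i\<in>indN N. wt r (fst i) * (a i)\<^sup>2)"
      using pairing_multiplication_bound[OF \<nu> f s, of a N] unfolding C_def by linarith
    also have "(\<Sum>i\<in>indN N. wt r (fst i) * (a i)\<^sup>2) = A"
      unfolding A_def
    proof (rule sum.cong)
      fix i
      have "wt r (fst i) * (a i)\<^sup>2 = (wt r (fst i) * wt (- r) (fst i)) * (wt (- r) (fst i) * (u (E i))\<^sup>2)"
        by (simp add: a_def power2_eq_square mult_ac)
      then show "wt r (fst i) * (a i)\<^sup>2 = wt (- r) (fst i) * (u (E i))\<^sup>2" by (simp only: wt_inverse mult_1)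
    qed simp
    finally have "sqrt A * sqrt A \<le> C * sqrt A" using A0 by simp
    then have "sqrt A \<le> C"
      using A0 C mult_right_le_imp_le[of "sqrt A" "sqrt A" C] by (cases "A = 0") auto
    then show ?thesis using sqrt_le_D[of A C] by (simp add: A_def)
  qed
  then show "summable (sobolev_term d Z Y (- r) (\<lambda>\<phi>. \<nu> (\<lambda>x. f x * \<phi> x)))"
    "sobolev_norm d Z Y (- r) (\<lambda>\<phi>. \<nu> (\<lambda>x. f x * \<phi> x)) \<le> (3 powr (r / 2) * sqrt (\<Sum>l. wt (r - s) l * Z l)) * sobolev_norm d Z Y s (of_fun f)
               * sobolev_norm d Z Y (- r) \<nu>"
    using sobolev_norm_leI[of "- r" u C] C by (auto simp: u_def[abs_def] C_def)
qed

end

section \<open>Distributions\<close>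

context
  fixes \<phi> :: "'a::euclidean_space \<Rightarrow> real"
  assumes \<phi>: "\<phi> \<in> test_functions"
begin

lemma partials_test_function_bounded:
  assumes "set bs \<subseteq> Basis"
  shows "\<exists>B\<ge>0. \<forall>x. norm x = 1 \<longrightarrow> \<bar>partials bs (\<lambda>y. \<phi> (sgn y)) x\<bar> \<le> B"
proof -
  have diff: "x \<noteq> 0 \<Longrightarrow> partials bs (\<lambda>y. \<phi> (sgn y)) differentiable (at x)" for x
    using \<phi> assms unfolding test_functions_def smooth_on_def by auto
  have "continuous_on (sphere 0 1) (partials bs (\<lambda>y. \<phi> (sgn y)))"
  proof (rule continuous_at_imp_continuous_on, rule ballI)
    fix x :: 'a assume "x \<in> sphere 0 1"
    then have "x \<noteq> 0" by auto
    then show "isCont (partials bs (\<lambda>y. \<phi> (sgn y))) x" using diff differentiable_imp_continuous_within by blast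
  qed
  then show ?thesis using continuous_sphere_bounded by metis
qed

text \<open>Finitely many lists and a compact sphere. Boundedness is what gives the real supremum in
  \<open>Ck_norm\<close> its intended meaning.\<close>

lemma bdd_above_partials:
  "bdd_above ((\<lambda>(bs, x). \<bar>partials bs (\<lambda>y. \<phi> (sgn y)) x\<bar>)
     ` ({bs. set bs \<subseteq> Basis \<and> length bs \<le> N} \<times> sphere 0 1))"
proof -
  define L where "L = {bs :: 'a list. set bs \<subseteq> Basis \<and> length bs \<le> N}"
  have fin: "finite L" unfolding L_def by (rule finite_lists_length_le) simp
  have "\<forall>bs\<in>L. \<exists>B. B \<ge> 0 \<and> (\<forall>x. norm x = 1 \<longrightarrow> \<bar>partials bs (\<lambda>y. \<phi> (sgn y)) x\<bar> \<le> B)"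
    using partials_test_function_bounded by (auto simp: L_def)
  then obtain B where B: "\<And>bs. bs \<in> L \<Longrightarrow> B bs \<ge> 0"
    "\<And>bs x. bs \<in> L \<Longrightarrow> norm x = 1 \<Longrightarrow> \<bar>partials bs (\<lambda>y. \<phi> (sgn y)) x\<bar> \<le> B bs"
    unfolding bchoice_iff by blast
  have "\<bar>partials bs (\<lambda>y. \<phi> (sgn y)) x\<bar> \<le> (\<Sum>bs\<in>L. B bs)" if "bs \<in> L" "norm x = 1" for bs x
    using B(2)[OF that] member_le_sum[OF that(1) B(1) fin] by force
  then show ?thesis unfolding L_def[symmetric] by (intro bdd_aboveI2[of _ _ "\<Sum>bs\<in>L. B bs"]) auto
qed

lemma abs_le_Ck_norm:
  assumes "norm y = 1" shows "\<bar>\<phi> y\<bar> \<le> Ck_norm N \<phi>"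
proof -
  have "(case ([] :: 'a list, y) of (bs, x) \<Rightarrow> \<bar>partials bs (\<lambda>y. \<phi> (sgn y)) x\<bar>) \<le> Ck_norm N \<phi>"
    unfolding Ck_norm_def by (rule cSUP_upper[OF _ bdd_above_partials]) (use assms in simp)
  moreover have "sgn y = y" using assms by (simp add: sgn_div_norm)
  ultimately show ?thesis by simp
qed

lemma Ck_norm_nonneg: "Ck_norm N \<phi> \<ge> 0"
proof -
  obtain y :: 'a where "y \<in> Basis" using nonempty_Basis by blast
  then show ?thesis using abs_le_Ck_norm[of y N] by (simp add: norm_Basis)
qed

lemma Ck_norm_mono:
  assumes "M \<le> N" shows "Ck_norm M \<phi> \<le> Ck_norm N \<phi>"
  unfolding Ck_norm_def
proof (rule cSUP_subset_mono[OF _ bdd_above_partials])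
  obtain y :: 'a where "y \<in> Basis" using nonempty_Basis by blast
  then have "([], y) \<in> {bs :: 'a list. set bs \<subseteq> Basis \<and> length bs \<le> M} \<times> sphere 0 1" by (simp add: norm_Basis)
  then show "{bs :: 'a list. set bs \<subseteq> Basis \<and> length bs \<le> M} \<times> sphere (0::'a) 1 \<noteq> {}" by blast
qed (use assms in auto)

end

lemma distribution_dirac: "norm y = 1 \<Longrightarrow> distribution (dirac (y :: 'a::euclidean_space))"
  unfolding distribution_def dirac_def
  by (intro conjI exI[of _ 0] exI[of _ 1]) (auto simp: abs_le_Ck_norm)

lemma distribution_lincomb:
  fixes u v :: "'a::euclidean_space functional"
  assumes u: "distribution u" and v: "distribution v"
  shows "distribution (\<lambda>\<phi>. a * u \<phi> + b * v \<phi>)"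
proof -
  obtain N C where N: "\<And>\<phi>. \<phi> \<in> test_functions \<Longrightarrow> \<bar>u \<phi>\<bar> \<le> C * Ck_norm N \<phi>"
    using u unfolding distribution_def by blast
  obtain M D where M: "\<And>\<phi>. \<phi> \<in> test_functions \<Longrightarrow> \<bar>v \<phi>\<bar> \<le> D * Ck_norm M \<phi>"
    using v unfolding distribution_def by blast
  \<comment> \<open>Absolute values appear because the constants in the definition of
    \<open>distribution\<close> carry no sign.\<close>
  have "\<bar>a * u \<phi> + b * v \<phi>\<bar> \<le> (\<bar>a\<bar> * \<bar>C\<bar> + \<bar>b\<bar> * \<bar>D\<bar>) * Ck_norm (max M N) \<phi>" if \<phi>: "\<phi> \<in> test_functions" for \<phi>
  proof -
    have "\<bar>u \<phi>\<bar> \<le> \<bar>C\<bar> * Ck_norm (max M N) \<phi>"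
      by (rule order_trans[OF N[OF \<phi>]]) (intro mult_mono Ck_norm_mono \<phi> Ck_norm_nonneg, auto)
    moreover have "\<bar>v \<phi>\<bar> \<le> \<bar>D\<bar> * Ck_norm (max M N) \<phi>"
      by (rule order_trans[OF M[OF \<phi>]]) (intro mult_mono Ck_norm_mono \<phi> Ck_norm_nonneg, auto)
    ultimately have "\<bar>a\<bar> * \<bar>u \<phi>\<bar> + \<bar>b\<bar> * \<bar>v \<phi>\<bar>
        \<le> \<bar>a\<bar> * (\<bar>C\<bar> * Ck_norm (max M N) \<phi>) + \<bar>b\<bar> * (\<bar>D\<bar> * Ck_norm (max M N) \<phi>)"
      by (intro add_mono mult_left_mono) auto
    then show ?thesis
      using abs_triangle_ineq[of "a * u \<phi>" "b * v \<phi>"] by (simp add: abs_mult algebra_simps)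
  qed
  then show ?thesis using u v unfolding distribution_def
    by (intro conjI exI[of _ "max M N"] exI[of _ "\<bar>a\<bar> * \<bar>C\<bar> + \<bar>b\<bar> * \<bar>D\<bar>"]) (auto simp: algebra_simps)
qed

lemma distribution_sum:
  fixes u :: "'i \<Rightarrow> 'a::euclidean_space functional"
  shows "(\<And>j. j \<in> A \<Longrightarrow> distribution (u j)) \<Longrightarrow> distribution (\<lambda>\<phi>. \<Sum>j\<in>A. c j * u j \<phi>)"
proof (induction A rule: infinite_finite_induct)
  case (insert j A)
  have "distribution (\<lambda>\<phi>. c j * u j \<phi> + 1 * (\<Sum>j\<in>A. c j * u j \<phi>))"
    by (intro distribution_lincomb insert) auto
  then show ?case using insert.hyps by simp
qed (auto simp: distribution_def intro!: exI[of _ 0])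

lemma distribution_diff:
  "distribution u \<Longrightarrow> distribution v \<Longrightarrow> distribution (u - v :: 'a::euclidean_space functional)"
  using distribution_lincomb[of u v 1 "-1"] by (simp add: fun_diff_def)

section \<open>The error estimate\<close>

lemma sup_bounded_dirac: "norm y = 1 \<Longrightarrow> sup_bounded (dirac (y :: 'a::euclidean_space))"
  unfolding sup_bounded_def dirac_def by (intro conjI exI[of _ 1]) auto

lemma sampling_error_eq:
  "sampling_error m w x \<phi> = (\<Sum>j=1..m. w j * \<phi> (x j)) - (\<integral>y. \<phi> y \<partial>sphere_measure)"
  by (simp add: sampling_error_def sampling_measure_def dirac_def)

text \<open>The sum of the absolute weights bounds the variation of the discrete part; the added one
  is the mass of the surface measure.\<close>

lemma sup_bounded_sampling_error:
  fixes x :: "nat \<Rightarrow> 'a::euclidean_space"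
  assumes x: "\<And>j. j \<in> {1..m} \<Longrightarrow> norm (x j) = 1"
  shows "sup_bounded (sampling_error m w x)"
  unfolding sup_bounded_def
proof (intro conjI allI impI exI[of _ "(\<Sum>j=1..m. \<bar>w j\<bar>) + 1"])
  fix f g :: "'a \<Rightarrow> real" assume "continuous_on (sphere 0 1) f" "continuous_on (sphere 0 1) g"
  then show "sampling_error m w x (\<lambda>x. f x + g x) = sampling_error m w x f + sampling_error m w x g"
    by (simp add: sampling_error_eq integrable_sphere sum.distrib algebra_simps)
next
  fix c and f :: "'a \<Rightarrow> real"
  show "sampling_error m w x (\<lambda>x. c * f x) = c * sampling_error m w x f"
    by (simp add: sampling_error_eq sum_distrib_left algebra_simps)
next
  fix f :: "'a \<Rightarrow> real" and B assume f: "continuous_on (sphere 0 1) f" "\<forall>x. norm x = 1 \<longrightarrow> \<bar>f x\<bar> \<le> B"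
  have "\<bar>\<Sum>j=1..m. w j * f (x j)\<bar> \<le> (\<Sum>j=1..m. \<bar>w j\<bar> * B)"
    by (rule order_trans[OF sum_abs]) (auto simp: abs_mult intro!: sum_mono mult_left_mono f(2)[rule_format] x)
  moreover have "\<bar>\<integral>y. f y \<partial>sphere_measure\<bar> \<le> B"
  proof -
    have "\<bar>\<integral>y. f y \<partial>sphere_measure\<bar> \<le> (\<integral>y. \<bar>f y\<bar> \<partial>sphere_measure)" by (rule integral_abs_bound)
    also have "\<dots> \<le> (\<integral>y. B \<partial>(sphere_measure :: 'a measure))"
      by (rule integral_sphere_mono) (use f in \<open>auto intro!: continuous_intros\<close>)
    finally show ?thesis by (simp only: integral_sphere_const)
  qed
  ultimately show "\<bar>sampling_error m w x f\<bar> \<le> ((\<Sum>j=1..m. \<bar>w j\<bar>) + 1) * B"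
    unfolding sampling_error_eq by (simp add: sum_distrib_right distrib_right)
qed (simp add: sum_nonneg)

context harmonic_system
begin

text \<open>The dual of the embedding into continuous functions. Against the extremal test function
  \<open>g\<close>, Cauchy-Schwarz and the addition theorem give
  \<open>\<bar>g x\<bar> \<le> sqrt A * sqrt S\<close>, so the partial sum \<open>A\<close>
  satisfies \<open>A \<le> K * sqrt A * sqrt S\<close>.\<close>

lemma sup_bounded_negative_sobolev:
  assumes \<nu>: "sup_bounded \<nu>" and r: "r > real d / 2"
  shows "summable (sobolev_term d Z Y (- r) \<nu>)"
proof -
  obtain K where K: "K \<ge> 0" "\<And>f B. continuous_on (sphere 0 1) f \<Longrightarrow> (\<And>x. norm x = 1 \<Longrightarrow> \<bar>f x\<bar> \<le> B) \<Longrightarrow> \<bar>\<nu> f\<bar> \<le> K * B"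
    using sup_bounded_bound[OF \<nu>] by blast
  define S where "S = (\<Sum>l. wt (- r) l * Z l)"
  have sS: "summable (\<lambda>l. wt (- r) l * Z l)" using summable_dimension[OF r] by (simp add: wt_def)
  have S: "S \<ge> 0" unfolding S_def by (intro suminf_nonneg sS) (simp add: less_imp_le)
  have "(\<Sum>i\<in>indN N. wt (- r) (fst i) * (\<nu> (E i))\<^sup>2) \<le> (K * sqrt S)\<^sup>2" for N
  proof -
    define A where "A = (\<Sum>i\<in>indN N. wt (- r) (fst i) * (\<nu> (E i))\<^sup>2)"
    define a where "a i = wt (- r) (fst i) * \<nu> (E i)" for i
    define g where "g x = (\<Sum>i\<in>indN N. a i * E i x)" for x
    have A0: "A \<ge> 0" unfolding A_def by (intro sum_nonneg mult_nonneg_nonneg less_imp_le[OF wt_pos]) auto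
    have "A = (\<Sum>i\<in>indN N. a i * \<nu> (E i))"
      by (simp add: A_def a_def power2_eq_square mult.assoc)
    also have "\<dots> = \<nu> g"
      unfolding g_def by (rule sup_bounded_sum[OF \<nu>, symmetric]) (auto intro!: continuous_E simp: indN_iff)
    finally have Ag: "A = \<nu> g" .
    have "\<bar>g x\<bar> \<le> sqrt A * sqrt S" if x: "norm x = 1" for x
    proof -
      have "g x = (\<Sum>i\<in>indN N. (wt (- r / 2) (fst i) * \<nu> (E i)) * (wt (- r / 2) (fst i) * E i x))"
        unfolding g_def a_def by (intro sum.cong refl) (simp add: wt_half[of "- r", symmetric] power2_eq_square)
      then have "(g x)\<^sup>2 \<le> (\<Sum>i\<in>indN N. (wt (- r / 2) (fst i) * \<nu> (E i))\<^sup>2) * (\<Sum>i\<in>indN N. (wt (- r / 2) (fst i) * E i x)\<^sup>2)"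
        using Cauchy_Schwarz_ineq_sum by simp
      also have "\<dots> = A * (\<Sum>i\<in>indN N. wt (- r) (fst i) * (E i x)\<^sup>2)"
        by (simp only: A_def power_mult_distrib wt_half)
      also have "(\<Sum>i\<in>indN N. wt (- r) (fst i) * (E i x)\<^sup>2) = (\<Sum>l<N. wt (- r) l * (\<Sum>k=1..Z l. (Y l k x)\<^sup>2))"
        by (simp add: sum_indN E_def sum_distrib_left)
      also have "\<dots> = (\<Sum>l<N. wt (- r) l * Z l)" by (simp only: addition_formula[OF x])
      also have "\<dots> \<le> S" unfolding S_def by (rule sum_le_suminf[OF sS]) (simp_all add: less_imp_le)
      finally have "(g x)\<^sup>2 \<le> A * S" using A0 by (simp add: mult_left_mono)
      then show ?thesis by (metis real_sqrt_abs real_sqrt_le_mono real_sqrt_mult)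
    qed
    then have "A \<le> K * (sqrt A * sqrt S)"
      using K(2)[of g "sqrt A * sqrt S"] indN_subset continuous_lincomb[of "indN N" a] by (simp add: Ag g_def)
    then have "sqrt A * sqrt A \<le> (K * sqrt S) * sqrt A" using A0 by (simp add: mult_ac)
    moreover have "K * sqrt S \<ge> 0" using K(1) S by simp
    ultimately have "sqrt A \<le> K * sqrt S"
      using A0 mult_right_le_imp_le[of "sqrt A" "sqrt A" "K * sqrt S"] by (cases "A = 0") auto
    then show ?thesis using sqrt_le_D[of A "K * sqrt S"] by (simp add: A_def)
  qed
  then show ?thesis using K(1) S by (intro sobolev_norm_leI(1)[of "- r" \<nu> "K * sqrt S"]) simp_all
qed

lemma dirac_sobolev:
  assumes "norm y = 1" "r > real d / 2" shows "dirac y \<in> sobolev d Z Y (- r)"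
  using sup_bounded_negative_sobolev[OF sup_bounded_dirac] distribution_dirac assms by (simp add: sobolev_def)

text \<open>The termwise inequality
  \<open>(u - v)\<^sup>2 \<le> 2 * u\<^sup>2 + 2 * v\<^sup>2\<close> replaces Minkowski's at the
  cost of a constant. Equality is required on the basis functions only, since the norms depend on
  nothing else.\<close>

lemma sobolev_norm_diff_le:
  assumes u: "summable (sobolev_term d Z Y s u)" and v: "summable (sobolev_term d Z Y s v)"
    and eq: "\<And>i. i \<in> ind \<Longrightarrow> w (E i) = u (E i) - v (E i)"
  shows "summable (sobolev_term d Z Y s w)"
    and "sobolev_norm d Z Y s w \<le> 2 * (sobolev_norm d Z Y s u + sobolev_norm d Z Y s v)"
proof -
  define U V where "U = sobolev_norm d Z Y s u" and "V = sobolev_norm d Z Y s v"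
  have UV: "U \<ge> 0" "V \<ge> 0" using u v by (auto simp: U_def V_def sobolev_norm_nonneg)
  have "(\<Sum>i\<in>indN N. wt s (fst i) * (w (E i))\<^sup>2) \<le> (2 * (U + V))\<^sup>2" for N
  proof -
    have "(\<Sum>i\<in>indN N. wt s (fst i) * (w (E i))\<^sup>2)
        \<le> (\<Sum>i\<in>indN N. 2 * (wt s (fst i) * (u (E i))\<^sup>2) + 2 * (wt s (fst i) * (v (E i))\<^sup>2))"
    proof (rule sum_mono)
      fix i assume "i \<in> indN N"
      then have "(w (E i))\<^sup>2 \<le> 2 * (u (E i))\<^sup>2 + 2 * (v (E i))\<^sup>2"
        using eq[of i] sum_squares_bound[of "u (E i)" "- v (E i)"] by (simp add: indN_iff power2_diff)
      then show "wt s (fst i) * (w (E i))\<^sup>2 \<le> 2 * (wt s (fst i) * (u (E i))\<^sup>2) + 2 * (wt s (fst i) * (v (E i))\<^sup>2)"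
        using mult_left_mono[OF _ less_imp_le[OF wt_pos[of s "fst i"]],
            of "(w (E i))\<^sup>2" "2 * (u (E i))\<^sup>2 + 2 * (v (E i))\<^sup>2"]
        by (simp add: algebra_simps)
    qed
    also have "\<dots> = 2 * (\<Sum>i\<in>indN N. wt s (fst i) * (u (E i))\<^sup>2) + 2 * (\<Sum>i\<in>indN N. wt s (fst i) * (v (E i))\<^sup>2)"
      by (simp add: sum.distrib sum_distrib_left)
    also have "\<dots> \<le> 2 * U\<^sup>2 + 2 * V\<^sup>2"
      unfolding U_def V_def by (intro add_mono mult_left_mono sum_le_sobolev_norm u v) auto
    also have "\<dots> \<le> (2 * (U + V))\<^sup>2"
      using UV by (simp add: power2_eq_square algebra_simps)
    finally show ?thesis .
  qed
  then show "summable (sobolev_term d Z Y s w)"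
    "sobolev_norm d Z Y s w \<le> 2 * (sobolev_norm d Z Y s u + sobolev_norm d Z Y s v)"
    using sobolev_norm_leI[of s w "2 * (U + V)"] UV by (auto simp: U_def V_def)
qed

text \<open>By orthogonality only one term of the defining series is nonzero, so no convergence
  question arises, whatever \<open>\<eta>\<close> and \<open>u\<close> are.\<close>

lemma multiplier_op_E:
  assumes j: "j \<in> ind" shows "multiplier_op d Z Y \<eta> u (E j) = \<eta> (eigval d (fst j)) * u (E j)"
proof -
  have orth: "of_fun (Y l k) (E j) = (if (l, k) = j then 1 else 0)" if "k \<in> {1..Z l}" for l k
    using of_fun_E[of "(l, k)" j] that j by (simp add: ind_def E_def)
  define F where "F l = \<eta> (eigval d l) * (\<Sum>k=1..Z l. u (Y l k) * of_fun (Y l k) (E j))" for l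
  have F: "F l = \<eta> (eigval d l) * (\<Sum>k=1..Z l. if (l, k) = j then u (Y l k) else 0)" for l
    unfolding F_def by (intro arg_cong2[where f="(*)"] sum.cong refl) (auto simp: orth)
  have "(\<Sum>l. F l) = (\<Sum>l\<in>{fst j}. F l)"
    by (rule suminf_finite) (auto simp: F intro!: sum.neutral)
  also have "\<dots> = \<eta> (eigval d (fst j)) * u (E j)"
    using j by (cases j) (simp add: F E_def ind_def)
  finally show ?thesis by (simp add: multiplier_op_def F_def)
qed

lemma multiplication_sampling_error:
  "sampling_error m w x (\<lambda>y. f y * \<phi> y) = (\<Sum>j=1..m. (w j * f (x j)) * dirac (x j) \<phi>) - of_fun f \<phi>"
  by (simp add: sampling_error_eq of_fun_def dirac_def mult.assoc)

end

theorem theorem3p2: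
  fixes d :: nat and r q s C1 C2 C3 :: real
    and Z :: "nat \<Rightarrow> nat" and Y :: "nat \<Rightarrow> nat \<Rightarrow> real^'n \<Rightarrow> real"
    and M :: "nat set" and x :: "nat \<Rightarrow> nat \<Rightarrow> real^'n" and w :: "nat \<Rightarrow> nat \<Rightarrow> real"
    and \<eta> :: "nat \<Rightarrow> real \<Rightarrow> real"
  assumes dim: "CARD('n) = d + 1" "d \<ge> 1"
    and basis: "harmonic_basis Z Y"
    and params: "r > real d / 2" "0 \<le> q" "q < s" "s > real d / 2 + r"
    and M: "infinite M" "\<And>m. m \<in> M \<Longrightarrow> m \<ge> 1"
    and points: "\<And>m j. m \<in> M \<Longrightarrow> j \<in> {1..m} \<Longrightarrow> x m j \<in> sphere 0 1"
    and weights: "\<And>m j. m \<in> M \<Longrightarrow> j \<in> {1..m} \<Longrightarrow> w m j > 0"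
      "\<And>m. m \<in> M \<Longrightarrow> (\<Sum>j=1..m. w m j) = 1"
    and sampling: "\<And>m. m \<in> M \<Longrightarrow>
      sobolev_norm d Z Y (- r) (sampling_error m (w m) (x m)) \<le> C1 * mesh_norm m (x m) powr r"
    and approximation: "\<And>n f. n \<ge> 1 \<Longrightarrow> f \<in> sobolev_fun d Z Y s \<Longrightarrow>
      of_fun f - multiplier_op d Z Y (\<eta> n) (of_fun f) \<in> sobolev d Z Y q \<and>
      sobolev_norm d Z Y q (of_fun f - multiplier_op d Z Y (\<eta> n) (of_fun f))
        \<le> C2 * real n powr (- (s - q)) * sobolev_norm d Z Y s (of_fun f)"
    and smoothing: "\<And>n u. n \<ge> 1 \<Longrightarrow> u \<in> sobolev d Z Y (- r) \<Longrightarrow>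
      multiplier_op d Z Y (\<eta> n) u \<in> sobolev d Z Y q \<and>
      sobolev_norm d Z Y q (multiplier_op d Z Y (\<eta> n) u)
        \<le> C3 * real n powr (r + q) * sobolev_norm d Z Y (- r) u"
  shows "\<exists>C>0. \<forall>m\<in>M. \<forall>n\<ge>1. \<forall>f\<in>sobolev_fun d Z Y s.
      of_fun f - hyperinterpolation d Z Y (\<eta> n) m (w m) (x m) f \<in> sobolev d Z Y q \<and>
      sobolev_norm d Z Y q (of_fun f - hyperinterpolation d Z Y (\<eta> n) m (w m) (x m) f)
        \<le> C * (real n powr (- (s - q)) + mesh_norm m (x m) powr r * real n powr (r + q))
            * sobolev_norm d Z Y s (of_fun f)"
proof -
  interpret harmonic_system d Z Y by (rule harmonic_system.intro[OF dim basis])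
  have r0: "r \<ge> 0" using params(1) by (simp add: order.strict_implies_order order.strict_trans1[of 0 "real d / 2" r])
  define K where "K = 3 powr (r / 2) * sqrt (\<Sum>l. wt (r - s) l * Z l)"
  have "summable (\<lambda>l. wt (r - s) l * Z l)"
    using summable_dimension[of "s - r"] params(4) by (simp add: wt_def)
  then have K: "K \<ge> 0" unfolding K_def by (simp add: suminf_nonneg less_imp_le)
  \<comment> \<open>The factor 2 comes from \<open>sobolev_norm_diff_le\<close>, the absolute values
    from constants of unknown sign, and the added one secures \<open>C > 0\<close>.\<close>
  define C where "C = 2 * (\<bar>C2\<bar> + \<bar>C3\<bar> * (K * \<bar>C1\<bar>)) + 1"
  have main: "of_fun f - hyperinterpolation d Z Y (\<eta> n) m (w m) (x m) f \<in> sobolev d Z Y q \<and>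
      sobolev_norm d Z Y q (of_fun f - hyperinterpolation d Z Y (\<eta> n) m (w m) (x m) f)
        \<le> C * (real n powr (- (s - q)) + mesh_norm m (x m) powr r * real n powr (r + q))
            * sobolev_norm d Z Y s (of_fun f)"
    if m: "m \<in> M" and n: "n \<ge> 1" and f: "f \<in> sobolev_fun d Z Y s" for m n f
  proof -
    define \<nu> where "\<nu> = sampling_error m (w m) (x m)"
    define u where "u = (\<lambda>\<phi>. \<nu> (\<lambda>y. f y * \<phi> y))"
    define v where "v = of_fun f - hyperinterpolation d Z Y (\<eta> n) m (w m) (x m) f"
    define a where "a = of_fun f - multiplier_op d Z Y (\<eta> n) (of_fun f)"
    define b where "b = multiplier_op d Z Y (\<eta> n) u"
    define F where "F = sobolev_norm d Z Y s (of_fun f)"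
    have x1: "norm (x m j) = 1" if "j \<in> {1..m}" for j using points[OF m that] by simp
    have fc: "continuous_on (sphere 0 1) f" and fd: "distribution (of_fun f)"
      and fs: "summable (sobolev_term d Z Y s (of_fun f))"
      using f by (auto simp: sobolev_fun_def sobolev_def)
    have F: "F \<ge> 0" unfolding F_def by (rule sobolev_norm_nonneg[OF fs])
    have \<nu>: "sup_bounded \<nu>" unfolding \<nu>_def by (rule sup_bounded_sampling_error[OF x1])
    have \<nu>s: "summable (sobolev_term d Z Y (- r) \<nu>)" by (rule sup_bounded_negative_sobolev[OF \<nu> params(1)])
    have us: "summable (sobolev_term d Z Y (- r) u)"
      and ub: "sobolev_norm d Z Y (- r) u \<le> K * F * sobolev_norm d Z Y (- r) \<nu>"
      unfolding u_def K_def F_def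
      by (rule multiplication_negative_sobolev[OF \<nu> \<nu>s fc fs params(4) r0])+
    \<comment> \<open>As \<open>f\<close> need not be a test function, continuity of
      \<open>u\<close> is not inherited from \<open>\<nu>\<close>; it is read off from this
      combination of Dirac masses and \<open>of_fun f\<close>.\<close>
    have u_eq: "u = (\<lambda>\<phi>. \<Sum>j=1..m. (w m j * f (x m j)) * dirac (x m j) \<phi>) - of_fun f"
      unfolding u_def \<nu>_def by (rule ext) (simp only: multiplication_sampling_error fun_diff_def)
    have "distribution u"
      unfolding u_eq by (intro distribution_diff distribution_sum distribution_dirac fd x1)
    then have "u \<in> sobolev d Z Y (- r)" using us by (simp add: sobolev_def)
    note Tu = smoothing[OF n this, folded b_def]
    note Tf = approximation[OF n f, folded a_def F_def]
    \<comment> \<open>The slice is the multiplier operator applied to a Dirac mass of order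
      \<open>- r\<close>, so the smoothing estimate makes it a distribution.\<close>
    have kd: "distribution (kernel d Z Y (\<eta> n) (x m j))" if "j \<in> {1..m}" for j
      using smoothing[OF n dirac_sobolev[OF x1[OF that] params(1)]] by (simp add: kernel_def sobolev_def)
    have vd: "distribution v"
      unfolding v_def hyperinterpolation_def by (intro distribution_diff distribution_sum kd fd)
    \<comment> \<open>On a basis function the operator is multiplication by a number and commutes
      with the finite sum over the sample points. The decomposition of the error is needed only
      there.\<close>
    have vE: "v (E i) = a (E i) - b (E i)" if i: "i \<in> ind" for i
    proof -
      have "hyperinterpolation d Z Y (\<eta> n) m (w m) (x m) f (E i)
          = \<eta> n (eigval d (fst i)) * (\<Sum>j=1..m. (w m j * f (x m j)) * dirac (x m j) (E i))"
        by (simp add: hyperinterpolation_def kernel_def multiplier_op_E[OF i] sum_distrib_left mult_ac)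
      then show ?thesis
        by (simp add: v_def a_def b_def multiplier_op_E[OF i] u_eq right_diff_distrib)
    qed
    have as: "summable (sobolev_term d Z Y q a)" and bs: "summable (sobolev_term d Z Y q b)"
      using Tf Tu by (auto simp: sobolev_def)
    have vs: "summable (sobolev_term d Z Y q v)"
      "sobolev_norm d Z Y q v \<le> 2 * (sobolev_norm d Z Y q a + sobolev_norm d Z Y q b)"
      using sobolev_norm_diff_le[OF as bs, of v] vE by blast+
    define P Q where "P = real n powr (- (s - q))" and "Q = mesh_norm m (x m) powr r * real n powr (r + q)"
    have PQ: "P \<ge> 0" "Q \<ge> 0" by (simp_all add: P_def Q_def)
    have "sobolev_norm d Z Y q a \<le> C2 * P * F" using Tf by (simp add: P_def)
    also have "\<dots> \<le> \<bar>C2\<bar> * P * F" using PQ F by (intro mult_right_mono) auto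
    finally have a_le: "sobolev_norm d Z Y q a \<le> \<bar>C2\<bar> * P * F" .
    have "sobolev_norm d Z Y q b \<le> C3 * real n powr (r + q) * sobolev_norm d Z Y (- r) u" using Tu by simp
    also have "\<dots> \<le> \<bar>C3\<bar> * real n powr (r + q) * (K * F * (\<bar>C1\<bar> * mesh_norm m (x m) powr r))"
    proof (intro mult_mono)
      have "sobolev_norm d Z Y (- r) \<nu> \<le> \<bar>C1\<bar> * mesh_norm m (x m) powr r"
        unfolding \<nu>_def by (rule order_trans[OF sampling[OF m]]) (intro mult_right_mono, auto)
      then show "sobolev_norm d Z Y (- r) u \<le> K * F * (\<bar>C1\<bar> * mesh_norm m (x m) powr r)"
        using K F by (intro order_trans[OF ub] mult_left_mono) auto
    qed (auto intro: sobolev_norm_nonneg us)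
    also have "\<dots> = \<bar>C3\<bar> * (K * \<bar>C1\<bar>) * Q * F" by (simp add: Q_def mult_ac)
    finally have b_le: "sobolev_norm d Z Y q b \<le> \<bar>C3\<bar> * (K * \<bar>C1\<bar>) * Q * F" .
    have "sobolev_norm d Z Y q v \<le> 2 * (\<bar>C2\<bar> * P * F + \<bar>C3\<bar> * (K * \<bar>C1\<bar>) * Q * F)"
      by (rule order_trans[OF vs(2)]) (intro mult_left_mono add_mono a_le b_le, simp)
    also have "\<dots> \<le> C * (P + Q) * F"
    proof -
      define G where "G = \<bar>C3\<bar> * (K * \<bar>C1\<bar>)"
      have "G \<ge> 0" using K by (simp add: G_def)
      then have "2 * (\<bar>C2\<bar> * P + G * Q) \<le> C * (P + Q)"
        unfolding C_def G_def[symmetric] using PQ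
        by (simp add: algebra_simps)
      from mult_right_mono[OF this F] show ?thesis by (simp add: G_def algebra_simps)
    qed
    finally show ?thesis using vd vs(1) by (simp add: sobolev_def v_def P_def Q_def F_def)
  qed
  have "C > 0" using K by (simp add: C_def add_nonneg_pos)
  then show ?thesis using main by blast
qed

end
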